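(* Let $k$ be a field, $H$ a finite dimensional Hopf algebra over $k$ with antipode $S$, and let $X=(H^{op}\otimes H)\underline{\otimes}(H^*\otimes H^{*op})$ and $Y=H^*\#(H\otimes H^{op})\# H^{*op}$. The map $\varphi:X\to Y$ given by $$\varphi((g\otimes h)\underline{\otimes}(p\otimes q))=\sum h_1\rightharpoonup p\leftharpoonup g_1\,\#\,(h_2\otimes g_2)\,\#\, q$$ is an algebra isomorphism, having the property that $$((g\otimes h)\underline{\otimes}(p\otimes q))\cdot m=\varphi((g\otimes h)\underline{\otimes}(p\otimes q))\cdot m$$ for all $g,h\in H$, $p,q\in H^*$ and $m$ in an $H^*$-Hopf bimodule $M$. The inverse of $\varphi$ is $\varphi^{-1}:Y\to X$, $$\varphi^{-1}(p\#(h\otimes g)\# q)=\sum (g_2\otimes h_2)\underline{\otimes}(S^{-1}(h_1)\rightharpoonup p\leftharpoonup S(g_1)\otimes q).$$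
   Context: Everything is over a fixed field $k$, $\otimes=\otimes_k$, and Sweedler notation is used. $H$ has antipode $S$ (bijective, since $H$ is finite dimensional); $H^*$ is the dual Hopf algebra, with $(pq)(h)=\sum p(h_1)q(h_2)$ and $\sum p_1(h)p_2(h')=p(hh')$. $H^{op}$, $H^{*op}$ denote opposite algebras. Regular actions of $H$ on $H^*$: $(h\rightharpoonup f)(h')=f(h'h)$ and $(f\leftharpoonup h')(h)=f(h'h)$. The algebra $X$ (Cibils–Rosso) has underlying space $H\otimes H\otimes H^*\otimes H^*$, elements written $(g\otimes h)\underline{\otimes}(p\otimes q)$. Its multiplication is determined by: $H^{op}\otimes H$ and $H^*\otimes H^{*op}$ (embedded as $(g\otimes h)\underline{\otimes}(1\otimes1)$ and $(1\otimes 1)\underline{\otimes}(p\otimes q)$) are subalgebras with their natural tensor product multiplications; $(g\otimes h)\underline{\otimes}(p\otimes q)=((g\otimes h)\underline{\otimes}(1\otimes1))((1\otimes1)\underline{\otimes}(p\otimes q))$; and $$((1\otimes1)\underline{\otimes}(p\otimes q))((g\otimes h)\underline{\otimes}(1\otimes1))=\sum (g_2\otimes h_2)\underline{\otimes}(S^{-1}(h_1)\rightharpoonup p\leftharpoonup S(g_1)\otimes S(h_3)\rightharpoonup q\leftharpoonup S^{-1}(g_3)).$$ The algebra $Y$ (a two-sided crossed product) has underlying space $H^*\otimes(H\otimes H)\otimes H^*$, elements written $p\#(h\otimes g)\# q$, unit $1\#(1\otimes1)\#1$, and multiplication $$(p\# (h\otimes g)\# q)(p'\# (h'\otimes g')\#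 q')=\sum p(h_1\rightharpoonup p'\leftharpoonup g_1)\# (h_2h'_1\otimes g'_1g_2)\# q'(S(h'_2)\rightharpoonup q\leftharpoonup S^{-1}(g'_2)),$$ all products on the right being taken in $H$ and $H^*$ (not in the opposite algebras). A Hopf bimodule over $H^*$ is a vector space $M$ that is an $H^*$-bimodule (actions $p\cdot m$, $m\cdot q$) and an $H^*$-bicomodule, with coaction $M\to H^*\otimes M\otimes H^*$, $m\mapsto\sum m_{(-1)}\otimes m_{(0)}\otimes m_{(1)}$, such that the left and right coactions are $H^*$-bimodule maps, i.e. $\sum (p\cdot m\cdot q)_{(-1)}\otimes (p\cdot m\cdot q)_{(0)}\otimes (p\cdot m\cdot q)_{(1)}=\sum p_1m_{(-1)}q_1\otimes p_2\cdot m_{(0)}\cdot q_2\otimes p_3m_{(1)}q_3$. Such an $M$ is a left $X$-module by $$((g\otimes h)\underline{\otimes}(p\otimes q))\cdot m=\sum m_{(-1)}(g_2)m_{(1)}(h_2)(h_1\rightharpoonup p\leftharpoonup g_1)\cdot m_{(0)}\cdot(h_3\rightharpoonup q\leftharpoonup g_3)$$ and a left $Y$-module by $$(p\#(h\otimes g)\# q)\cdot m=\sum m_{(-1)}(g_1)m_{(1)}(h_1)\,p\cdot m_{(0)}\cdot(h_2\rightharpoonup q\leftharpoonup g_2).$$ *)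

theory Defs
  imports Complex_Main "HOL-Library.Function_Algebras"
begin

section \<open>Vector spaces, linear and bilinear maps\<close>

text \<open>
  A vector space is a subspace \<open>carrier V\<close> of an ambient type on which
  \<open>smult V\<close> is a vector space structure in the sense of the locale
  \<^locale>\<open>vector_space\<close>. Carriers are needed because duals and tensor products are not
  full types. Functions carry the pointwise addition of \<open>HOL-Library.Function_Algebras\<close>.
\<close>

record ('k, 'v) vspace =
  carrier :: "'v set"
  smult :: "'k \<Rightarrow> 'v \<Rightarrow> 'v"

definition vspace :: "('k::field, 'v::ab_group_add, 'z) vspace_scheme \<Rightarrow> bool" where
  "vspace V \<longleftrightarrow> vector_space (smult V) \<and> module.subspace (smult V) (carrier V)"

definition finite_dimensional :: "('k::field, 'v::ab_group_add, 'z) vspace_scheme \<Rightarrow> bool" where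
  "finite_dimensional V \<longleftrightarrow>
     (\<exists>B. finite B \<and> B \<subseteq> carrier V \<and> module.span (smult V) B = carrier V)"

definition base_field :: "('k::field, 'k) vspace" where
  "base_field = \<lparr>carrier = UNIV, smult = (*)\<rparr>"

definition linear_map ::
  "('k::field, 'v::ab_group_add, 'y) vspace_scheme \<Rightarrow> ('k, 'w::ab_group_add, 'z) vspace_scheme \<Rightarrow>
   ('v \<Rightarrow> 'w) \<Rightarrow> bool" where
  "linear_map V W f \<longleftrightarrow>
     (\<forall>x\<in>carrier V. f x \<in> carrier W) \<and>
     (\<forall>x\<in>carrier V. \<forall>y\<in>carrier V. f (x + y) = f x + f y) \<and>
     (\<forall>c. \<forall>x\<in>carrier V. f (smult V c x) = smult W c (f x))"

definition bilinear_map ::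
  "('k::field, 'v::ab_group_add, 'x) vspace_scheme \<Rightarrow> ('k, 'w::ab_group_add, 'y) vspace_scheme \<Rightarrow>
   ('k, 'u::ab_group_add, 'z) vspace_scheme \<Rightarrow> ('v \<Rightarrow> 'w \<Rightarrow> 'u) \<Rightarrow> bool" where
  "bilinear_map V W U F \<longleftrightarrow>
     (\<forall>v\<in>carrier V. linear_map W U (F v)) \<and>
     (\<forall>w\<in>carrier W. linear_map V U (\<lambda>v. F v w))"

section \<open>Tensor products\<close>

text \<open>
  The tensor product of \<open>V\<close> and \<open>W\<close> is realised inside the dual of the space of bilinear forms
  on \<open>V \<times> W\<close>: the pure tensor of \<open>v\<close> and \<open>w\<close> is evaluation at \<open>(v, w)\<close>, and the tensor product
  consists of the finite sums of pure tensors. Over a field this is the usual tensor product in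
  any dimension; its universal property is proved below.
\<close>

type_synonym ('k, 'v, 'w) tensor = "('v \<Rightarrow> 'w \<Rightarrow> 'k) \<Rightarrow> 'k"

definition pure_tensor ::
  "('k::field, 'v::ab_group_add, 'y) vspace_scheme \<Rightarrow> ('k, 'w::ab_group_add, 'z) vspace_scheme \<Rightarrow>
   'v \<Rightarrow> 'w \<Rightarrow> ('k, 'v, 'w) tensor" where
  "pure_tensor V W v w = (\<lambda>\<beta>. if bilinear_map V W base_field \<beta> then \<beta> v w else 0)"

definition tensor_of ::
  "('k::field, 'v::ab_group_add, 'y) vspace_scheme \<Rightarrow> ('k, 'w::ab_group_add, 'z) vspace_scheme \<Rightarrow>
   ('v \<times> 'w) list \<Rightarrow> ('k, 'v, 'w) tensor" where
  "tensor_of V W xs = (\<Sum>(v, w)\<leftarrow>xs. pure_tensor V W v w)"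

definition tensor_space ::
  "('k::field, 'v::ab_group_add, 'y) vspace_scheme \<Rightarrow> ('k, 'w::ab_group_add, 'z) vspace_scheme \<Rightarrow>
   ('k, ('k, 'v, 'w) tensor) vspace" where
  "tensor_space V W =
     \<lparr>carrier = {tensor_of V W xs | xs. set xs \<subseteq> carrier V \<times> carrier W},
      smult = (\<lambda>c t \<beta>. c * t \<beta>)\<rparr>"

text \<open>
  \<open>tlift V W F t\<close> is \<open>\<Sum> F v\<^sub>i w\<^sub>i\<close> for \<open>t = \<Sum> v\<^sub>i \<otimes> w\<^sub>i\<close>, that is, the linear
  map on the tensor product induced by \<open>F\<close>; for bilinear \<open>F\<close> it does not depend on the chosen
  representation of \<open>t\<close>.
\<close>

definition tlift ::
  "('k::field, 'v::ab_group_add, 'y) vspace_scheme \<Rightarrow> ('k, 'w::ab_group_add, 'z) vspace_scheme \<Rightarrow>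
   ('v \<Rightarrow> 'w \<Rightarrow> 'u::ab_group_add) \<Rightarrow> ('k, 'v, 'w) tensor \<Rightarrow> 'u" where
  "tlift V W F t =
     (let xs = (SOME xs. set xs \<subseteq> carrier V \<times> carrier W \<and> tensor_of V W xs = t)
      in \<Sum>(v, w)\<leftarrow>xs. F v w)"

lemma tensor_of_append: "tensor_of V W (xs @ ys) = tensor_of V W xs + tensor_of V W ys"
  by (simp add: tensor_of_def)

lemma tensor_of_apply:
  assumes "bilinear_map V W base_field \<beta>"
  shows "tensor_of V W xs \<beta> = (\<Sum>(v, w)\<leftarrow>xs. \<beta> v w)"
  by (induction xs) (auto simp: tensor_of_def pure_tensor_def assms)

lemma tensor_of_eqD:
  fixes F :: "'v::ab_group_add \<Rightarrow> 'w::ab_group_add \<Rightarrow> 'u::ab_group_add"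
    and U :: "('k::field, 'u, 'z) vspace_scheme"
  assumes U: "vspace U" and F: "bilinear_map V W U F"
    and eq: "tensor_of V W xs = tensor_of V W ys"
  shows "(\<Sum>(v, w)\<leftarrow>xs. F v w) = (\<Sum>(v, w)\<leftarrow>ys. F v w)"
proof (rule ccontr)
  assume neq: "(\<Sum>(v, w)\<leftarrow>xs. F v w) \<noteq> (\<Sum>(v, w)\<leftarrow>ys. F v w)"
  define u where "u = (\<Sum>(v, w)\<leftarrow>xs. F v w) - (\<Sum>(v, w)\<leftarrow>ys. F v w)"
  interpret U: vector_space "smult U" using U by (simp add: vspace_def)
  interpret K: vector_space "(*) :: 'k \<Rightarrow> 'k \<Rightarrow> 'k"
    by unfold_locales (auto simp: algebra_simps)
  interpret UK: vector_space_pair "smult U" "(*) :: 'k \<Rightarrow> 'k \<Rightarrow> 'k" ..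
  have "U.independent {u}"
    using neq by (subst U.dependent_single) (simp add: u_def)
  from UK.linear_independent_extend[OF this, of "\<lambda>_. 1"]
  obtain g where g: "Vector_Spaces.linear (smult U) (*) g" and gu: "g u = 1" by auto
  interpret g: Vector_Spaces.linear "smult U" "(*)" g by (fact g)
  define \<beta> where "\<beta> = (\<lambda>v w. g (F v w))"
  have \<beta>: "bilinear_map V W base_field \<beta>"
    using F by (auto simp: bilinear_map_def linear_map_def base_field_def \<beta>_def g.add g.scale)
  have gsum: "g (\<Sum>(v, w)\<leftarrow>zs. F v w) = (\<Sum>(v, w)\<leftarrow>zs. \<beta> v w)" for zs
    by (induction zs) (auto simp: \<beta>_def g.add g.zero)
  have "g u = tensor_of V W xs \<beta> - tensor_of V W ys \<beta>"
    by (simp add: u_def g.diff gsum tensor_of_apply[OF \<beta>])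
  with gu eq show False by simp
qed

lemma tlift_tensor_of:
  assumes "vspace U" "bilinear_map V W U F" "set xs \<subseteq> carrier V \<times> carrier W"
  shows "tlift V W F (tensor_of V W xs) = (\<Sum>(v, w)\<leftarrow>xs. F v w)"
proof -
  let ?P = "\<lambda>ys. set ys \<subseteq> carrier V \<times> carrier W \<and> tensor_of V W ys = tensor_of V W xs"
  have "?P (Eps ?P)" by (rule someI[of ?P xs]) (simp add: assms)
  then have "tensor_of V W (Eps ?P) = tensor_of V W xs" by blast
  from tensor_of_eqD[OF assms(1,2) this] show ?thesis
    by (simp add: tlift_def Let_def)
qed

theorem tlift_pure_tensor:
  assumes "vspace U" "bilinear_map V W U F" "v \<in> carrier V" "w \<in> carrier W"
  shows "tlift V W F (pure_tensor V W v w) = F v w"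
  using tlift_tensor_of[OF assms(1,2), of "[(v, w)]"] assms(3,4) by (simp add: tensor_of_def)

lemma bilinear_pure_tensor:
  assumes "vspace V" "vspace W"
  shows "bilinear_map V W (tensor_space V W) (pure_tensor V W)"
proof -
  have mem: "pure_tensor V W v w \<in> carrier (tensor_space V W)"
    if "v \<in> carrier V" "w \<in> carrier W" for v w
    unfolding tensor_space_def using that
    by (auto simp: tensor_of_def intro!: exI[of _ "[(v, w)]"])
  show ?thesis
    using mem unfolding bilinear_map_def linear_map_def
    by (auto simp: pure_tensor_def tensor_space_def fun_eq_iff bilinear_map_def
        linear_map_def base_field_def)
qed

lemma smult_tensor_of:
  assumes "vspace V" "vspace W" "set xs \<subseteq> carrier V \<times> carrier W"
  shows "smult (tensor_space V W) c (tensor_of V W xs) =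
    tensor_of V W (map (\<lambda>(v, w). (smult V c v, w)) xs)"
  using assms(3)
proof (induction xs)
  case Nil
  then show ?case by (simp add: tensor_of_def tensor_space_def fun_eq_iff)
next
  case (Cons x xs)
  obtain v w where x: "x = (v, w)" by (cases x)
  have "smult (tensor_space V W) c (pure_tensor V W v w) = pure_tensor V W (smult V c v) w"
    using bilinear_pure_tensor[OF assms(1,2)] Cons.prems
    by (auto simp: x bilinear_map_def linear_map_def)
  with Cons show ?case
    by (simp add: tensor_of_def tensor_space_def fun_eq_iff x distrib_left)
qed

theorem linear_map_tlift:
  assumes V: "vspace V" and W: "vspace W" and U: "vspace U" and F: "bilinear_map V W U F"
  shows "linear_map (tensor_space V W) U (tlift V W F)"
proof -
  interpret V: vector_space "smult V" using V by (simp add: vspace_def)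
  interpret U: vector_space "smult U" using U by (simp add: vspace_def)
  have sV: "V.subspace (carrier V)" and sU: "U.subspace (carrier U)"
    using V U by (simp_all add: vspace_def)
  have mem: "(\<Sum>(v, w)\<leftarrow>xs. F v w) \<in> carrier U" if "set xs \<subseteq> carrier V \<times> carrier W" for xs
    using that
  proof (induction xs)
    case (Cons x xs)
    obtain v w where x: "x = (v, w)" by (cases x)
    then have "F v w \<in> carrier U" using F Cons.prems by (auto simp: bilinear_map_def linear_map_def)
    then show ?case using Cons by (auto simp: x intro: U.subspace_add[OF sU])
  qed (simp add: U.subspace_0[OF sU])
  have sc: "(\<Sum>(v, w)\<leftarrow>map (\<lambda>(v, w). (smult V c v, w)) xs. F v w) =
      smult U c (\<Sum>(v, w)\<leftarrow>xs. F v w)" if "set xs \<subseteq> carrier V \<times> carrier W" for c xs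
    using that
  proof (induction xs)
    case (Cons x xs)
    obtain v w where x: "x = (v, w)" by (cases x)
    then have "F (smult V c v) w = smult U c (F v w)"
      using F Cons.prems by (auto simp: bilinear_map_def linear_map_def)
    then show ?case using Cons by (auto simp: x U.scale_right_distrib)
  qed simp
  have scm: "set (map (\<lambda>(v, w). (smult V c v, w)) xs) \<subseteq> carrier V \<times> carrier W"
    if "set xs \<subseteq> carrier V \<times> carrier W" for c xs
    using that V.subspace_scale[OF sV] by auto
  have lift: "tlift V W F (tensor_of V W xs) = (\<Sum>(v, w)\<leftarrow>xs. F v w)"
    if "set xs \<subseteq> carrier V \<times> carrier W" for xs
    using tlift_tensor_of[OF U F that] .
  show ?thesis
    unfolding linear_map_def
  proof (intro conjI ballI allI)
    fix s assume "s \<in> carrier (tensor_space V W)"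
    then obtain xs where xs: "set xs \<subseteq> carrier V \<times> carrier W" "s = tensor_of V W xs"
      by (auto simp: tensor_space_def)
    show "tlift V W F s \<in> carrier U" using xs mem lift by simp
    show "tlift V W F (smult (tensor_space V W) c s) = smult U c (tlift V W F s)" for c
      unfolding xs(2) smult_tensor_of[OF V W xs(1)] lift[OF xs(1)] lift[OF scm[OF xs(1)]]
      by (rule sc[OF xs(1)])
    fix t assume "t \<in> carrier (tensor_space V W)"
    then obtain ys where ys: "set ys \<subseteq> carrier V \<times> carrier W" "t = tensor_of V W ys"
      by (auto simp: tensor_space_def)
    show "tlift V W F (s + t) = tlift V W F s + tlift V W F t"
      using xs ys lift[of "xs @ ys"] lift[of xs] lift[of ys] by (simp add: tensor_of_append)
  qed
qed

theorem tlift_unique: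
  assumes V: "vspace V" and W: "vspace W" and U: "vspace U" and F: "bilinear_map V W U F"
    and f: "linear_map (tensor_space V W) U f"
    and fF: "\<And>v w. v \<in> carrier V \<Longrightarrow> w \<in> carrier W \<Longrightarrow> f (pure_tensor V W v w) = F v w"
    and t: "t \<in> carrier (tensor_space V W)"
  shows "f t = tlift V W F t"
proof -
  interpret U: vector_space "smult U" using U by (simp add: vspace_def)
  obtain xs where xs: "set xs \<subseteq> carrier V \<times> carrier W" "t = tensor_of V W xs"
    using t by (auto simp: tensor_space_def)
  have "f (tensor_of V W xs) = (\<Sum>(v, w)\<leftarrow>xs. F v w)" using xs(1)
  proof (induction xs)
    case Nil
    have "0 \<in> carrier (tensor_space V W)"
      by (auto simp: tensor_space_def tensor_of_def intro!: exI[of _ "[]"])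
    then have "f (0 + 0) = f 0 + f 0" using f unfolding linear_map_def by blast
    then show ?case by (simp add: tensor_of_def flip: zero_fun_def)
  next
    case (Cons x xs)
    obtain v w where x: "x = (v, w)" by (cases x)
    have "pure_tensor V W v w \<in> carrier (tensor_space V W)"
      using bilinear_pure_tensor[OF V W] Cons.prems
      by (auto simp: x bilinear_map_def linear_map_def)
    moreover have "tensor_of V W xs \<in> carrier (tensor_space V W)"
      using Cons.prems by (auto simp: tensor_space_def)
    ultimately have "f (pure_tensor V W v w + tensor_of V W xs) =
        f (pure_tensor V W v w) + f (tensor_of V W xs)"
      using f unfolding linear_map_def by blast
    then show ?case using Cons fF by (simp add: tensor_of_def x del: plus_fun_apply plus_fun_def)
  qed
  then show ?thesis using tlift_tensor_of[OF U F xs(1)] xs(2) by simp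
qed

section \<open>Algebras\<close>

record ('k, 'a) alg = "('k, 'a) vspace" +
  mult :: "'a \<Rightarrow> 'a \<Rightarrow> 'a" (infixl "\<cdot>\<index>" 70)
  unity :: "'a"

definition algebra :: "('k::field, 'a::ab_group_add, 'z) alg_scheme \<Rightarrow> bool" where
  "algebra A \<longleftrightarrow> vspace A \<and> bilinear_map A A A (mult A) \<and> unity A \<in> carrier A \<and>
     (\<forall>x\<in>carrier A. \<forall>y\<in>carrier A. \<forall>z\<in>carrier A.
        (x \<cdot>\<^bsub>A\<^esub> y) \<cdot>\<^bsub>A\<^esub> z = x \<cdot>\<^bsub>A\<^esub> (y \<cdot>\<^bsub>A\<^esub> z)) \<and>
     (\<forall>x\<in>carrier A. unity A \<cdot>\<^bsub>A\<^esub> x = x \<and> x \<cdot>\<^bsub>A\<^esub> unity A = x)"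

definition op_alg :: "('k, 'a, 'z) alg_scheme \<Rightarrow> ('k, 'a) alg" where
  "op_alg A = \<lparr>carrier = carrier A, smult = smult A,
               mult = (\<lambda>x y. y \<cdot>\<^bsub>A\<^esub> x), unity = unity A\<rparr>"

definition tensor_alg ::
  "('k::field, 'a::ab_group_add, 'y) alg_scheme \<Rightarrow> ('k, 'b::ab_group_add, 'z) alg_scheme \<Rightarrow>
   ('k, ('k, 'a, 'b) tensor) alg" where
  "tensor_alg A B =
     \<lparr>carrier = carrier (tensor_space A B), smult = smult (tensor_space A B),
      mult = (\<lambda>s t. tlift A B (\<lambda>a b. tlift A B (\<lambda>a' b'.
                pure_tensor A B (a \<cdot>\<^bsub>A\<^esub> a') (b \<cdot>\<^bsub>B\<^esub> b')) t) s),
      unity = pure_tensor A B (unity A) (unity B)\<rparr>"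

definition algebra_iso ::
  "('k::field, 'a::ab_group_add, 'y) alg_scheme \<Rightarrow> ('k, 'b::ab_group_add, 'z) alg_scheme \<Rightarrow>
   ('a \<Rightarrow> 'b) \<Rightarrow> bool" where
  "algebra_iso A B f \<longleftrightarrow> linear_map A B f \<and> bij_betw f (carrier A) (carrier B) \<and>
     f (unity A) = unity B \<and>
     (\<forall>x\<in>carrier A. \<forall>y\<in>carrier A. f (x \<cdot>\<^bsub>A\<^esub> y) = f x \<cdot>\<^bsub>B\<^esub> f y)"

section \<open>Hopf algebras and their duals\<close>

record ('k, 'a) hopf = "('k, 'a) alg" +
  comul :: "'a \<Rightarrow> ('k, 'a, 'a) tensor"
  counit :: "'a \<Rightarrow> 'k"
  antipode :: "'a \<Rightarrow> 'a"

text \<open>Sweedler sums \<open>\<Sum> F h\<^sub>1 h\<^sub>2\<close> and \<open>\<Sum> F h\<^sub>1 h\<^sub>2 h\<^sub>3\<close>.\<close>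

definition sweedler2 ::
  "('k::field, 'a::ab_group_add, 'z) hopf_scheme \<Rightarrow> 'a \<Rightarrow> ('a \<Rightarrow> 'a \<Rightarrow> 'u::ab_group_add) \<Rightarrow> 'u" where
  "sweedler2 H h F = tlift H H F (comul H h)"

definition sweedler3 ::
  "('k::field, 'a::ab_group_add, 'z) hopf_scheme \<Rightarrow> 'a \<Rightarrow> ('a \<Rightarrow> 'a \<Rightarrow> 'a \<Rightarrow> 'u::ab_group_add) \<Rightarrow> 'u" where
  "sweedler3 H h F = sweedler2 H h (\<lambda>h1 h'. sweedler2 H h' (\<lambda>h2 h3. F h1 h2 h3))"

definition hopf_algebra :: "('k::field, 'a::ab_group_add, 'z) hopf_scheme \<Rightarrow> bool" where
  "hopf_algebra H \<longleftrightarrow>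
     algebra H \<and>
     linear_map H (tensor_space H H) (comul H) \<and>
     linear_map H base_field (counit H) \<and>
     (\<forall>h\<in>carrier H.
        sweedler2 H h (\<lambda>a b. sweedler2 H a (\<lambda>a1 a2.
          pure_tensor H (tensor_space H H) a1 (pure_tensor H H a2 b))) =
        sweedler2 H h (\<lambda>a b. sweedler2 H b (\<lambda>b1 b2.
          pure_tensor H (tensor_space H H) a (pure_tensor H H b1 b2)))) \<and>
     (\<forall>h\<in>carrier H.
        sweedler2 H h (\<lambda>h1 h2. smult H (counit H h1) h2) = h \<and>
        sweedler2 H h (\<lambda>h1 h2. smult H (counit H h2) h1) = h) \<and>
     (\<forall>x\<in>carrier H. \<forall>y\<in>carrier H.
        comul H (x \<cdot>\<^bsub>H\<^esub> y) = comul H x \<cdot>\<^bsub>tensor_alg H H\<^esub> comul H y) \<and>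
     comul H (unity H) = unity (tensor_alg H H) \<and>
     (\<forall>x\<in>carrier H. \<forall>y\<in>carrier H. counit H (x \<cdot>\<^bsub>H\<^esub> y) = counit H x * counit H y) \<and>
     counit H (unity H) = 1 \<and>
     linear_map H H (antipode H) \<and>
     (\<forall>h\<in>carrier H.
        sweedler2 H h (\<lambda>h1 h2. antipode H h1 \<cdot>\<^bsub>H\<^esub> h2) = smult H (counit H h) (unity H) \<and>
        sweedler2 H h (\<lambda>h1 h2. h1 \<cdot>\<^bsub>H\<^esub> antipode H h2) = smult H (counit H h) (unity H))"

definition antipode_inv :: "('k::field, 'a::ab_group_add, 'z) hopf_scheme \<Rightarrow> 'a \<Rightarrow> 'a" where
  "antipode_inv H = inv_into (carrier H) (antipode H)"

text \<open>
  Linear forms on \<open>H\<close> are represented by functions vanishing outside \<open>carrier H\<close>, so that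
  distinct functions are distinct forms.
\<close>

definition dual_space ::
  "('k::field, 'a::ab_group_add, 'z) vspace_scheme \<Rightarrow> ('k, 'a \<Rightarrow> 'k) vspace" where
  "dual_space V =
     \<lparr>carrier = {p. linear_map V base_field p \<and> (\<forall>x. x \<notin> carrier V \<longrightarrow> p x = 0)},
      smult = (\<lambda>c p x. c * p x)\<rparr>"

text \<open>
  The comultiplication \<open>p \<mapsto> \<Sum> p\<^sub>1 \<otimes> p\<^sub>2\<close> of the dual is characterised by
  \<open>\<Sum> p\<^sub>1(h) p\<^sub>2(h') = p(h h')\<close>; the tensor exists and is unique for finite-dimensional \<open>H\<close>.
\<close>

definition dual_comul ::
  "('k::field, 'a::ab_group_add, 'z) hopf_scheme \<Rightarrow> ('a \<Rightarrow> 'k) \<Rightarrow>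
   ('k, 'a \<Rightarrow> 'k, 'a \<Rightarrow> 'k) tensor" where
  "dual_comul H p =
     (THE t. t \<in> carrier (tensor_space (dual_space H) (dual_space H)) \<and>
        (\<forall>h\<in>carrier H. \<forall>h'\<in>carrier H.
           tlift (dual_space H) (dual_space H) (\<lambda>p1 p2. p1 h * p2 h') t = p (h \<cdot>\<^bsub>H\<^esub> h')))"

definition dual_hopf ::
  "('k::field, 'a::ab_group_add, 'z) hopf_scheme \<Rightarrow> ('k, 'a \<Rightarrow> 'k) hopf" where
  "dual_hopf H =
     \<lparr>carrier = carrier (dual_space H), smult = smult (dual_space H),
      mult = (\<lambda>p q h. if h \<in> carrier H then sweedler2 H h (\<lambda>h1 h2. p h1 * q h2) else 0),
      unity = (\<lambda>h. if h \<in> carrier H then counit H h else 0),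
      comul = dual_comul H,
      counit = (\<lambda>p. p (unity H)),
      antipode = (\<lambda>p h. if h \<in> carrier H then p (antipode H h) else 0)\<rparr>"

definition left_regular ::
  "'a \<Rightarrow> ('k::field, 'a::ab_group_add, 'z) hopf_scheme \<Rightarrow> ('a \<Rightarrow> 'k) \<Rightarrow> 'a \<Rightarrow> 'k" where
  "left_regular h H f = (\<lambda>h'. if h' \<in> carrier H then f (h' \<cdot>\<^bsub>H\<^esub> h) else 0)"

definition right_regular ::
  "('a \<Rightarrow> 'k) \<Rightarrow> ('k::field, 'a::ab_group_add, 'z) hopf_scheme \<Rightarrow> 'a \<Rightarrow> 'a \<Rightarrow> 'k" where
  "right_regular f H h' = (\<lambda>h. if h \<in> carrier H then f (h' \<cdot>\<^bsub>H\<^esub> h) else 0)"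

notation left_regular ("(_ \<rightharpoonup>\<^bsub>_\<^esub> _)" [76, 0, 75] 75)
notation right_regular ("(_ \<leftharpoonup>\<^bsub>_\<^esub> _)" [75, 0, 76] 75)

section \<open>Hopf bimodules\<close>

record ('k, 'a, 'm) hbimod = "('k, 'm) vspace" +
  lact :: "'a \<Rightarrow> 'm \<Rightarrow> 'm"
  ract :: "'m \<Rightarrow> 'a \<Rightarrow> 'm"
  lcoact :: "'m \<Rightarrow> ('k, 'a, 'm) tensor"
  rcoact :: "'m \<Rightarrow> ('k, 'm, 'a) tensor"

definition bimodule ::
  "('k::field, 'a::ab_group_add, 'y) alg_scheme \<Rightarrow>
   ('k, 'a, 'm::ab_group_add, 'z) hbimod_scheme \<Rightarrow> bool" where
  "bimodule A M \<longleftrightarrow>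
     vspace M \<and> bilinear_map A M M (lact M) \<and> bilinear_map M A M (ract M) \<and>
     (\<forall>m\<in>carrier M. lact M (unity A) m = m \<and> ract M m (unity A) = m) \<and>
     (\<forall>p\<in>carrier A. \<forall>q\<in>carrier A. \<forall>m\<in>carrier M.
        lact M (p \<cdot>\<^bsub>A\<^esub> q) m = lact M p (lact M q m) \<and>
        ract M m (p \<cdot>\<^bsub>A\<^esub> q) = ract M (ract M m p) q \<and>
        ract M (lact M p m) q = lact M p (ract M m q))"

definition coact_elt ::
  "('k::field, 'a::ab_group_add, 'y) hopf_scheme \<Rightarrow>
   ('k, 'a, 'm::ab_group_add, 'z) hbimod_scheme \<Rightarrow>
   'a \<Rightarrow> 'm \<Rightarrow> 'a \<Rightarrow> ('k, 'a, ('k, 'm, 'a) tensor) tensor" where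
  "coact_elt A M a m b = pure_tensor A (tensor_space M A) a (pure_tensor M A m b)"

definition bicomodule ::
  "('k::field, 'a::ab_group_add, 'y) hopf_scheme \<Rightarrow>
   ('k, 'a, 'm::ab_group_add, 'z) hbimod_scheme \<Rightarrow> bool" where
  "bicomodule A M \<longleftrightarrow>
     vspace M \<and>
     linear_map M (tensor_space A M) (lcoact M) \<and>
     linear_map M (tensor_space M A) (rcoact M) \<and>
     (\<forall>m\<in>carrier M.
        tlift A M (\<lambda>a n. smult M (counit A a) n) (lcoact M m) = m \<and>
        tlift M A (\<lambda>n b. smult M (counit A b) n) (rcoact M m) = m \<and>
        tlift A M (\<lambda>a n. sweedler2 A a (\<lambda>a1 a2.
            pure_tensor A (tensor_space A M) a1 (pure_tensor A M a2 n))) (lcoact M m) =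
        tlift A M (\<lambda>a n. tlift A M (\<lambda>a' n'.
            pure_tensor A (tensor_space A M) a (pure_tensor A M a' n')) (lcoact M n))
          (lcoact M m) \<and>
        tlift M A (\<lambda>n b. sweedler2 A b (\<lambda>b1 b2.
            pure_tensor M (tensor_space A A) n (pure_tensor A A b1 b2))) (rcoact M m) =
        tlift M A (\<lambda>n b. tlift M A (\<lambda>n' b'.
            pure_tensor M (tensor_space A A) n' (pure_tensor A A b' b)) (rcoact M n))
          (rcoact M m) \<and>
        tlift A M (\<lambda>a n. tlift M A (\<lambda>n' b. coact_elt A M a n' b) (rcoact M n)) (lcoact M m) =
        tlift M A (\<lambda>n b. tlift A M (\<lambda>a n'. coact_elt A M a n' b) (lcoact M n)) (rcoact M m))"

text \<open>
  The two-sided coaction \<open>m \<mapsto> \<Sum> m\<^sub>(\<^sub>-\<^sub>1\<^sub>) \<otimes> m\<^sub>(\<^sub>0\<^sub>) \<otimes> m\<^sub>(\<^sub>1\<^sub>)\<close>, and the Sweedler sum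
  \<open>\<Sum> F m\<^sub>(\<^sub>-\<^sub>1\<^sub>) m\<^sub>(\<^sub>0\<^sub>) m\<^sub>(\<^sub>1\<^sub>)\<close>.
\<close>

definition coact ::
  "('k::field, 'a::ab_group_add, 'y) hopf_scheme \<Rightarrow>
   ('k, 'a, 'm::ab_group_add, 'z) hbimod_scheme \<Rightarrow>
   'm \<Rightarrow> ('k, 'a, ('k, 'm, 'a) tensor) tensor" where
  "coact A M m =
     tlift A M (\<lambda>a n. tlift M A (\<lambda>n' b. coact_elt A M a n' b) (rcoact M n)) (lcoact M m)"

definition coact_sum ::
  "('k::field, 'a::ab_group_add, 'y) hopf_scheme \<Rightarrow>
   ('k, 'a, 'm::ab_group_add, 'z) hbimod_scheme \<Rightarrow>
   'm \<Rightarrow> ('a \<Rightarrow> 'm \<Rightarrow> 'a \<Rightarrow> 'u::ab_group_add) \<Rightarrow> 'u" where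
  "coact_sum A M m F =
     tlift A (tensor_space M A) (\<lambda>a t. tlift M A (\<lambda>n b. F a n b) t) (coact A M m)"

definition hopf_bimodule ::
  "('k::field, 'a::ab_group_add, 'y) hopf_scheme \<Rightarrow>
   ('k, 'a, 'm::ab_group_add, 'z) hbimod_scheme \<Rightarrow> bool" where
  "hopf_bimodule A M \<longleftrightarrow> bimodule A M \<and> bicomodule A M \<and>
     (\<forall>p\<in>carrier A. \<forall>q\<in>carrier A. \<forall>m\<in>carrier M.
        coact A M (ract M (lact M p m) q) =
        sweedler3 A p (\<lambda>p1 p2 p3. sweedler3 A q (\<lambda>q1 q2 q3.
          coact_sum A M m (\<lambda>a n b.
            coact_elt A M (p1 \<cdot>\<^bsub>A\<^esub> a \<cdot>\<^bsub>A\<^esub> q1) (ract M (lact M p2 n) q2)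
              (p3 \<cdot>\<^bsub>A\<^esub> b \<cdot>\<^bsub>A\<^esub> q3)))))"

section \<open>The algebra X\<close>

abbreviation X_left where "X_left H \<equiv> tensor_alg (op_alg H) H"
abbreviation X_right where "X_right H \<equiv> tensor_alg (dual_hopf H) (op_alg (dual_hopf H))"

type_synonym ('k, 'h) X_type =
  "('k, ('k, 'h, 'h) tensor, ('k, 'h \<Rightarrow> 'k, 'h \<Rightarrow> 'k) tensor) tensor"

text \<open>The element \<open>(g \<otimes> h) \<otimes> (p \<otimes> q)\<close> of \<open>X\<close>.\<close>

definition X_elt ::
  "('k::field, 'h::ab_group_add, 'z) hopf_scheme \<Rightarrow> 'h \<Rightarrow> 'h \<Rightarrow> ('h \<Rightarrow> 'k) \<Rightarrow> ('h \<Rightarrow> 'k) \<Rightarrow>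
   ('k, 'h) X_type" where
  "X_elt H g h p q =
     pure_tensor (X_left H) (X_right H)
       (pure_tensor (op_alg H) H g h)
       (pure_tensor (dual_hopf H) (op_alg (dual_hopf H)) p q)"

text \<open>The linear map on \<open>X\<close> with value \<open>F g h p q\<close> at \<open>(g \<otimes> h) \<otimes> (p \<otimes> q)\<close>.\<close>

definition X_lift ::
  "('k::field, 'h::ab_group_add, 'z) hopf_scheme \<Rightarrow>
   ('h \<Rightarrow> 'h \<Rightarrow> ('h \<Rightarrow> 'k) \<Rightarrow> ('h \<Rightarrow> 'k) \<Rightarrow> 'u::ab_group_add) \<Rightarrow> ('k, 'h) X_type \<Rightarrow> 'u" where
  "X_lift H F =
     tlift (X_left H) (X_right H) (\<lambda>a f.
       tlift (op_alg H) H (\<lambda>g h.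
         tlift (dual_hopf H) (op_alg (dual_hopf H)) (\<lambda>p q. F g h p q) f) a)"

text \<open>
  The product \<open>((1 \<otimes> 1) \<otimes> f) (a \<otimes> (1 \<otimes> 1))\<close> in \<open>X\<close>, for \<open>f = p \<otimes> q\<close> in the right-hand and
  \<open>a = g \<otimes> h\<close> in the left-hand subalgebra.
\<close>

definition X_exchange ::
  "('k::field, 'h::ab_group_add, 'z) hopf_scheme \<Rightarrow>
   ('k, 'h \<Rightarrow> 'k, 'h \<Rightarrow> 'k) tensor \<Rightarrow> ('k, 'h, 'h) tensor \<Rightarrow> ('k, 'h) X_type" where
  "X_exchange H f a =
     tlift (dual_hopf H) (op_alg (dual_hopf H)) (\<lambda>p q.
       tlift (op_alg H) H (\<lambda>g h.
         sweedler3 H g (\<lambda>g1 g2 g3. sweedler3 H h (\<lambda>h1 h2 h3.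
           X_elt H g2 h2
             ((antipode_inv H h1 \<rightharpoonup>\<^bsub>H\<^esub> p) \<leftharpoonup>\<^bsub>H\<^esub> antipode H g1)
             ((antipode H h3 \<rightharpoonup>\<^bsub>H\<^esub> q) \<leftharpoonup>\<^bsub>H\<^esub> antipode_inv H g3)))) a) f"

text \<open>
  With \<open>a \<otimes> f = (a \<otimes> 1) (1 \<otimes> f)\<close> and both factors being subalgebras, associativity forces
  \<open>(a \<otimes> f) (a' \<otimes> f') = \<Sum> a a'' \<otimes> f'' f'\<close> where \<open>(1 \<otimes> f) (a' \<otimes> 1) = \<Sum> a'' \<otimes> f''\<close>.
\<close>

definition X_alg ::
  "('k::field, 'h::ab_group_add, 'z) hopf_scheme \<Rightarrow> ('k, ('k, 'h) X_type) alg" where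
  "X_alg H =
     \<lparr>carrier = carrier (tensor_space (X_left H) (X_right H)),
      smult = smult (tensor_space (X_left H) (X_right H)),
      mult = (\<lambda>x y.
        tlift (X_left H) (X_right H) (\<lambda>a f.
          tlift (X_left H) (X_right H) (\<lambda>a' f'.
            tlift (X_left H) (X_right H) (\<lambda>a'' f''.
              pure_tensor (X_left H) (X_right H)
                (a \<cdot>\<^bsub>X_left H\<^esub> a'') (f'' \<cdot>\<^bsub>X_right H\<^esub> f'))
            (X_exchange H f a')) y) x),
      unity = X_elt H (unity H) (unity H) (unity (dual_hopf H)) (unity (dual_hopf H))\<rparr>"

section \<open>The algebra Y\<close>

abbreviation Y_mid where "Y_mid H \<equiv> tensor_space H (op_alg H)"
abbreviation Y_midright where "Y_midright H \<equiv> tensor_space (Y_mid H) (op_alg (dual_hopf H))"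

type_synonym ('k, 'h) Y_type =
  "('k, 'h \<Rightarrow> 'k, ('k, ('k, 'h, 'h) tensor, 'h \<Rightarrow> 'k) tensor) tensor"

text \<open>The element \<open>p # (h \<otimes> g) # q\<close> of \<open>Y\<close>, and linear maps given by their values on these.\<close>

definition Y_elt ::
  "('k::field, 'h::ab_group_add, 'z) hopf_scheme \<Rightarrow> ('h \<Rightarrow> 'k) \<Rightarrow> 'h \<Rightarrow> 'h \<Rightarrow> ('h \<Rightarrow> 'k) \<Rightarrow>
   ('k, 'h) Y_type" where
  "Y_elt H p h g q =
     pure_tensor (dual_hopf H) (Y_midright H) p
       (pure_tensor (Y_mid H) (op_alg (dual_hopf H)) (pure_tensor H (op_alg H) h g) q)"

definition Y_lift ::
  "('k::field, 'h::ab_group_add, 'z) hopf_scheme \<Rightarrow>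
   (('h \<Rightarrow> 'k) \<Rightarrow> 'h \<Rightarrow> 'h \<Rightarrow> ('h \<Rightarrow> 'k) \<Rightarrow> 'u::ab_group_add) \<Rightarrow> ('k, 'h) Y_type \<Rightarrow> 'u" where
  "Y_lift H F =
     tlift (dual_hopf H) (Y_midright H) (\<lambda>p s.
       tlift (Y_mid H) (op_alg (dual_hopf H)) (\<lambda>t q.
         tlift H (op_alg H) (\<lambda>h g. F p h g q) t) s)"

definition Y_alg ::
  "('k::field, 'h::ab_group_add, 'z) hopf_scheme \<Rightarrow> ('k, ('k, 'h) Y_type) alg" where
  "Y_alg H =
     \<lparr>carrier = carrier (tensor_space (dual_hopf H) (Y_midright H)),
      smult = smult (tensor_space (dual_hopf H) (Y_midright H)),
      mult = (\<lambda>y y'.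
        Y_lift H (\<lambda>p h g q. Y_lift H (\<lambda>p' h' g' q'.
          sweedler2 H h (\<lambda>h1 h2. sweedler2 H g (\<lambda>g1 g2.
          sweedler2 H h' (\<lambda>h1' h2'. sweedler2 H g' (\<lambda>g1' g2'.
            Y_elt H
              (p \<cdot>\<^bsub>dual_hopf H\<^esub> ((h1 \<rightharpoonup>\<^bsub>H\<^esub> p') \<leftharpoonup>\<^bsub>H\<^esub> g1))
              (h2 \<cdot>\<^bsub>H\<^esub> h1')
              (g1' \<cdot>\<^bsub>H\<^esub> g2)
              (q' \<cdot>\<^bsub>dual_hopf H\<^esub>
                ((antipode H h2' \<rightharpoonup>\<^bsub>H\<^esub> q) \<leftharpoonup>\<^bsub>H\<^esub> antipode_inv H g2')))))))
          y') y),
      unity = Y_elt H (unity (dual_hopf H)) (unity H) (unity H) (unity (dual_hopf H))\<rparr>"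

section \<open>Actions on Hopf bimodules\<close>

definition X_act ::
  "('k::field, 'h::ab_group_add, 'y) hopf_scheme \<Rightarrow>
   ('k, 'h \<Rightarrow> 'k, 'm::ab_group_add, 'z) hbimod_scheme \<Rightarrow> ('k, 'h) X_type \<Rightarrow> 'm \<Rightarrow> 'm" where
  "X_act H M x m =
     X_lift H (\<lambda>g h p q.
       sweedler3 H g (\<lambda>g1 g2 g3. sweedler3 H h (\<lambda>h1 h2 h3.
         coact_sum (dual_hopf H) M m (\<lambda>a n b.
           smult M (a g2 * b h2)
             (ract M (lact M ((h1 \<rightharpoonup>\<^bsub>H\<^esub> p) \<leftharpoonup>\<^bsub>H\<^esub> g1) n)
               ((h3 \<rightharpoonup>\<^bsub>H\<^esub> q) \<leftharpoonup>\<^bsub>H\<^esub> g3)))))) x"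

definition Y_act ::
  "('k::field, 'h::ab_group_add, 'y) hopf_scheme \<Rightarrow>
   ('k, 'h \<Rightarrow> 'k, 'm::ab_group_add, 'z) hbimod_scheme \<Rightarrow> ('k, 'h) Y_type \<Rightarrow> 'm \<Rightarrow> 'm" where
  "Y_act H M y m =
     Y_lift H (\<lambda>p h g q.
       sweedler2 H g (\<lambda>g1 g2. sweedler2 H h (\<lambda>h1 h2.
         coact_sum (dual_hopf H) M m (\<lambda>a n b.
           smult M (a g1 * b h1)
             (ract M (lact M p n) ((h2 \<rightharpoonup>\<^bsub>H\<^esub> q) \<leftharpoonup>\<^bsub>H\<^esub> g2)))))) y"

section \<open>The maps between X and Y\<close>

definition phi ::
  "('k::field, 'h::ab_group_add, 'z) hopf_scheme \<Rightarrow> ('k, 'h) X_type \<Rightarrow> ('k, 'h) Y_type" where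
  "phi H = X_lift H (\<lambda>g h p q.
     sweedler2 H g (\<lambda>g1 g2. sweedler2 H h (\<lambda>h1 h2.
       Y_elt H ((h1 \<rightharpoonup>\<^bsub>H\<^esub> p) \<leftharpoonup>\<^bsub>H\<^esub> g1) h2 g2 q)))"

definition phi_inv ::
  "('k::field, 'h::ab_group_add, 'z) hopf_scheme \<Rightarrow> ('k, 'h) Y_type \<Rightarrow> ('k, 'h) X_type" where
  "phi_inv H = Y_lift H (\<lambda>p h g q.
     sweedler2 H g (\<lambda>g1 g2. sweedler2 H h (\<lambda>h1 h2.
       X_elt H g2 h2 ((antipode_inv H h1 \<rightharpoonup>\<^bsub>H\<^esub> p) \<leftharpoonup>\<^bsub>H\<^esub> antipode H g1) q)))"

end

theory Submission
  imports Defs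
begin

text \<open>
  Write \<open>R h p g\<close> for \<open>h \<rightharpoonup> p \<leftharpoonup> g\<close>. The two composites of the maps between \<open>X\<close> and \<open>Y\<close> are the
  identity because \<open>R h (R h' p g') g = R (h h') p (g' g)\<close> and the antipode and its inverse cancel
  adjacent Sweedler factors. Multiplicativity comes down to
  \<open>R h (p p') g = \<Sum> (R h\<^sub>1 p g\<^sub>1) (R h\<^sub>2 p' g\<^sub>2)\<close> and its twisted form
  \<open>\<Sum> R h\<^sub>2 ((R (S\<^sup>-\<^sup>1 h\<^sub>1) p (S g\<^sub>1)) p') g\<^sub>2 = p (R h p' g)\<close>; the compatibility with the
  actions is coassociativity already built into the iterated Sweedler sums.

  The antipode is shown to be bijective without integrals. For a large even power \<open>f\<close> of \<open>S\<close>,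
  Fitting's lemma gives a projection \<open>\<pi>\<close> onto the image of \<open>f\<close> with \<open>f \<circ> \<pi> = f\<close>. Then
  \<open>f\<close> maps \<open>b = id * (S \<circ> \<pi>)\<close> to the convolution unit, a descent on the power of \<open>S\<close> shows
  that \<open>b\<close> itself is the unit, and convolving with \<open>\<pi>\<close> gives \<open>\<pi> = id\<close>, so \<open>S\<close> is injective.
\<close>

section \<open>Linear maps and tensor products\<close>

text \<open>\<open>tlift\<close> sums over one representation of a tensor picked by choice, so
  coassociativity, counit and antipode laws reach a Sweedler sum only when its summand is known to
  be linear in each slot involved. This shapes the proof: nearly every step leaves linearity and
  membership goals, which \<open>linear_intro\<close> and \<open>carrier_intro\<close> settle by
  following the syntax of the summand, while \<open>space_norm\<close> erases the opposite and
  tensor algebra structures that tensor products do not see.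

  The axioms in \<open>hopf_algebra\<close> do not ask for an invertible antipode, and
  \<open>antipode_inv\<close> is a bare \<open>inv_into\<close>; the formulas for \<open>X\<close>,
  \<open>Y\<close> and \<open>phi_inv\<close> have their intended meaning only once bijectivity is
  proved. The power of \<open>S\<close> is taken even because \<open>S\<close> reverses products: an
  even power is multiplicative and commutes with \<open>S\<close>, so it can be pushed through the
  antipode identities.

  The sums over \<open>g\<close> and \<open>h\<close> always run in parallel. They are therefore
  treated as one sum over \<open>g\<close> and \<open>h\<close> together, with its own
  coassociativity and cancellation rules.\<close>

named_theorems linear_intro
named_theorems carrier_intro
named_theorems space_norm

lemma vspaceD:
  assumes "vspace V"
  shows vspace_zero: "0 \<in> carrier V"
    and vspace_add: "x \<in> carrier V \<Longrightarrow> y \<in> carrier V \<Longrightarrow> x + y \<in> carrier V"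
    and vspace_scale: "x \<in> carrier V \<Longrightarrow> smult V c x \<in> carrier V"
    and vspace_vector_space: "vector_space (smult V)"
proof -
  interpret vector_space "smult V" using assms by (simp add: vspace_def)
  have "subspace (carrier V)" using assms by (simp add: vspace_def)
  then show "0 \<in> carrier V"
    and "x \<in> carrier V \<Longrightarrow> y \<in> carrier V \<Longrightarrow> x + y \<in> carrier V"
    and "x \<in> carrier V \<Longrightarrow> smult V c x \<in> carrier V"
    by (auto simp: subspace_def)
  show "vector_space (smult V)" ..
qed

lemma vspace_sum_list:
  assumes "vspace V" and "\<And>x. x \<in> set xs \<Longrightarrow> f x \<in> carrier V"
  shows "(\<Sum>x\<leftarrow>xs. f x) \<in> carrier V"
  using assms(2) by (induction xs) (auto intro: vspace_zero[OF assms(1)] vspace_add[OF assms(1)])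

lemma linear_mapI:
  assumes "\<And>x. x \<in> carrier V \<Longrightarrow> f x \<in> carrier W"
    and "\<And>x y. x \<in> carrier V \<Longrightarrow> y \<in> carrier V \<Longrightarrow> f (x + y) = f x + f y"
    and "\<And>c x. x \<in> carrier V \<Longrightarrow> f (smult V c x) = smult W c (f x)"
  shows "linear_map V W f"
  using assms by (auto simp: linear_map_def)

lemma linear_mapD:
  assumes "linear_map V W f"
  shows linear_map_closed: "x \<in> carrier V \<Longrightarrow> f x \<in> carrier W"
    and linear_map_add: "x \<in> carrier V \<Longrightarrow> y \<in> carrier V \<Longrightarrow> f (x + y) = f x + f y"
    and linear_map_scale: "x \<in> carrier V \<Longrightarrow> f (smult V c x) = smult W c (f x)"
  using assms by (auto simp: linear_map_def)

lemma linear_map_zero: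
  assumes "vspace V" "linear_map V W f"
  shows "f 0 = 0"
  using linear_map_add[OF assms(2) vspace_zero[OF assms(1)] vspace_zero[OF assms(1)]] by simp

lemma linear_map_sum_list:
  assumes "vspace V" "linear_map V W f" "\<And>x. x \<in> set xs \<Longrightarrow> g x \<in> carrier V"
  shows "f (\<Sum>x\<leftarrow>xs. g x) = (\<Sum>x\<leftarrow>xs. f (g x))"
  using assms(3)
  by (induction xs)
    (simp_all add: linear_map_zero[OF assms(1,2)] linear_map_add[OF assms(2)]
      vspace_sum_list[OF assms(1)])

lemma linear_map_cong:
  assumes "linear_map V W f" "vspace V" "\<And>x. x \<in> carrier V \<Longrightarrow> f x = g x"
  shows "linear_map V W g"
  using assms vspaceD[OF assms(2)] unfolding linear_map_def by auto

lemma linear_map_ident [linear_intro]: "linear_map V V (\<lambda>x. x)"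
  by (rule linear_mapI) simp_all

lemma linear_map_compose:
  assumes "linear_map V W f" "linear_map U V g"
  shows "linear_map U W (\<lambda>x. f (g x))"
  using assms by (auto simp: linear_map_def)

lemma bilinear_mapI [linear_intro]:
  assumes "\<And>v. v \<in> carrier V \<Longrightarrow> linear_map W U (\<lambda>w. F v w)"
    and "\<And>w. w \<in> carrier W \<Longrightarrow> linear_map V U (\<lambda>v. F v w)"
  shows "bilinear_map V W U F"
  using assms by (simp add: bilinear_map_def)

lemma bilinear_left:
  assumes "bilinear_map V W U F" "linear_map T V f" "w \<in> carrier W"
  shows "linear_map T U (\<lambda>x. F (f x) w)"
  by (rule linear_map_compose[OF _ assms(2)]) (use assms in \<open>simp add: bilinear_map_def\<close>)

lemma bilinear_right:
  assumes "bilinear_map V W U F" "linear_map T W f" "v \<in> carrier V"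
  shows "linear_map T U (\<lambda>x. F v (f x))"
  by (rule linear_map_compose[OF _ assms(2)]) (use assms in \<open>simp add: bilinear_map_def\<close>)

lemma bilinear_closed:
  assumes "bilinear_map V W U F" "v \<in> carrier V" "w \<in> carrier W"
  shows "F v w \<in> carrier U"
  using assms by (simp add: bilinear_map_def linear_map_def)

lemma vspace_base_field [carrier_intro]: "vspace (base_field :: ('k::field, 'k) vspace)"
proof -
  interpret vector_space "(*) :: 'k \<Rightarrow> 'k \<Rightarrow> 'k"
    by unfold_locales (auto simp: algebra_simps)
  show ?thesis unfolding vspace_def base_field_def
    by (simp add: vector_space_axioms subspace_def)
qed

lemma base_field_simps [simp]: "carrier base_field = UNIV" "smult base_field = (*)"
  by (simp_all add: base_field_def)

lemma mem_base_field [carrier_intro]: "c \<in> carrier base_field"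
  by simp

lemma linear_map_base_mult [linear_intro]:
  "linear_map V base_field f \<Longrightarrow> linear_map V base_field (\<lambda>x. f x * (c :: 'k::field))"
  "linear_map V base_field f \<Longrightarrow> linear_map V base_field (\<lambda>x. (c :: 'k::field) * f x)"
  by (auto simp: linear_map_def algebra_simps)

lemma bilinear_smult:
  assumes "vspace V"
  shows "bilinear_map base_field V V (smult V)"
proof -
  interpret vector_space "smult V" using assms by (simp add: vspace_def)
  show ?thesis
    by (intro bilinear_mapI linear_mapI)
      (simp_all add: vspace_scale[OF assms] scale_right_distrib scale_left_distrib mult.commute)
qed

lemma linear_map_smult [linear_intro]:
  assumes "vspace U"
  shows "linear_map V base_field c \<Longrightarrow> u \<in> carrier U \<Longrightarrow> linear_map V U (\<lambda>x. smult U (c x) u)"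
    and "linear_map V U f \<Longrightarrow> linear_map V U (\<lambda>x. smult U r (f x))"
  using bilinear_left[OF bilinear_smult[OF assms]] bilinear_right[OF bilinear_smult[OF assms]]
  by auto

lemma vspace_tensor_space [carrier_intro]:
  assumes "vspace V" "vspace W"
  shows "vspace (tensor_space V W)"
proof -
  interpret T: vector_space "\<lambda>c (t :: ('a, 'b, 'd) tensor) \<beta>. c * t \<beta>"
    by unfold_locales (auto simp: algebra_simps fun_eq_iff)
  have "t + s \<in> carrier (tensor_space V W)"
    if "t \<in> carrier (tensor_space V W)" "s \<in> carrier (tensor_space V W)" for t s
    using that
    by (auto simp: tensor_space_def tensor_of_append[symmetric] simp del: plus_fun_apply)
      (metis Un_subset_iff set_append)
  moreover have "0 \<in> carrier (tensor_space V W)"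
    by (auto simp: tensor_space_def tensor_of_def intro!: exI[of _ "[]"])
  moreover have "smult (tensor_space V W) c t \<in> carrier (tensor_space V W)"
    if t: "t \<in> carrier (tensor_space V W)" for c t
  proof -
    obtain xs where xs: "set xs \<subseteq> carrier V \<times> carrier W" "t = tensor_of V W xs"
      using t by (auto simp: tensor_space_def)
    have "set (map (\<lambda>(v, w). (smult V c v, w)) xs) \<subseteq> carrier V \<times> carrier W"
      using xs(1) by (auto intro: vspace_scale[OF assms(1)])
    then show ?thesis
      using xs smult_tensor_of[OF assms xs(1), of c]
      unfolding tensor_space_def by (simp del: set_map) blast
  qed
  ultimately show ?thesis
    unfolding vspace_def T.subspace_def
    by (auto simp: T.vector_space_axioms T.subspace_def tensor_space_def)
qed

text \<open>The representation that \<open>tlift\<close> picks. It depends on the tensor but not on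
  the summand, so congruence, additivity in the summand and interchange of sums hold without any
  bilinearity.\<close>

definition tensor_list where
  "tensor_list V W t =
     (SOME xs. set xs \<subseteq> carrier V \<times> carrier W \<and> tensor_of V W xs = t)"

lemma tlift_eq: "tlift V W F t = (\<Sum>(v, w)\<leftarrow>tensor_list V W t. F v w)"
  by (simp add: tlift_def tensor_list_def)

lemma tensor_list:
  assumes "t \<in> carrier (tensor_space V W)"
  shows "set (tensor_list V W t) \<subseteq> carrier V \<times> carrier W" "tensor_of V W (tensor_list V W t) = t"
proof -
  have "\<exists>xs. set xs \<subseteq> carrier V \<times> carrier W \<and> tensor_of V W xs = t"
    using assms by (auto simp: tensor_space_def)
  from someI_ex[OF this]
  show "set (tensor_list V W t) \<subseteq> carrier V \<times> carrier W" "tensor_of V W (tensor_list V W t) = t"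
    by (simp_all add: tensor_list_def)
qed

lemma tlift_cong:
  assumes "t \<in> carrier (tensor_space V W)"
    and "\<And>v w. v \<in> carrier V \<Longrightarrow> w \<in> carrier W \<Longrightarrow> F v w = G v w"
  shows "tlift V W F t = tlift V W G t"
  unfolding tlift_eq
  by (intro arg_cong[of _ _ sum_list] map_cong) (use assms tensor_list(1)[OF assms(1)] in auto)

lemma tlift_closed [carrier_intro]:
  assumes "vspace U" "t \<in> carrier (tensor_space V W)"
    and "\<And>v w. v \<in> carrier V \<Longrightarrow> w \<in> carrier W \<Longrightarrow> F v w \<in> carrier U"
  shows "tlift V W F t \<in> carrier U"
  unfolding tlift_eq
  by (rule vspace_sum_list) (use assms tensor_list(1)[OF assms(2)] in auto)

lemma linear_map_tlift_apply:
  assumes "vspace U" "linear_map U U' f" "t \<in> carrier (tensor_space V W)"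
    and "\<And>v w. v \<in> carrier V \<Longrightarrow> w \<in> carrier W \<Longrightarrow> F v w \<in> carrier U"
  shows "f (tlift V W F t) = tlift V W (\<lambda>v w. f (F v w)) t"
  unfolding tlift_eq
  by (subst linear_map_sum_list[OF assms(1,2)])
    (use assms(4) tensor_list(1)[OF assms(3)] in \<open>auto simp: case_prod_unfold\<close>)

text \<open>Addition of functions is pointwise. This lets a Sweedler sum of linear forms be compared
  argument by argument.\<close>

lemma tlift_apply: "tlift V W F t \<beta> = tlift V W (\<lambda>v w. F v w \<beta>) t"
proof -
  have "(\<Sum>x\<leftarrow>xs. f x) b = (\<Sum>x\<leftarrow>xs. f x b)" for xs b and f :: "'x \<Rightarrow> 'y \<Rightarrow> 'z::ab_group_add"
    by (induction xs) simp_all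
  then show ?thesis by (simp add: tlift_eq case_prod_unfold)
qed

text \<open>Interchange of two finite sums: \<open>t'\<close> does not mention the variables bound
  by the outer sum, so both chosen lists are fixed.\<close>

lemma tlift_swap:
  "tlift V W (\<lambda>v w. tlift V' W' (\<lambda>v' w'. F v w v' w') t') t =
   tlift V' W' (\<lambda>v' w'. tlift V W (\<lambda>v w. F v w v' w') t) t'"
proof -
  have *: "(\<Sum>x\<leftarrow>xs. \<Sum>y\<leftarrow>ys. f x y) = (\<Sum>y\<leftarrow>ys. \<Sum>x\<leftarrow>xs. f x y)"
    for xs ys and f :: "'x \<Rightarrow> 'y \<Rightarrow> 'z::ab_group_add"
    by (induction xs) (simp_all add: sum_list_addf)
  show ?thesis unfolding tlift_eq case_prod_unfold by (rule *)
qed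

lemma pure_tensor_mem [carrier_intro]:
  assumes "vspace V" "vspace W" "v \<in> carrier V" "w \<in> carrier W"
  shows "pure_tensor V W v w \<in> carrier (tensor_space V W)"
  by (rule bilinear_closed[OF bilinear_pure_tensor]) (use assms in auto)

lemma linear_map_pure_tensor [linear_intro]:
  assumes "vspace V" "vspace W"
  shows "linear_map T V f \<Longrightarrow> w \<in> carrier W \<Longrightarrow>
      linear_map T (tensor_space V W) (\<lambda>x. pure_tensor V W (f x) w)"
    and "linear_map T W g \<Longrightarrow> v \<in> carrier V \<Longrightarrow>
      linear_map T (tensor_space V W) (\<lambda>x. pure_tensor V W v (g x))"
  using bilinear_left[OF bilinear_pure_tensor] bilinear_right[OF bilinear_pure_tensor] assms
  by blast+

lemma linear_map_tlift_arg [linear_intro]: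
  assumes "vspace V" "vspace W" "vspace U"
    and "linear_map T (tensor_space V W) t" "bilinear_map V W U F"
  shows "linear_map T U (\<lambda>x. tlift V W F (t x))"
  by (rule linear_map_compose[OF linear_map_tlift]) (use assms in auto)

text \<open>Here the parameter sits in the summand and the tensor stays fixed, so linearity is
  inherited term by term. The companion rule \<open>linear_map_tlift_arg\<close> varies the tensor
  and has to ask for a bilinear summand.\<close>

lemma linear_map_tlift_fun [linear_intro]:
  assumes U: "vspace U" and t: "t \<in> carrier (tensor_space V W)"
    and F: "\<And>v w. v \<in> carrier V \<Longrightarrow> w \<in> carrier W \<Longrightarrow> linear_map T U (\<lambda>x. F x v w)"
  shows "linear_map T U (\<lambda>x. tlift V W (F x) t)"
proof (rule linear_mapI)
  fix x y c assume x: "x \<in> carrier T"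
  show "tlift V W (F x) t \<in> carrier U"
    by (rule tlift_closed[OF U t]) (use F x linear_map_closed in blast)
  have "tlift V W (F (smult T c x)) t = tlift V W (\<lambda>v w. smult U c (F x v w)) t"
    by (rule tlift_cong[OF t]) (use linear_map_scale[OF F x] in blast)
  also have "\<dots> = smult U c (tlift V W (F x) t)"
    by (rule linear_map_tlift_apply[OF U _ t, symmetric])
      (use x linear_map_closed[OF F] U in \<open>auto intro: linear_map_smult linear_map_ident\<close>)
  finally show "tlift V W (F (smult T c x)) t = smult U c (tlift V W (F x) t)" .
  assume y: "y \<in> carrier T"
  have "tlift V W (F (x + y)) t = tlift V W (\<lambda>v w. F x v w + F y v w) t"
    by (rule tlift_cong[OF t]) (use linear_map_add[OF F x y] in blast)
  also have "\<dots> = tlift V W (F x) t + tlift V W (F y) t"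
    by (simp add: tlift_eq case_prod_unfold sum_list_addf)
  finally show "tlift V W (F (x + y)) t = tlift V W (F x) t + tlift V W (F y) t" .
qed

text \<open>By \<open>tlift_unique\<close> both maps equal the lift of one and the same bilinear
  map. Identities on \<open>X\<close> and \<open>Y\<close> are reduced to generators through
  this.\<close>

lemma tensor_ext:
  assumes "vspace V" "vspace W" "vspace U"
    and f: "linear_map (tensor_space V W) U f" and g: "linear_map (tensor_space V W) U g"
    and "\<And>v w. v \<in> carrier V \<Longrightarrow> w \<in> carrier W \<Longrightarrow> f (pure_tensor V W v w) = g (pure_tensor V W v w)"
    and t: "t \<in> carrier (tensor_space V W)"
  shows "f t = g t"
proof -
  have "bilinear_map V W U (\<lambda>v w. g (pure_tensor V W v w))"
    using assms by (intro bilinear_mapI linear_map_compose[OF g] linear_map_pure_tensor linear_map_ident)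
  from tlift_unique[OF assms(1-3) this f _ t] tlift_unique[OF assms(1-3) this g _ t] assms(6)
  show ?thesis by simp
qed

text \<open>The tensor constructions read only carrier and scalar multiplication. An algebra, its
  opposite and its underlying space therefore give literally equal tensor products, even though
  their record types differ.\<close>

lemma tensor_cong:
  fixes V :: "('k::field, 'v::ab_group_add, 'a) vspace_scheme"
    and W :: "('k, 'w::ab_group_add, 'b) vspace_scheme"
    and V' :: "('k, 'v, 'c) vspace_scheme" and W' :: "('k, 'w, 'd) vspace_scheme"
    and F :: "'v \<Rightarrow> 'w \<Rightarrow> 'u::ab_group_add"
  assumes "carrier V = carrier V'" "smult V = smult V'" "carrier W = carrier W'" "smult W = smult W'"
  shows "pure_tensor V W = pure_tensor V' W'"
    and "tensor_space V W = tensor_space V' W'"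
    and "tlift V W F = tlift V' W' F"
proof -
  show 1: "pure_tensor V W = pure_tensor V' W'"
    using assms by (simp add: pure_tensor_def bilinear_map_def linear_map_def fun_eq_iff)
  have 2: "tensor_of V W = tensor_of V' W'"
    by (simp add: tensor_of_def 1 fun_eq_iff)
  show "tensor_space V W = tensor_space V' W'"
    using assms by (simp add: tensor_space_def 2)
  show "tlift V W F = tlift V' W' F"
    using assms by (simp add: tlift_def 2 fun_eq_iff)
qed

section \<open>Sweedler calculus\<close>

locale hopf =
  fixes H :: "('k::field, 'h::ab_group_add, 'z) hopf_scheme" (structure)
  assumes hopf_algebra: "hopf_algebra H"
begin

abbreviation C where "C \<equiv> carrier H"
abbreviation sw where "sw \<equiv> sweedler2 H"
abbreviation S where "S \<equiv> antipode H"
abbreviation one where "one \<equiv> unity H"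
abbreviation eps where "eps \<equiv> counit H"

lemma algebra: "algebra H"
  using hopf_algebra by (simp add: hopf_algebra_def)

lemma vspace_H [carrier_intro]: "vspace H"
  using algebra by (simp add: algebra_def)

lemma bilinear_mult: "bilinear_map H H H (mult H)"
  using algebra by (simp add: algebra_def)

lemma unity_mem [carrier_intro, simp]: "one \<in> C"
  using algebra by (simp add: algebra_def)

lemma mult_mem [carrier_intro, simp]: "x \<in> C \<Longrightarrow> y \<in> C \<Longrightarrow> x \<cdot> y \<in> C"
  by (rule bilinear_closed[OF bilinear_mult])

lemma mult_assoc: "x \<in> C \<Longrightarrow> y \<in> C \<Longrightarrow> z \<in> C \<Longrightarrow> x \<cdot> y \<cdot> z = x \<cdot> (y \<cdot> z)"
  using algebra by (simp add: algebra_def)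

lemma unity_mult [simp]: "x \<in> C \<Longrightarrow> one \<cdot> x = x" "x \<in> C \<Longrightarrow> x \<cdot> one = x"
  using algebra by (simp_all add: algebra_def)

lemma linear_map_mult [linear_intro]:
  "linear_map V H f \<Longrightarrow> y \<in> C \<Longrightarrow> linear_map V H (\<lambda>x. f x \<cdot> y)"
  "linear_map V H f \<Longrightarrow> y \<in> C \<Longrightarrow> linear_map V H (\<lambda>x. y \<cdot> f x)"
  by (rule bilinear_left[OF bilinear_mult], assumption+)
    (rule bilinear_right[OF bilinear_mult], assumption+)

lemma smult_mem [carrier_intro, simp]: "x \<in> C \<Longrightarrow> smult H c x \<in> C"
  by (rule vspace_scale[OF vspace_H])

lemma smult_mult [simp]:
  "x \<in> C \<Longrightarrow> y \<in> C \<Longrightarrow> smult H c x \<cdot> y = smult H c (x \<cdot> y)"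
  "x \<in> C \<Longrightarrow> y \<in> C \<Longrightarrow> x \<cdot> smult H c y = smult H c (x \<cdot> y)"
  using linear_map_scale[OF linear_map_mult(1)[OF linear_map_ident]]
    linear_map_scale[OF linear_map_mult(2)[OF linear_map_ident]] by simp_all

lemma linear_comul: "linear_map H (tensor_space H H) (comul H)"
  using hopf_algebra by (simp add: hopf_algebra_def)

lemma comul_mem [carrier_intro]: "h \<in> C \<Longrightarrow> comul H h \<in> carrier (tensor_space H H)"
  by (rule linear_map_closed[OF linear_comul])

lemma linear_map_counit [linear_intro]: "linear_map V H f \<Longrightarrow> linear_map V base_field (\<lambda>x. eps (f x))"
  by (rule linear_map_compose) (use hopf_algebra in \<open>simp_all add: hopf_algebra_def\<close>)

lemma linear_map_antipode [linear_intro]: "linear_map V H f \<Longrightarrow> linear_map V H (\<lambda>x. S (f x))"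
  by (rule linear_map_compose) (use hopf_algebra in \<open>simp_all add: hopf_algebra_def\<close>)

lemma antipode_mem [carrier_intro, simp]: "h \<in> C \<Longrightarrow> S h \<in> C"
  by (rule linear_map_closed[OF linear_map_antipode[OF linear_map_ident]])

lemma sw_cong:
  "h \<in> C \<Longrightarrow> (\<And>a b. a \<in> C \<Longrightarrow> b \<in> C \<Longrightarrow> F a b = G a b) \<Longrightarrow> sw h F = sw h G"
  unfolding sweedler2_def by (rule tlift_cong[OF comul_mem])

lemma sw_mem [carrier_intro]:
  "vspace U \<Longrightarrow> h \<in> C \<Longrightarrow> (\<And>a b. a \<in> C \<Longrightarrow> b \<in> C \<Longrightarrow> F a b \<in> carrier U) \<Longrightarrow> sw h F \<in> carrier U"
  unfolding sweedler2_def by (rule tlift_closed[OF _ comul_mem])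

lemma sw_linear:
  "vspace U \<Longrightarrow> linear_map U U' f \<Longrightarrow> h \<in> C \<Longrightarrow>
    (\<And>a b. a \<in> C \<Longrightarrow> b \<in> C \<Longrightarrow> F a b \<in> carrier U) \<Longrightarrow> f (sw h F) = sw h (\<lambda>a b. f (F a b))"
  unfolding sweedler2_def by (rule linear_map_tlift_apply[OF _ _ comul_mem])

lemma sw_apply: "sw h F x = sw h (\<lambda>a b. F a b x)"
  unfolding sweedler2_def by (rule tlift_apply)

lemma sw_swap: "sw g (\<lambda>a b. sw h (\<lambda>c d. F a b c d)) = sw h (\<lambda>c d. sw g (\<lambda>a b. F a b c d))"
  unfolding sweedler2_def by (rule tlift_swap)

lemma linear_map_sw [linear_intro]:
  "vspace U \<Longrightarrow> linear_map V H f \<Longrightarrow> bilinear_map H H U F \<Longrightarrow> linear_map V U (\<lambda>x. sw (f x) F)"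
  "vspace U \<Longrightarrow> h \<in> C \<Longrightarrow> (\<And>a b. a \<in> C \<Longrightarrow> b \<in> C \<Longrightarrow> linear_map V U (\<lambda>x. G x a b)) \<Longrightarrow>
    linear_map V U (\<lambda>x. sw h (G x))"
  unfolding sweedler2_def
  by (rule linear_map_tlift_arg[OF vspace_H vspace_H _ linear_map_compose[OF linear_comul]],
      assumption+)
    (rule linear_map_tlift_fun[OF _ comul_mem], assumption+)

text \<open>The axiom is an equation in \<open>H \<otimes> (H \<otimes> H)\<close>. Applying to both
  sides the linear map \<open>?L\<close> induced by the trilinear \<open>F\<close> turns it into an
  equation of Sweedler sums with arbitrary summand.\<close>

lemma sw_coassoc:
  assumes h: "h \<in> C" and U: "vspace U"
    and F: "\<And>b c. b \<in> C \<Longrightarrow> c \<in> C \<Longrightarrow> linear_map H U (\<lambda>a. F a b c)"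
      "\<And>a c. a \<in> C \<Longrightarrow> c \<in> C \<Longrightarrow> linear_map H U (\<lambda>b. F a b c)"
      "\<And>a b. a \<in> C \<Longrightarrow> b \<in> C \<Longrightarrow> linear_map H U (\<lambda>c. F a b c)"
  shows "sw h (\<lambda>a b. sw a (\<lambda>a1 a2. F a1 a2 b)) = sw h (\<lambda>a b. sw b (\<lambda>b1 b2. F a b1 b2))"
proof -
  let ?HH = "tensor_space H H"
  let ?P = "\<lambda>a b c. pure_tensor H ?HH a (pure_tensor H H b c)"
  let ?L = "tlift H ?HH (\<lambda>a s. tlift H H (F a) s)"
  have bil: "bilinear_map H ?HH U (\<lambda>a s. tlift H H (F a) s)"
    using F by (intro linear_intro carrier_intro U)
  have L: "linear_map (tensor_space H ?HH) U ?L"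
    by (intro linear_map_tlift carrier_intro U bil)
  have P: "?L (?P a b c) = F a b c" if "a \<in> C" "b \<in> C" "c \<in> C" for a b c
    using that F
    by (simp add: tlift_pure_tensor[OF U bil] tlift_pure_tensor[OF U] linear_intro carrier_intro)
  have 1: "?L (sw h (\<lambda>a b. sw a (\<lambda>a1 a2. ?P a1 a2 b))) = sw h (\<lambda>a b. sw a (\<lambda>a1 a2. F a1 a2 b))"
    apply (subst sw_linear[OF _ L h]; (assumption | intro carrier_intro; assumption)?)
    apply (rule sw_cong[OF h])
    apply (subst sw_linear[OF _ L]; (assumption | intro carrier_intro; assumption)?)
    apply (rule sw_cong, assumption)
    apply (rule P; assumption)
    done
  have 2: "?L (sw h (\<lambda>a b. sw b (\<lambda>b1 b2. ?P a b1 b2))) = sw h (\<lambda>a b. sw b (\<lambda>b1 b2. F a b1 b2))"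
    apply (subst sw_linear[OF _ L h]; (assumption | intro carrier_intro; assumption)?)
    apply (rule sw_cong[OF h])
    apply (subst sw_linear[OF _ L]; (assumption | intro carrier_intro; assumption)?)
    apply (rule sw_cong, assumption)
    apply (rule P; assumption)
    done
  have "sw h (\<lambda>a b. sw a (\<lambda>a1 a2. ?P a1 a2 b)) = sw h (\<lambda>a b. sw b (\<lambda>b1 b2. ?P a b1 b2))"
    using hopf_algebra h by (simp add: hopf_algebra_def)
  with 1 2 show ?thesis by simp
qed

text \<open>Multiplicativity of the comultiplication, pushed through the linear map induced by
  \<open>F\<close>.\<close>

lemma sw_mult:
  assumes x: "x \<in> C" and y: "y \<in> C" and U: "vspace U" and F: "bilinear_map H H U F"
  shows "sw (x \<cdot> y) F = sw x (\<lambda>x1 x2. sw y (\<lambda>y1 y2. F (x1 \<cdot> y1) (x2 \<cdot> y2)))"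
proof -
  have L: "linear_map (tensor_space H H) U (tlift H H F)"
    by (intro linear_map_tlift carrier_intro U F)
  have "comul H (x \<cdot> y) =
      sw x (\<lambda>x1 x2. sw y (\<lambda>y1 y2. pure_tensor H H (x1 \<cdot> y1) (x2 \<cdot> y2)))"
    using hopf_algebra x y by (simp add: hopf_algebra_def tensor_alg_def sweedler2_def)
  then have "sw (x \<cdot> y) F =
      tlift H H F (sw x (\<lambda>x1 x2. sw y (\<lambda>y1 y2. pure_tensor H H (x1 \<cdot> y1) (x2 \<cdot> y2))))"
    by (simp add: sweedler2_def)
  also have "\<dots> = sw x (\<lambda>x1 x2. sw y (\<lambda>y1 y2. F (x1 \<cdot> y1) (x2 \<cdot> y2)))"
    apply (subst sw_linear[OF _ L x]; (assumption | intro carrier_intro y; assumption)?)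
    apply (rule sw_cong[OF x])
    apply (subst sw_linear[OF _ L y]; (assumption | intro carrier_intro; assumption)?)
    apply (rule sw_cong[OF y])
    apply (rule tlift_pure_tensor[OF U F]; (assumption | intro carrier_intro; assumption))
    done
  finally show ?thesis .
qed

lemma sw_unity:
  assumes U: "vspace U" and F: "bilinear_map H H U F"
  shows "sw one F = F one one"
proof -
  have "comul H one = pure_tensor H H one one"
    using hopf_algebra by (simp add: hopf_algebra_def tensor_alg_def)
  then show ?thesis using tlift_pure_tensor[OF U F] by (simp add: sweedler2_def)
qed

lemma counit_mult [simp]: "x \<in> C \<Longrightarrow> y \<in> C \<Longrightarrow> eps (x \<cdot> y) = eps x * eps y"
  and counit_unity [simp]: "eps one = 1"
  using hopf_algebra by (simp_all add: hopf_algebra_def)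

text \<open>A linear \<open>F\<close> moves out of the sum, where the known value of the inner
  expression can be substituted. Counit and antipode cancellations are both instances.\<close>

lemma sw_collapse:
  assumes U: "vspace U" and F: "linear_map H U F" and h: "h \<in> C"
    and G: "\<And>a b. a \<in> C \<Longrightarrow> b \<in> C \<Longrightarrow> G a b \<in> C" and eq: "sw h G = z"
  shows "sw h (\<lambda>a b. F (G a b)) = F z"
  using sw_linear[OF vspace_H F h, where F = G, OF G] eq by simp

lemma sw_counit:
  assumes "vspace U" "linear_map H U F" "h \<in> C"
  shows "sw h (\<lambda>a b. smult U (eps a) (F b)) = F h"
    and "sw h (\<lambda>a b. smult U (eps b) (F a)) = F h"
proof -
  have eq: "sw h (\<lambda>h1 h2. smult H (eps h1) h2) = h" "sw h (\<lambda>h1 h2. smult H (eps h2) h1) = h"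
    using hopf_algebra assms(3) by (simp_all add: hopf_algebra_def)
  have "sw h (\<lambda>a b. smult U (eps a) (F b)) = sw h (\<lambda>a b. F (smult H (eps a) b))"
    "sw h (\<lambda>a b. smult U (eps b) (F a)) = sw h (\<lambda>a b. F (smult H (eps b) a))"
    by (rule sw_cong[OF assms(3)], simp add: linear_map_scale[OF assms(2)])+
  then show "sw h (\<lambda>a b. smult U (eps a) (F b)) = F h"
    "sw h (\<lambda>a b. smult U (eps b) (F a)) = F h"
    using sw_collapse[OF assms _ eq(1)] sw_collapse[OF assms _ eq(2)] by simp_all
qed

lemma antipode_left: "h \<in> C \<Longrightarrow> sw h (\<lambda>a b. S a \<cdot> b) = smult H (eps h) one"
  and antipode_right: "h \<in> C \<Longrightarrow> sw h (\<lambda>a b. a \<cdot> S b) = smult H (eps h) one"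
  using hopf_algebra by (simp_all add: hopf_algebra_def)

end

section \<open>Bijectivity of the antipode\<close>

lemma vspace_scale_one: "vspace V \<Longrightarrow> smult V 1 x = x"
  and vspace_scale_scale: "vspace V \<Longrightarrow> smult V a (smult V b x) = smult V (a * b) x"
  by (simp_all add: vspace_def vector_space_def)

lemma vspace_diff:
  assumes "vspace V" "x \<in> carrier V" "y \<in> carrier V"
  shows "x - y \<in> carrier V"
proof -
  interpret vector_space "smult V" by (rule vspace_vector_space[OF assms(1)])
  show ?thesis using subspace_diff assms by (simp add: vspace_def)
qed

lemma linear_map_diff:
  assumes "vspace V" "linear_map V W f" "x \<in> carrier V" "y \<in> carrier V"
  shows "f (x - y) = f x - f y"
  using linear_map_add[OF assms(2) vspace_diff[OF assms(1,3,4)] assms(4)] by simp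

lemma linear_map_funpow [linear_intro]: "linear_map V V f \<Longrightarrow> linear_map V V (\<lambda>x. (f ^^ n) x)"
  by (induction n) (auto simp: linear_map_def)

lemma vspace_image:
  assumes V: "vspace V" and f: "linear_map V V f"
  shows "vspace \<lparr>carrier = f ` carrier V, smult = smult V\<rparr>"
proof -
  interpret vector_space "smult V" by (rule vspace_vector_space[OF V])
  have "subspace (f ` carrier V)"
    unfolding subspace_def
  proof (intro conjI ballI allI)
    show "0 \<in> f ` carrier V"
      using linear_map_zero[OF V f] vspace_zero[OF V] by (metis image_eqI)
    show "x + y \<in> f ` carrier V" if "x \<in> f ` carrier V" "y \<in> f ` carrier V" for x y
      using that by (auto simp: vspace_add[OF V] simp flip: linear_map_add[OF f])
    show "smult V c x \<in> f ` carrier V" if "x \<in> f ` carrier V" for c x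
      using that by (auto simp: vspace_scale[OF V] simp flip: linear_map_scale[OF f])
  qed
  then show ?thesis by (simp add: vspace_def vector_space_axioms)
qed

text \<open>A Krylov sequence in a finite-dimensional space is linearly dependent; the first nonzero
  coefficient of a dependency gives the preimage.\<close>

lemma krylov_dependence:
  assumes V: "vspace V" and fd: "finite_dimensional V" and f: "linear_map V V f"
    and h: "h \<in> carrier V"
  obtains j y where "y \<in> carrier V" "(f ^^ j) h = (f ^^ Suc j) y"
proof (rule ccontr)
  assume "\<not> thesis"
  with that have no: "(f ^^ j) h \<notin> (f ^^ Suc j) ` carrier V" for j by blast
  interpret vector_space "smult V" by (rule vspace_vector_space[OF V])
  obtain B where B: "finite B" "B \<subseteq> carrier V" "span B = carrier V"
    using fd by (auto simp: finite_dimensional_def)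
  define e where "e i = (f ^^ i) h" for i
  have eC: "e i \<in> carrier V" for i
    unfolding e_def by (rule linear_map_closed[OF linear_map_funpow[OF f] h])
  \<comment> \<open>All iterates after the \<open>j\<close>-th lie in the image of the power
    \<open>Suc j\<close>, a subspace which by \<open>no\<close> misses \<open>e j\<close>; hence
    \<open>notin\<close> below.\<close>
  have "e ` {j<..} \<subseteq> (f ^^ Suc j) ` carrier V" for j
  proof
    fix x assume "x \<in> e ` {j<..}"
    then obtain i where i: "j < i" "x = e i" by auto
    then have "x = (f ^^ Suc j) (e (i - Suc j))"
      by (simp add: e_def flip: funpow_add comp_apply[of "f ^^ _"] del: funpow.simps)
    with eC show "x \<in> (f ^^ Suc j) ` carrier V" by blast
  qed
  moreover have "subspace ((f ^^ Suc j) ` carrier V)" for j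
    using vspace_image[OF V linear_map_funpow[OF f, of "Suc j"]] by (simp add: vspace_def)
  ultimately have "span (e ` {j<..}) \<subseteq> (f ^^ Suc j) ` carrier V" for j
    by (rule span_minimal)
  with no have notin: "e j \<notin> span (e ` {j<..})" for j
    using h by (metis e_def subsetD)
  \<comment> \<open>\<open>notin\<close> controls only the span of later iterates, so the
    independent window is grown downwards from its upper end \<open>L\<close>. Injectivity is
    carried along in order to count the vectors.\<close>
  have ind: "independent (e ` {L - k..<L}) \<and> inj_on e {L - k..<L}" if "k \<le> L" for k L
    using that
  proof (induction k)
    case (Suc k)
    have eq: "{L - Suc k..<L} = insert (L - Suc k) {L - k..<L}" using Suc.prems by auto
    have sub: "e ` {L - k..<L} \<subseteq> e ` {L - Suc k<..}" using Suc.prems by auto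
    have "e (L - Suc k) \<notin> span (e ` {L - k..<L})"
      using notin span_mono[OF sub] by blast
    moreover have "independent (e ` {L - k..<L})" "inj_on e {L - k..<L}"
      using Suc by auto
    ultimately show ?case
      using independent_insertI span_base by (fastforce simp: eq)
  qed (simp add: independent_empty)
  \<comment> \<open>One vector more than the spanning set has elements.\<close>
  let ?L = "Suc (card B)"
  have "independent (e ` {0..<?L})" "inj_on e {0..<?L}" using ind[of ?L ?L] by auto
  moreover have "e ` {0..<?L} \<subseteq> span B" using eC B(3) by auto
  ultimately show False
    using independent_span_bound[OF B(1)] card_image[of e "{0..<?L}"] by fastforce
qed

text \<open>A maximal independent subset of the union of all kernels is finite. Each of its members
  is killed by some power; the largest of these exponents kills its span, and so the whole
  union.\<close>

lemma kernel_stabilizes: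
  assumes V: "vspace V" and fd: "finite_dimensional V" and f: "linear_map V V f"
  obtains n where "\<And>m x. x \<in> carrier V \<Longrightarrow> (f ^^ m) x = 0 \<Longrightarrow> (f ^^ n) x = 0"
proof -
  interpret vector_space "smult V" by (rule vspace_vector_space[OF V])
  obtain B where B: "finite B" "B \<subseteq> carrier V" "span B = carrier V"
    using fd by (auto simp: finite_dimensional_def)
  have f0: "(f ^^ m) 0 = 0" for m by (rule linear_map_zero[OF V linear_map_funpow[OF f]])
  have mono: "(f ^^ n) x = 0" if "(f ^^ m) x = 0" "m \<le> n" for m n x
    using that funpow_add[of "n - m" m f] f0[of "n - m"] by simp
  define U where "U = {x \<in> carrier V. \<exists>m. (f ^^ m) x = 0}"
  obtain I where I: "I \<subseteq> U" "independent I" "U \<subseteq> span I"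
    using maximal_independent_subset by blast
  have "finite I"
    using independent_span_bound[OF B(1) I(2)] I(1) B(3) by (auto simp: U_def)
  then have "\<exists>n. \<forall>x\<in>I. (f ^^ n) x = 0" using I(1)
  proof (induction I)
    case (insert x F)
    then obtain n m where "\<forall>x\<in>F. (f ^^ n) x = 0" "(f ^^ m) x = 0" by (auto simp: U_def)
    then have "\<forall>y\<in>insert x F. (f ^^ max n m) y = 0" using mono by auto
    then show ?case ..
  qed simp
  then obtain n where n: "\<forall>x\<in>I. (f ^^ n) x = 0" ..
  have "subspace {x \<in> carrier V. (f ^^ n) x = 0}"
    unfolding subspace_def using V f0[of n] linear_map_funpow[OF f, of n]
    by (auto simp: vspace_zero vspace_add vspace_scale linear_map_add linear_map_scale)
  then have "span I \<subseteq> {x \<in> carrier V. (f ^^ n) x = 0}"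
    by (rule span_minimal[rotated]) (use I(1) n in \<open>auto simp: U_def\<close>)
  with I(3) show thesis by (intro that[of n]) (auto simp: U_def)
qed

text \<open>The exponent delivered by \<open>krylov_dependence\<close> varies with the vector.
  Stabilization of the kernels replaces it by the uniform \<open>n\<close>, after which the image of
  the power \<open>n\<close> can be fed through ever higher powers.\<close>

lemma fitting:
  assumes V: "vspace V" and fd: "finite_dimensional V" and f: "linear_map V V f"
  obtains n where "\<And>m x. x \<in> carrier V \<Longrightarrow> (f ^^ m) x = 0 \<Longrightarrow> (f ^^ n) x = 0"
    and "\<And>m x. x \<in> carrier V \<Longrightarrow> n \<le> m \<Longrightarrow> (f ^^ m) x \<in> (f ^^ m) ` (f ^^ m) ` carrier V"
proof -
  obtain n where n: "\<And>m x. x \<in> carrier V \<Longrightarrow> (f ^^ m) x = 0 \<Longrightarrow> (f ^^ n) x = 0"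
    using kernel_stabilizes[OF assms] by blast
  have pow: "linear_map V V (f ^^ m)" for m using linear_map_funpow[OF f] by simp
  have step: "\<exists>y\<in>carrier V. (f ^^ n) x = (f ^^ Suc n) y" if x: "x \<in> carrier V" for x
  proof -
    obtain j y where y: "y \<in> carrier V" "(f ^^ j) x = (f ^^ Suc j) y"
      using krylov_dependence[OF assms x] by blast
    have fy: "f y \<in> carrier V" by (rule linear_map_closed[OF f y(1)])
    \<comment> \<open>The Krylov relation says that \<open>x - f y\<close> lies in some kernel,
      hence in the kernel of the power \<open>n\<close>.\<close>
    have "(f ^^ j) (x - f y) = 0"
      using y by (simp add: linear_map_diff[OF V pow x fy] funpow_swap1)
    then have "(f ^^ n) (x - f y) = 0" by (rule n[OF vspace_diff[OF V x fy]])
    then show ?thesis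
      using y(1) by (auto simp: linear_map_diff[OF V pow x fy] funpow_swap1)
  qed
  have steps: "\<exists>y\<in>carrier V. (f ^^ n) x = (f ^^ (k + n)) y" if x: "x \<in> carrier V" for x k
  proof (induction k)
    case (Suc k)
    then obtain y where y: "y \<in> carrier V" "(f ^^ n) x = (f ^^ (k + n)) y" by blast
    obtain z where z: "z \<in> carrier V" "(f ^^ n) y = (f ^^ Suc n) z" using step[OF y(1)] by blast
    have "(f ^^ n) x = (f ^^ k) ((f ^^ Suc n) z)" using y z by (simp add: funpow_add)
    also have "\<dots> = (f ^^ (Suc k + n)) z" by (simp add: funpow_add funpow_swap1)
    finally show ?case using z(1) by blast
  qed (use x in auto)
  have "(f ^^ m) x \<in> (f ^^ m) ` (f ^^ m) ` carrier V" if x: "x \<in> carrier V" and m: "n \<le> m" for x m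
  proof -
    obtain y where y: "y \<in> carrier V" "(f ^^ n) x = (f ^^ (m + n)) y" using steps[OF x] by blast
    have "(f ^^ m) x = (f ^^ (m - n)) ((f ^^ n) x)"
      using funpow_add[of "m - n" n f] m by simp
    also have "\<dots> = (f ^^ (m - n + (m + n))) y"
      using y(2) by (simp add: funpow_add)
    also have "m - n + (m + n) = m + m" using m by simp
    finally show ?thesis using y(1) by (auto simp: funpow_add)
  qed
  with n show thesis using that by blast
qed

section \<open>Cancellation rules and antimultiplicativity of the antipode\<close>

context hopf begin

lemma antipode_unity [simp]: "S one = one"
proof -
  have "sw one (\<lambda>a b. S a \<cdot> b) = S one \<cdot> one"
    by (rule sw_unity[OF vspace_H]) (intro linear_intro carrier_intro; assumption)
  then show ?thesis
    using antipode_left[OF unity_mem] vspace_scale_one[OF vspace_H]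
    by simp
qed

text \<open>Common interface of the cancellations: the two antipode identities, their two analogues
  for the inverse antipode, and one of them transported along \<open>\<pi>\<close>. The collapse
  lemmas are proved once for all of these.\<close>

definition counital where
  "counital G \<longleftrightarrow> bilinear_map H H H G \<and> (\<forall>h\<in>C. sw h G = smult H (eps h) one)"

lemma counital_antipode:
  "counital (\<lambda>a b. S a \<cdot> b)" "counital (\<lambda>a b. a \<cdot> S b)"
  by (auto simp: counital_def antipode_left antipode_right intro!: linear_intro carrier_intro)

lemma counital_linear:
  "counital G \<Longrightarrow> linear_map V H f \<Longrightarrow> w \<in> C \<Longrightarrow> linear_map V H (\<lambda>x. G (f x) w)"
  "counital G \<Longrightarrow> linear_map V H f \<Longrightarrow> w \<in> C \<Longrightarrow> linear_map V H (\<lambda>x. G w (f x))"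
  "counital G \<Longrightarrow> v \<in> C \<Longrightarrow> w \<in> C \<Longrightarrow> G v w \<in> C"
  by (auto simp: counital_def intro: bilinear_left bilinear_right bilinear_closed)

lemma sw_counital:
  assumes "counital G" "vspace U" "linear_map H U F" "h \<in> C"
  shows "sw h (\<lambda>a b. F (G a b)) = smult U (eps h) (F one)"
  using sw_collapse[OF assms(2-4), of G "smult H (eps h) one"] assms(1)
    linear_map_scale[OF assms(3) unity_mem] assms(4)
  by (auto simp: counital_def bilinear_closed)

text \<open>The inner sum becomes the counit of \<open>b\<close> times the value at
  \<open>one\<close>; the counit axiom then restores \<open>h\<close>.\<close>

lemma sw_collapse_right:
  assumes G: "counital G" and U: "vspace U" and F: "bilinear_map H H U F" and h: "h \<in> C"
  shows "sw h (\<lambda>a b. sw b (\<lambda>c d. F a (G c d))) = F h one"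
proof -
  have Fab: "linear_map H U (\<lambda>b. F a b)" "linear_map H U (\<lambda>b. F b a)" if "a \<in> C" for a
    using F that by (simp_all add: bilinear_map_def)
  have "sw h (\<lambda>a b. sw b (\<lambda>c d. F a (G c d))) = sw h (\<lambda>a b. smult U (eps b) (F a one))"
    by (rule sw_cong[OF h]) (rule sw_counital[OF G U Fab(1)])
  also have "\<dots> = F h one"
    by (rule sw_counit(2)[OF U Fab(2) h]) simp
  finally show ?thesis .
qed

lemma sw_collapse_left:
  assumes G: "counital G" and U: "vspace U" and F: "bilinear_map H H U F" and h: "h \<in> C"
  shows "sw h (\<lambda>a b. sw a (\<lambda>c d. F (G c d) b)) = F one h"
proof -
  have Fab: "linear_map H U (\<lambda>b. F a b)" "linear_map H U (\<lambda>b. F b a)" if "a \<in> C" for a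
    using F that by (simp_all add: bilinear_map_def)
  have "sw h (\<lambda>a b. sw a (\<lambda>c d. F (G c d) b)) = sw h (\<lambda>a b. smult U (eps a) (F one b))"
    by (rule sw_cong[OF h]) (rule sw_counital[OF G U Fab(2)])
  also have "\<dots> = F one h"
    by (rule sw_counit(1)[OF U Fab(1) h]) simp
  finally show ?thesis .
qed

text \<open>Uniqueness of convolution inverses: \<open>S (x \<cdot> y)\<close> is a left inverse and
  \<open>S y \<cdot> S x\<close> a right inverse of the product map on pairs. The triple convolution
  \<open>?F\<close> is evaluated in both bracketings; here the last two factors cancel, first in
  \<open>y\<close> and then in \<open>x\<close>.\<close>

lemma antipode_mult:
  assumes x: "x \<in> C" and y: "y \<in> C"
  shows "S (x \<cdot> y) = S y \<cdot> S x"
proof -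
  let ?F = "\<lambda>x1 x2 x3 y1 y2 y3. S (x1 \<cdot> y1) \<cdot> (x2 \<cdot> y2) \<cdot> (S y3 \<cdot> S x3)"
  let ?G = "\<lambda>x1 x2 x3 y1 y2 y3. S (x1 \<cdot> y1) \<cdot> (x2 \<cdot> (y2 \<cdot> S y3)) \<cdot> S x3"
  have "sw x (\<lambda>x1 x'. sw x' (\<lambda>x2 x3. sw y (\<lambda>y1 y'. sw y' (\<lambda>y2 y3. ?F x1 x2 x3 y1 y2 y3)))) =
      sw x (\<lambda>x1 x'. sw x' (\<lambda>x2 x3. sw y (\<lambda>y1 y'. sw y' (\<lambda>y2 y3. ?G x1 x2 x3 y1 y2 y3))))"
    by (intro sw_cong x y; (assumption | simp add: mult_assoc))
  also have "\<dots> = sw x (\<lambda>x1 x'. sw x' (\<lambda>x2 x3. S (x1 \<cdot> y) \<cdot> (x2 \<cdot> one) \<cdot> S x3))"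
    by (intro sw_cong x sw_collapse_right[OF counital_antipode(2) vspace_H _ y])
      (assumption | intro linear_intro carrier_intro; assumption)+
  also have "\<dots> = sw x (\<lambda>x1 x'. sw x' (\<lambda>x2 x3. S (x1 \<cdot> y) \<cdot> (x2 \<cdot> S x3)))"
    by (intro sw_cong x y; (assumption | simp add: mult_assoc y))
  also have "\<dots> = S (x \<cdot> y) \<cdot> one"
    by (rule sw_collapse_right[OF counital_antipode(2) vspace_H _ x])
      (intro linear_intro carrier_intro y; assumption)
  finally have 1: "sw x (\<lambda>x1 x'. sw x' (\<lambda>x2 x3. sw y (\<lambda>y1 y'. sw y' (\<lambda>y2 y3.
      ?F x1 x2 x3 y1 y2 y3)))) = S (x \<cdot> y)" using x y by simp
  \<comment> \<open>Other bracketing: coassociativity in both variables isolates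
    \<open>S (x1 \<cdot> y1) \<cdot> (x2 \<cdot> y2)\<close>, which is the antipode identity for the
    product \<open>x' \<cdot> y'\<close>.\<close>
  have "sw x (\<lambda>x1 x'. sw x' (\<lambda>x2 x3. sw y (\<lambda>y1 y'. sw y' (\<lambda>y2 y3. ?F x1 x2 x3 y1 y2 y3)))) =
      sw x (\<lambda>x' x3. sw x' (\<lambda>x1 x2. sw y (\<lambda>y1 y'. sw y' (\<lambda>y2 y3. ?F x1 x2 x3 y1 y2 y3))))"
    by (rule sw_coassoc[OF x vspace_H, symmetric]) (intro linear_intro carrier_intro y; assumption)+
  also have "\<dots> = sw x (\<lambda>x' x3. sw x' (\<lambda>x1 x2. sw y (\<lambda>y' y3. sw y' (\<lambda>y1 y2.
      ?F x1 x2 x3 y1 y2 y3))))"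
    by (intro sw_cong x sw_coassoc[OF y vspace_H, symmetric])
      (assumption | intro linear_intro carrier_intro; assumption)+
  also have "\<dots> = sw x (\<lambda>x' x3. sw y (\<lambda>y' y3. sw x' (\<lambda>x1 x2. sw y' (\<lambda>y1 y2.
      ?F x1 x2 x3 y1 y2 y3))))"
    by (rule sw_cong[OF x]) (rule sw_swap)
  also have "\<dots> = sw x (\<lambda>x' x3. sw y (\<lambda>y' y3. sw (x' \<cdot> y') (\<lambda>a b. S a \<cdot> b \<cdot> (S y3 \<cdot> S x3))))"
    by (intro sw_cong x y sw_mult[OF _ _ vspace_H, symmetric])
      (assumption | intro linear_intro carrier_intro; assumption)+
  also have "\<dots> = sw x (\<lambda>x' x3. sw y (\<lambda>y' y3. smult H (eps x' * eps y') (one \<cdot> (S y3 \<cdot> S x3))))"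
    apply (intro sw_cong x y; assumption?)
    apply (subst sw_counital[OF counital_antipode(1) vspace_H])
    apply (intro linear_intro carrier_intro; assumption)+
    apply simp
    done
  also have "\<dots> = sw x (\<lambda>x' x3. sw y (\<lambda>y' y3. smult H (eps y') (smult H (eps x') (S y3 \<cdot> S x3))))"
    by (intro sw_cong x y; assumption?)
      (simp add: mult.commute
        vspace_scale_scale[OF vspace_H])
  also have "\<dots> = sw x (\<lambda>x' x3. smult H (eps x') (S y \<cdot> S x3))"
    by (intro sw_cong x sw_counit(1)[OF vspace_H _ y]) (assumption | intro linear_intro carrier_intro; assumption)+
  also have "\<dots> = S y \<cdot> S x"
    by (rule sw_counit(1)[OF vspace_H _ x]) (intro linear_intro carrier_intro y; assumption)+
  finally show ?thesis using 1 by simp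
qed

lemma antipode_pow_mult:
  assumes "x \<in> C" "y \<in> C"
  shows "(S ^^ n) (x \<cdot> y) = (if even n then (S ^^ n) x \<cdot> (S ^^ n) y else (S ^^ n) y \<cdot> (S ^^ n) x)"
proof (induction n)
  case (Suc n)
  have "(S ^^ n) z \<in> C" if "z \<in> C" for z
    by (rule linear_map_closed[OF linear_map_funpow[OF linear_map_antipode[OF linear_map_ident]] that])
  with Suc assms show ?case by (simp add: antipode_mult)
qed simp

lemma linear_map_antipode_pow [linear_intro]: "linear_map V H f \<Longrightarrow> linear_map V H (\<lambda>x. (S ^^ n) (f x))"
  by (rule linear_map_compose[OF linear_map_funpow]) (intro linear_intro)

lemma antipode_pow_mem [carrier_intro, simp]: "h \<in> C \<Longrightarrow> (S ^^ n) h \<in> C"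
  by (rule linear_map_closed[OF linear_map_antipode_pow[OF linear_map_ident]])

lemma antipode_pow_unity [simp]: "(S ^^ n) one = one"
  by (induction n) simp_all

lemma antipode_pow_scale: "h \<in> C \<Longrightarrow> (S ^^ n) (smult H c h) = smult H c ((S ^^ n) h)"
  by (rule linear_map_scale[OF linear_map_antipode_pow[OF linear_map_ident]])

text \<open>\<open>\<pi>\<close> stands for the projection onto the image of a high even power of the antipode. The
  convolution product of the identity with \<open>S \<circ> \<pi>\<close> is mapped to the convolution
  unit by that power, and the antipode identity applied to \<open>\<Sum> h\<^sub>1 S (\<pi> h\<^sub>2)\<close> lowers the power by one.\<close>

lemma coinvariant_descent:
  assumes P: "linear_map H H \<pi>" and G: "counital (\<lambda>a b. S (\<pi> a) \<cdot> \<pi> b)"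
    and Sj: "\<And>h. h \<in> C \<Longrightarrow> (S ^^ Suc j) (sw h (\<lambda>a b. a \<cdot> S (\<pi> b))) = smult H (eps h) one"
    and h: "h \<in> C"
  shows "(S ^^ j) (sw h (\<lambda>a b. a \<cdot> S (\<pi> b))) = smult H (eps h) one"
proof -
  have P' [linear_intro]: "linear_map V H f \<Longrightarrow> linear_map V H (\<lambda>x. \<pi> (f x))"
    for V :: "('k, 'x::ab_group_add, 'y) vspace_scheme" and f
    by (rule linear_map_compose[OF P])
  have PC [carrier_intro, simp]: "x \<in> C \<Longrightarrow> \<pi> x \<in> C" for x
    by (rule linear_map_closed[OF P])
  let ?b = "\<lambda>h. sw h (\<lambda>a b. a \<cdot> S (\<pi> b))"
  have b [carrier_intro, simp]: "x \<in> C \<Longrightarrow> ?b x \<in> C" for x by (intro carrier_intro)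
  \<comment> \<open>The auxiliary sum \<open>?E\<close> is evaluated twice. Expanding
    \<open>S (h2 \<cdot> S (\<pi> h3))\<close> by antimultiplicativity puts
    \<open>S (\<pi> h4)\<close> next to \<open>S (S (\<pi> h3))\<close>; together they are
    \<open>S\<close> of the expression that \<open>G\<close> collapses, and what remains is the
    antipode identity.\<close>
  have "(S ^^ j) (sw h (\<lambda>h1 d. sw d (\<lambda>e h4. sw e (\<lambda>h2 h3. h1 \<cdot> S (\<pi> h4) \<cdot> S (h2 \<cdot> S (\<pi> h3)))))) =
      smult H (eps h) one" (is "(S ^^ j) ?E = _")
  proof -
    have "?E = sw h (\<lambda>h1 d. sw d (\<lambda>e h4. sw e (\<lambda>h2 h3. h1 \<cdot> S (S (\<pi> h3) \<cdot> \<pi> h4) \<cdot> S h2)))"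
      by (intro sw_cong h; (assumption | simp add: antipode_mult mult_assoc))
    also have "\<dots> = sw h (\<lambda>h1 d. sw d (\<lambda>h2 e. sw e (\<lambda>h3 h4. h1 \<cdot> S (S (\<pi> h3) \<cdot> \<pi> h4) \<cdot> S h2)))"
      by (rule sw_cong[OF h], rule sw_coassoc[OF _ vspace_H]) (assumption | intro linear_intro carrier_intro; assumption)+
    also have "\<dots> = sw h (\<lambda>h1 d. h1 \<cdot> S one \<cdot> S d)"
      by (intro sw_cong h sw_collapse_right[OF G vspace_H]) (assumption | intro linear_intro carrier_intro; assumption)+
    also have "\<dots> = sw h (\<lambda>h1 d. h1 \<cdot> S d)"
      by (rule sw_cong[OF h]) simp
    also have "\<dots> = smult H (eps h) one" by (rule antipode_right[OF h])
    finally show ?thesis by (simp add: antipode_pow_scale)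
  qed
  moreover have "(S ^^ j) ?E = (S ^^ j) (?b h)"
  proof -
    \<comment> \<open>The power \<open>j\<close> may preserve or reverse products, but by
      \<open>Sj\<close> the factor coming from \<open>S (?b y)\<close> becomes a multiple of
      \<open>one\<close>, so both parities give the same result. This is where \<open>Suc j\<close>
      drops to \<open>j\<close>.\<close>
    have scal: "(S ^^ j) (x \<cdot> S (?b y)) = smult H (eps y) ((S ^^ j) x)" if "x \<in> C" "y \<in> C" for x y
      using Sj[OF that(2)] that by (simp add: antipode_pow_mult funpow_swap1)
    have "?E = sw h (\<lambda>h1 d. sw d (\<lambda>e h4. h1 \<cdot> S (\<pi> h4) \<cdot> S (?b e)))"
      apply (intro sw_cong h; assumption?)
      apply (rule sw_linear[OF vspace_H, where U' = H, symmetric])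
        apply (intro linear_intro carrier_intro; assumption)
       apply assumption
      apply (intro carrier_intro; assumption)
      done
    then have "(S ^^ j) ?E = sw h (\<lambda>h1 d. (S ^^ j) (sw d (\<lambda>e h4. h1 \<cdot> S (\<pi> h4) \<cdot> S (?b e))))"
      apply (simp only:)
      apply (rule sw_linear[OF vspace_H _ h, where U' = H])
       apply (intro linear_intro)
      apply (intro carrier_intro; assumption)
      done
    also have "\<dots> = sw h (\<lambda>h1 d. sw d (\<lambda>e h4. (S ^^ j) (h1 \<cdot> S (\<pi> h4) \<cdot> S (?b e))))"
      apply (intro sw_cong h)
      apply (rule sw_linear[OF vspace_H, where U' = H])
        apply (intro linear_intro)
       apply assumption
      apply (intro carrier_intro; assumption)
      done
    also have "\<dots> = sw h (\<lambda>h1 d. sw d (\<lambda>e h4. smult H (eps e) ((S ^^ j) (h1 \<cdot> S (\<pi> h4)))))"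
      by (intro sw_cong h scal carrier_intro; assumption)
    also have "\<dots> = sw h (\<lambda>h1 d. (S ^^ j) (h1 \<cdot> S (\<pi> d)))"
      by (intro sw_cong h sw_counit(1) vspace_H) (assumption | intro linear_intro carrier_intro; assumption)+
    also have "\<dots> = (S ^^ j) (?b h)"
      by (rule sw_linear[OF vspace_H _ h, where U' = H, symmetric]) (intro linear_intro carrier_intro; assumption)+
    finally show ?thesis .
  qed
  ultimately show ?thesis by simp
qed

end

section \<open>Injectivity and surjectivity of the antipode in finite dimension\<close>

locale fd_hopf = hopf H for H :: "('k::field, 'h::ab_group_add, 'z) hopf_scheme" (structure) +
  assumes finite_dimensional: "finite_dimensional H"
begin

lemma antipode_kernel:
  assumes x: "x \<in> C" and "S x = 0"
  shows "x = 0"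
proof -
  have lS: "linear_map H H S" by (rule linear_map_antipode[OF linear_map_ident])
  obtain n where ker: "\<And>m x. x \<in> C \<Longrightarrow> (S ^^ m) x = 0 \<Longrightarrow> (S ^^ n) x = 0"
    and im: "\<And>m x. x \<in> C \<Longrightarrow> n \<le> m \<Longrightarrow> (S ^^ m) x \<in> (S ^^ m) ` (S ^^ m) ` C"
    using fitting[OF vspace_H finite_dimensional lS] by blast
  \<comment> \<open>Even, so that \<open>f\<close> preserves products; at least \<open>n\<close>, so
    that kernels and images have stabilized; positive, so that \<open>S x = 0\<close> forces
    \<open>f x = 0\<close>.\<close>
  define N where "N = 2 * Suc n"
  define f where "f = S ^^ N"
  have lf: "linear_map H H f" unfolding f_def by (intro linear_intro)
  have f_mem [simp]: "y \<in> C \<Longrightarrow> f y \<in> C" for y by (simp add: f_def)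
  have f_S: "f (S y) = S (f y)" for y by (simp add: f_def funpow_swap1)
  have f_mult: "y \<in> C \<Longrightarrow> z \<in> C \<Longrightarrow> f (y \<cdot> z) = f y \<cdot> f z" for y z
    by (simp add: f_def antipode_pow_mult antipode_mult N_def)
  have f_one: "f (smult H c one) = smult H c one" for c
    by (simp add: f_def antipode_pow_scale)
  have f0: "f 0 = 0" by (rule linear_map_zero[OF vspace_H lf])
  have ker_f: "f y = 0" if "y \<in> C" "f (f y) = 0" for y
  proof -
    have "(S ^^ (N + N)) y = 0" using that by (simp add: f_def funpow_add)
    then have "(S ^^ n) y = 0" by (rule ker[OF that(1)])
    moreover have "N = (N - n) + n" by (simp add: N_def)
    moreover have "(S ^^ (N - n)) 0 = 0"
      by (rule linear_map_zero[OF vspace_H linear_map_funpow[OF lS]])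
    ultimately show ?thesis using funpow_add[of "N - n" n S] by (simp add: f_def)
  qed
  define K where "K = f ` C"
  have K_mem: "y \<in> K \<Longrightarrow> y \<in> C" for y by (auto simp: K_def)
  have VK: "vspace \<lparr>carrier = K, smult = smult H\<rparr>"
    unfolding K_def by (rule vspace_image[OF vspace_H lf])
  \<comment> \<open>Since \<open>f\<close> and \<open>f \<circ> f\<close> have the same kernel,
    \<open>f\<close> is injective on its image \<open>K\<close>. Equations inside \<open>K\<close>
    can therefore be checked after applying \<open>f\<close>.\<close>
  have K_inj: "y = z" if "y \<in> K" "z \<in> K" "f y = f z" for y z
  proof -
    obtain u v where uv: "u \<in> C" "v \<in> C" "y = f u" "z = f v" using \<open>y \<in> K\<close> \<open>z \<in> K\<close> by (auto simp: K_def)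
    have d: "u - v \<in> C" by (rule vspace_diff[OF vspace_H uv(1,2)])
    have "f (f (u - v)) = 0"
      using uv that(3) by (simp add: linear_map_diff[OF vspace_H lf])
    from ker_f[OF d this] show ?thesis using uv by (simp add: linear_map_diff[OF vspace_H lf])
  qed
  \<comment> \<open>The image of \<open>f \<circ> f\<close> is that of \<open>f\<close>, so a
    preimage of \<open>f y\<close> can be taken in \<open>K\<close>. It is unique by
    \<open>K_inj\<close>, which is what makes the chosen \<open>\<pi>\<close> linear.\<close>
  have "\<exists>k. k \<in> K \<and> f k = f y" if "y \<in> C" for y
    using im[OF that, of N] by (auto simp: K_def f_def N_def)
  then obtain \<pi> where \<pi>: "\<And>y. y \<in> C \<Longrightarrow> \<pi> y \<in> K" "\<And>y. y \<in> C \<Longrightarrow> f (\<pi> y) = f y" by metis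
  have PC [carrier_intro, simp]: "y \<in> C \<Longrightarrow> \<pi> y \<in> C" for y using \<pi>(1) K_mem by blast
  have lP: "linear_map H H \<pi>"
  proof (rule linear_mapI)
    show "\<pi> y \<in> C" if "y \<in> C" for y using that by simp
    show "\<pi> (y + z) = \<pi> y + \<pi> z" if "y \<in> C" "z \<in> C" for y z
      using that vspace_add[OF VK] vspace_add[OF vspace_H]
      by - (rule K_inj, simp_all add: \<pi> linear_map_add[OF lf])
    show "\<pi> (smult H c y) = smult H c (\<pi> y)" if "y \<in> C" for c y
      using that vspace_scale[OF VK]
      by - (rule K_inj, simp_all add: \<pi> linear_map_scale[OF lf])
  qed
  have P [linear_intro]: "linear_map V H g \<Longrightarrow> linear_map V H (\<lambda>x. \<pi> (g x))"
    for V :: "('k, 'x::ab_group_add, 'y) vspace_scheme" and g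
    by (rule linear_map_compose[OF lP])
  have K_S: "S y \<in> K" if "y \<in> K" for y
    using that f_S by (auto simp: K_def simp flip: f_S)
  have K_mult: "y \<cdot> z \<in> K" if "y \<in> K" "z \<in> K" for y z
    using that by (auto simp: K_def simp flip: f_mult)
  have sw_f: "f (sw h F) = sw h (\<lambda>a b. f (F a b))"
    if "h \<in> C" "\<And>a b. a \<in> C \<Longrightarrow> b \<in> C \<Longrightarrow> F a b \<in> C" for h F
    by (rule sw_linear[OF vspace_H lf that])
  \<comment> \<open>Both sides lie in \<open>K\<close>, which is closed under \<open>S\<close> and
    products, and \<open>f\<close> cannot distinguish \<open>\<pi> y\<close> from \<open>y\<close>;
    so the antipode identity transfers.\<close>
  have G: "counital (\<lambda>a b. S (\<pi> a) \<cdot> \<pi> b)"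
    unfolding counital_def
  proof (intro conjI ballI)
    show "bilinear_map H H H (\<lambda>a b. S (\<pi> a) \<cdot> \<pi> b)" by (intro linear_intro carrier_intro)
    fix h assume h: "h \<in> C"
    show "sw h (\<lambda>a b. S (\<pi> a) \<cdot> \<pi> b) = smult H (eps h) one"
    proof (rule K_inj)
      show "sw h (\<lambda>a b. S (\<pi> a) \<cdot> \<pi> b) \<in> K"
        using sw_mem[OF VK h] K_mult K_S \<pi>(1) by simp
      show "smult H (eps h) one \<in> K"
        using f_one unfolding K_def by (metis image_eqI smult_mem unity_mem)
      have "f (sw h (\<lambda>a b. S (\<pi> a) \<cdot> \<pi> b)) = sw h (\<lambda>a b. f (S a \<cdot> b))"
        by (subst sw_f[OF h], simp) (rule sw_cong[OF h], simp add: f_mult f_S \<pi>)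
      also have "\<dots> = f (smult H (eps h) one)"
        by (subst sw_f[OF h, symmetric]) (simp_all add: antipode_left h)
      finally show "f (sw h (\<lambda>a b. S (\<pi> a) \<cdot> \<pi> b)) = f (smult H (eps h) one)" .
    qed
  qed
  \<comment> \<open>The left factor \<open>a\<close> need not lie in \<open>K\<close>, so
    \<open>K_inj\<close> cannot strip off \<open>f\<close>. Only the image under \<open>f\<close> is
    known at this point, and the descent has to remove the power.\<close>
  have b_f: "(S ^^ N) (sw h (\<lambda>a b. a \<cdot> S (\<pi> b))) = smult H (eps h) one" if h: "h \<in> C" for h
  proof -
    have "f (sw h (\<lambda>a b. a \<cdot> S (\<pi> b))) = sw h (\<lambda>a b. f (a \<cdot> S b))"
      by (subst sw_f[OF h], simp) (rule sw_cong[OF h], simp add: f_mult f_S \<pi>)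
    also have "\<dots> = f (smult H (eps h) one)"
      by (subst sw_f[OF h, symmetric]) (simp_all add: antipode_right h)
    finally show ?thesis unfolding f_one by (simp add: f_def)
  qed
  \<comment> \<open>Induction on the number \<open>i\<close> of powers already removed. The claim is
    kept for all \<open>h\<close> because each descent uses it at Sweedler components of
    \<open>h\<close>.\<close>
  have b_desc: "\<forall>h\<in>C. (S ^^ (N - i)) (sw h (\<lambda>a b. a \<cdot> S (\<pi> b))) = smult H (eps h) one"
    if "i \<le> N" for i
    using that
  proof (induction i)
    case (Suc i)
    then have eq: "N - i = Suc (N - Suc i)" by simp
    have "\<forall>h\<in>C. (S ^^ Suc (N - Suc i)) (sw h (\<lambda>a b. a \<cdot> S (\<pi> b))) = smult H (eps h) one"
      unfolding eq[symmetric] using Suc by simp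
    then show ?case
      by - (rule ballI, rule coinvariant_descent[OF lP G, of "N - Suc i"], blast+)
  qed (simp add: b_f)
  have b: "sw h (\<lambda>a b. a \<cdot> S (\<pi> b)) = smult H (eps h) one" if "h \<in> C" for h
    using b_desc[of N] that by simp
  have "\<pi> x = x"
  proof -
    \<comment> \<open>The sum of \<open>h1 \<cdot> S (\<pi> h2) \<cdot> \<pi> h3\<close> in two
      bracketings: cancelling on the right by \<open>G\<close> leaves \<open>x\<close>, cancelling
      on the left by \<open>b\<close> leaves \<open>\<pi> x\<close>.\<close>
    have "x = sw x (\<lambda>h1 d. sw d (\<lambda>h2 h3. h1 \<cdot> (S (\<pi> h2) \<cdot> \<pi> h3)))"
      using sw_collapse_right[OF G vspace_H bilinear_mult x] x by simp
    also have "\<dots> = sw x (\<lambda>d h3. sw d (\<lambda>h1 h2. h1 \<cdot> (S (\<pi> h2) \<cdot> \<pi> h3)))"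
      by (rule sw_coassoc[OF x vspace_H, symmetric]) (intro linear_intro carrier_intro; assumption)+
    also have "\<dots> = sw x (\<lambda>d h3. sw d (\<lambda>h1 h2. h1 \<cdot> S (\<pi> h2) \<cdot> \<pi> h3))"
      by (intro sw_cong x; (assumption | simp add: mult_assoc))
    also have "\<dots> = sw x (\<lambda>d h3. smult H (eps d) (\<pi> h3))"
    proof (rule sw_cong[OF x])
      fix d h3 assume d: "d \<in> C" "h3 \<in> C"
      have "sw d (\<lambda>h1 h2. h1 \<cdot> S (\<pi> h2) \<cdot> \<pi> h3) = sw d (\<lambda>h1 h2. h1 \<cdot> S (\<pi> h2)) \<cdot> \<pi> h3"
        by (rule sw_linear[OF vspace_H, where U' = H, symmetric]) (intro linear_intro carrier_intro d; assumption)+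
      then show "sw d (\<lambda>h1 h2. h1 \<cdot> S (\<pi> h2) \<cdot> \<pi> h3) = smult H (eps d) (\<pi> h3)"
        by (simp add: b d)
    qed
    also have "\<dots> = \<pi> x" by (rule sw_counit(1)[OF vspace_H lP x])
    finally show ?thesis by simp
  qed
  moreover have "f x = 0"
    using assms(2) linear_map_zero[OF vspace_H linear_map_funpow[OF lS], of "N - 1"]
    by (simp add: f_def N_def funpow_swap1)
  \<comment> \<open>Both \<open>\<pi> x\<close> and \<open>0\<close> lie in \<open>K\<close> and
    have the same image \<open>0\<close> under \<open>f\<close>.\<close>
  then have "\<pi> x = 0"
    using \<pi>(1,2)[OF x] vspace_zero[OF VK] f0 by - (rule K_inj, simp_all)
  ultimately show ?thesis by simp
qed

text \<open>Injectivity gives surjectivity through the Krylov relation for \<open>S\<close>: the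
  power \<open>j\<close> can be cancelled from \<open>(S ^^ j) h = (S ^^ Suc j) y\<close>, leaving
  \<open>h = S y\<close>.\<close>

lemma bij_antipode: "bij_betw S C C"
proof -
  have lS: "linear_map H H S" by (rule linear_map_antipode[OF linear_map_ident])
  have inj: "x = y" if "x \<in> C" "y \<in> C" "S x = S y" for x y
    using antipode_kernel[OF vspace_diff[OF vspace_H that(1,2)]] that
    by (simp add: linear_map_diff[OF vspace_H lS])
  have pow: "(S ^^ j) x = (S ^^ j) y \<Longrightarrow> x = y" if "x \<in> C" "y \<in> C" for x y j
    using that by (induction j) (auto dest: inj[rotated 2])
  have "h \<in> S ` C" if h: "h \<in> C" for h
  proof -
    obtain j y where y: "y \<in> C" "(S ^^ j) h = (S ^^ Suc j) y"
      using krylov_dependence[OF vspace_H finite_dimensional lS h] by blast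
    then have "h = S y" using pow[OF h, of "S y" j] by (simp add: funpow_swap1)
    with y(1) show ?thesis by blast
  qed
  then show ?thesis unfolding bij_betw_def inj_on_def using inj by auto
qed

abbreviation Si where "Si \<equiv> antipode_inv H"

lemma antipode_inv_mem [carrier_intro, simp]: "h \<in> C \<Longrightarrow> Si h \<in> C"
  and antipode_antipode_inv [simp]: "h \<in> C \<Longrightarrow> S (Si h) = h"
  using bij_antipode by (auto simp: antipode_inv_def bij_betw_def inv_into_into f_inv_into_f)

lemma antipode_inj: "x \<in> C \<Longrightarrow> y \<in> C \<Longrightarrow> S x = S y \<Longrightarrow> x = y"
  using bij_antipode by (auto simp: bij_betw_def inj_on_def)

lemma linear_map_antipode_inv [linear_intro]: "linear_map V H f \<Longrightarrow> linear_map V H (\<lambda>x. Si (f x))"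
proof -
  have lS: "linear_map H H S" by (rule linear_map_antipode[OF linear_map_ident])
  have "linear_map H H Si"
  proof (rule linear_mapI)
    show "Si x \<in> C" if "x \<in> C" for x using that by simp
    show "Si (x + y) = Si x + Si y" if "x \<in> C" "y \<in> C" for x y
      using that by - (rule antipode_inj, simp_all add: linear_map_add[OF lS] vspace_add[OF vspace_H])
    show "Si (smult H c x) = smult H c (Si x)" if "x \<in> C" for c x
      using that by - (rule antipode_inj, simp_all add: linear_map_scale[OF lS])
  qed
  then show "linear_map V H f \<Longrightarrow> linear_map V H (\<lambda>x. Si (f x))"
    by (rule linear_map_compose)
qed

text \<open>\<open>S\<close> reverses products, so applying it to these sums gives the ordinary
  antipode identities; \<open>S\<close> is then removed by injectivity. The reversal is also why the
  two Sweedler factors appear in swapped order.\<close>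

lemma counital_antipode_inv:
  "counital (\<lambda>a b. Si b \<cdot> a)" "counital (\<lambda>a b. b \<cdot> Si a)"
proof -
  have lS: "linear_map H H S" by (rule linear_map_antipode[OF linear_map_ident])
  have "sw h (\<lambda>a b. Si b \<cdot> a) = smult H (eps h) one"
    "sw h (\<lambda>a b. b \<cdot> Si a) = smult H (eps h) one" if h: "h \<in> C" for h
  proof -
    have "S (sw h (\<lambda>a b. Si b \<cdot> a)) = sw h (\<lambda>a b. S a \<cdot> b)"
      by (subst sw_linear[OF vspace_H lS h], simp) (rule sw_cong[OF h], simp add: antipode_mult)
    then show "sw h (\<lambda>a b. Si b \<cdot> a) = smult H (eps h) one"
      by - (rule antipode_inj, simp_all add: antipode_left h linear_map_scale[OF lS] sw_mem[OF vspace_H])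
    have "S (sw h (\<lambda>a b. b \<cdot> Si a)) = sw h (\<lambda>a b. a \<cdot> S b)"
      by (subst sw_linear[OF vspace_H lS h], simp) (rule sw_cong[OF h], simp add: antipode_mult)
    then show "sw h (\<lambda>a b. b \<cdot> Si a) = smult H (eps h) one"
      by - (rule antipode_inj, simp_all add: antipode_right h linear_map_scale[OF lS] sw_mem[OF vspace_H])
  qed
  then show "counital (\<lambda>a b. Si b \<cdot> a)" "counital (\<lambda>a b. b \<cdot> Si a)"
    unfolding counital_def by (auto intro!: linear_intro carrier_intro)
qed

end

section \<open>The dual and its regular actions\<close>

context hopf begin

abbreviation D where "D \<equiv> dual_hopf H"
abbreviation rr where "rr h p g \<equiv> (h \<rightharpoonup>\<^bsub>H\<^esub> p) \<leftharpoonup>\<^bsub>H\<^esub> g"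

lemma carrier_D: "carrier D = {p. linear_map H base_field p \<and> (\<forall>x. x \<notin> C \<longrightarrow> p x = 0)}"
  and smult_D: "smult D = (\<lambda>c p x. c * p x)"
  by (simp_all add: dual_hopf_def dual_space_def)

lemma linear_map_D: "p \<in> carrier D \<Longrightarrow> linear_map V H f \<Longrightarrow> linear_map V base_field (\<lambda>x. p (f x))"
  by (rule linear_map_compose) (simp_all add: carrier_D)

lemma D_ext: "p \<in> carrier D \<Longrightarrow> q \<in> carrier D \<Longrightarrow> (\<And>x. x \<in> C \<Longrightarrow> p x = q x) \<Longrightarrow> p = q"
  by (auto simp: carrier_D fun_eq_iff) metis

lemma vspace_D [carrier_intro]: "vspace D"
proof -
  interpret T: vector_space "\<lambda>c (p :: 'h \<Rightarrow> 'k) x. c * p x"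
    by unfold_locales (auto simp: algebra_simps fun_eq_iff)
  have "T.subspace (carrier D)"
    unfolding T.subspace_def
    by (auto simp: carrier_D linear_map_def algebra_simps)
  then show ?thesis by (simp add: vspace_def smult_D T.vector_space_axioms)
qed

lemma D_mult_apply: "x \<in> C \<Longrightarrow> (p \<cdot>\<^bsub>D\<^esub> q) x = sw x (\<lambda>a b. p a * q b)"
  and D_mult_outside: "x \<notin> C \<Longrightarrow> (p \<cdot>\<^bsub>D\<^esub> q) x = 0"
  by (simp_all add: dual_hopf_def)

lemma D_mult_mem [carrier_intro, simp]: "p \<in> carrier D \<Longrightarrow> q \<in> carrier D \<Longrightarrow> p \<cdot>\<^bsub>D\<^esub> q \<in> carrier D"
proof -
  assume p: "p \<in> carrier D" "q \<in> carrier D"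
  have "linear_map H base_field (\<lambda>x. sw x (\<lambda>a b. p a * q b))"
    by (intro linear_intro carrier_intro linear_map_D p)
  then have "linear_map H base_field (p \<cdot>\<^bsub>D\<^esub> q)"
    by (rule linear_map_cong[OF _ vspace_H]) (simp add: D_mult_apply)
  then show ?thesis by (simp add: carrier_D D_mult_outside)
qed

lemma bilinear_D_mult: "bilinear_map D D D (mult D)"
proof (intro bilinear_mapI linear_mapI)
  fix p q assume p: "p \<in> carrier D" "q \<in> carrier D"
  show "p \<cdot>\<^bsub>D\<^esub> q \<in> carrier D" "p \<cdot>\<^bsub>D\<^esub> q \<in> carrier D" using p by simp_all
  have L: "linear_map base_field base_field ((*) c)" for c :: 'k by (intro linear_intro)
  have sc: "c * sw x (\<lambda>a b. p a * q b) = sw x (\<lambda>a b. c * (p a * q b))" if "x \<in> C" for c x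
    by (rule sw_linear[OF vspace_base_field L that]) simp
  show "smult D c p \<cdot>\<^bsub>D\<^esub> q = smult D c (p \<cdot>\<^bsub>D\<^esub> q)" "p \<cdot>\<^bsub>D\<^esub> smult D c q = smult D c (p \<cdot>\<^bsub>D\<^esub> q)" for c
    using sc D_mult_outside
    by (auto simp: fun_eq_iff dual_hopf_def dual_space_def algebra_simps)
  fix r assume r: "r \<in> carrier D"
  have "sw x (\<lambda>a b. F a b + G a b) = sw x F + sw x G" for x and F G :: "'h \<Rightarrow> 'h \<Rightarrow> 'k"
    by (simp add: sweedler2_def tlift_eq case_prod_unfold sum_list_addf)
  then show "(p + r) \<cdot>\<^bsub>D\<^esub> q = p \<cdot>\<^bsub>D\<^esub> q + r \<cdot>\<^bsub>D\<^esub> q" "p \<cdot>\<^bsub>D\<^esub> (q + r) = p \<cdot>\<^bsub>D\<^esub> q + p \<cdot>\<^bsub>D\<^esub> r"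
    by (auto simp: fun_eq_iff dual_hopf_def algebra_simps)
qed

lemma linear_map_D_mult [linear_intro]:
  "linear_map V D f \<Longrightarrow> q \<in> carrier D \<Longrightarrow> linear_map V D (\<lambda>x. f x \<cdot>\<^bsub>D\<^esub> q)"
  "linear_map V D f \<Longrightarrow> q \<in> carrier D \<Longrightarrow> linear_map V D (\<lambda>x. q \<cdot>\<^bsub>D\<^esub> f x)"
  by (rule bilinear_left[OF bilinear_D_mult], assumption+)
    (rule bilinear_right[OF bilinear_D_mult], assumption+)

lemma unity_D_mem [carrier_intro, simp]: "unity D \<in> carrier D"
proof -
  have "linear_map H base_field (unity D)"
    by (rule linear_map_cong[OF linear_map_counit[OF linear_map_ident] vspace_H])
      (simp add: dual_hopf_def)
  then show ?thesis by (simp add: carrier_D) (simp add: dual_hopf_def)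
qed

lemma rr_apply: "x \<in> C \<Longrightarrow> g \<in> C \<Longrightarrow> rr h p g x = p (g \<cdot> x \<cdot> h)"
  by (simp add: left_regular_def right_regular_def)

lemma rr_mem [carrier_intro, simp]: "h \<in> C \<Longrightarrow> p \<in> carrier D \<Longrightarrow> g \<in> C \<Longrightarrow> rr h p g \<in> carrier D"
proof -
  assume a: "h \<in> C" "p \<in> carrier D" "g \<in> C"
  have "linear_map H base_field (\<lambda>x. p (g \<cdot> x \<cdot> h))" by (intro linear_intro linear_map_D a)
  then have "linear_map H base_field (rr h p g)"
    by (rule linear_map_cong[OF _ vspace_H]) (simp add: rr_apply a)
  then show ?thesis by (simp add: carrier_D right_regular_def)
qed

text \<open>Operations in the dual are pointwise and forms vanish outside \<open>C\<close>, so
  evaluation at the elements of \<open>C\<close> decides linearity.\<close>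

lemma linear_map_to_D:
  assumes "\<And>x. x \<in> carrier V \<Longrightarrow> f x \<in> carrier D"
    and "\<And>y. y \<in> C \<Longrightarrow> linear_map V base_field (\<lambda>x. f x y)" and V: "vspace V"
  shows "linear_map V D f"
proof (rule linear_mapI)
  fix x c assume x: "x \<in> carrier V"
  show "f x \<in> carrier D" using x assms by simp
  show "f (smult V c x) = smult D c (f x)"
  proof (rule D_ext)
    show "smult D c (f x) \<in> carrier D" using x assms vspace_scale[OF vspace_D] by simp
    show "f (smult V c x) y = smult D c (f x) y" if "y \<in> C" for y
      using linear_map_scale[OF assms(2)[OF that] x] by (simp add: smult_D)
  qed (use x V assms vspace_scale in blast)
  fix y assume y: "y \<in> carrier V"
  show "f (x + y) = f x + f y"
  proof (rule D_ext)
    show "f x + f y \<in> carrier D" using x y assms vspace_add[OF vspace_D] by simp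
    show "f (x + y) z = (f x + f y) z" if "z \<in> C" for z
      using linear_map_add[OF assms(2)[OF that] x y] by simp
  qed (use x y V assms vspace_add in blast)
qed

lemma linear_map_rr [linear_intro]:
  "linear_map V H f \<Longrightarrow> p \<in> carrier D \<Longrightarrow> g \<in> C \<Longrightarrow> linear_map V D (\<lambda>x. rr (f x) p g)"
  "linear_map V D k \<Longrightarrow> h \<in> C \<Longrightarrow> g \<in> C \<Longrightarrow> linear_map V D (\<lambda>x. rr h (k x) g)"
  "linear_map V H f \<Longrightarrow> p \<in> carrier D \<Longrightarrow> h \<in> C \<Longrightarrow> linear_map V D (\<lambda>x. rr h p (f x))"
proof -
  assume g: "g \<in> C"
  have "linear_map H D (\<lambda>x. rr x p g)" if p: "p \<in> carrier D"
  proof (rule linear_map_to_D[OF _ _ vspace_H])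
    show "linear_map H base_field (\<lambda>x. rr x p g y)" if y: "y \<in> C" for y
      by (rule linear_map_cong[OF _ vspace_H, of _ "\<lambda>x. p (g \<cdot> y \<cdot> x)"])
        (use y g in \<open>auto simp: rr_apply intro!: linear_intro linear_map_D p\<close>)
  qed (use p g in auto)
  then show "linear_map V H f \<Longrightarrow> p \<in> carrier D \<Longrightarrow> linear_map V D (\<lambda>x. rr (f x) p g)"
    using linear_map_compose by blast
next
  assume h: "h \<in> C"
  have "linear_map H D (\<lambda>x. rr h p x)" if p: "p \<in> carrier D"
  proof (rule linear_map_to_D[OF _ _ vspace_H])
    show "linear_map H base_field (\<lambda>x. rr h p x y)" if y: "y \<in> C" for y
      by (rule linear_map_cong[OF _ vspace_H, of _ "\<lambda>x. p (x \<cdot> y \<cdot> h)"])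
        (use y h in \<open>auto simp: rr_apply intro!: linear_intro linear_map_D p\<close>)
  qed (use p h in auto)
  then show "linear_map V H f \<Longrightarrow> p \<in> carrier D \<Longrightarrow> linear_map V D (\<lambda>x. rr h p (f x))"
    using linear_map_compose by blast
next
  assume a: "h \<in> C" "g \<in> C"
  have "linear_map D D (\<lambda>p. rr h p g)"
    using a
    by (intro linear_mapI rr_mem) (auto simp: fun_eq_iff left_regular_def right_regular_def smult_D)
  then show "linear_map V D k \<Longrightarrow> linear_map V D (\<lambda>x. rr h (k x) g)"
    using linear_map_compose by blast
qed

lemma rr_unity [simp]: "p \<in> carrier D \<Longrightarrow> rr one p one = p"
  by (rule D_ext) (simp_all add: rr_apply)

lemma rr_rr:
  "h \<in> C \<Longrightarrow> h' \<in> C \<Longrightarrow> g \<in> C \<Longrightarrow> g' \<in> C \<Longrightarrow> p \<in> carrier D \<Longrightarrow>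
    rr h (rr h' p g') g = rr (h \<cdot> h') p (g' \<cdot> g)"
  by (rule D_ext) (simp_all add: rr_apply mult_assoc)

text \<open>The iterated sums are nested to the right, whereas the cancelling factors are the first
  two; one use of coassociativity brings them together.\<close>

lemma sw_collapse_nested_left:
  assumes G: "counital G" and U: "vspace U" and F: "bilinear_map H H U F" and h: "h \<in> C"
  shows "sw h (\<lambda>a b. sw b (\<lambda>c d. F (G a c) d)) = F one h"
proof -
  have "sw h (\<lambda>a b. sw b (\<lambda>c d. F (G a c) d)) = sw h (\<lambda>b d. sw b (\<lambda>a c. F (G a c) d))"
    by (rule sw_coassoc[OF h U, symmetric])
      (intro bilinear_left[OF F] bilinear_right[OF F] counital_linear[OF G] linear_intro; assumption)+
  then show ?thesis using sw_collapse_left[OF assms] by simp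
qed

text \<open>In effect the Sweedler sum of \<open>g \<otimes> h\<close> in the tensor product
  coalgebra \<open>H \<otimes> H\<close>: \<open>F\<close> receives both components of the first
  leg, then both of the second.\<close>

abbreviation SS where
  "SS g h F \<equiv> sw g (\<lambda>g1 g2. sw h (\<lambda>h1 h2. F g1 h1 g2 h2))"

lemma SS_cong:
  assumes "g \<in> C" "h \<in> C"
    and "\<And>a b c d. a \<in> C \<Longrightarrow> b \<in> C \<Longrightarrow> c \<in> C \<Longrightarrow> d \<in> C \<Longrightarrow> F a b c d = G a b c d"
  shows "SS g h F = SS g h G"
  by (intro sw_cong assms)

lemma SS_linear:
  assumes U: "vspace U" and f: "linear_map U U' f" and g: "g \<in> C" and h: "h \<in> C"
    and F: "\<And>a b c d. a \<in> C \<Longrightarrow> b \<in> C \<Longrightarrow> c \<in> C \<Longrightarrow> d \<in> C \<Longrightarrow> F a b c d \<in> carrier U"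
  shows "f (SS g h F) = SS g h (\<lambda>a b c d. f (F a b c d))"
proof -
  have "f (SS g h F) = sw g (\<lambda>a c. f (sw h (\<lambda>b d. F a b c d)))"
    by (rule sw_linear[OF U f g]) (intro sw_mem U h F)
  also have "\<dots> = SS g h (\<lambda>a b c d. f (F a b c d))"
    by (rule sw_cong[OF g], rule sw_linear[OF U f h]) (rule F)
  finally show ?thesis .
qed

lemma SS_swap:
  "SS g h (\<lambda>a b c d. SS g' h' (\<lambda>a' b' c' d'. F a b c d a' b' c' d')) =
   SS g' h' (\<lambda>a' b' c' d'. SS g h (\<lambda>a b c d. F a b c d a' b' c' d'))"
proof -
  have "SS g h (\<lambda>a b c d. SS g' h' (\<lambda>a' b' c' d'. F a b c d a' b' c' d')) =
      sw g (\<lambda>a c. sw g' (\<lambda>a' c'. sw h (\<lambda>b d. sw h' (\<lambda>b' d'. F a b c d a' b' c' d'))))"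
    by (subst sw_swap) (rule refl)
  also have "\<dots> = sw g' (\<lambda>a' c'. sw g (\<lambda>a c. sw h (\<lambda>b d. sw h' (\<lambda>b' d'. F a b c d a' b' c' d'))))"
    by (rule sw_swap)
  also have "\<dots> = sw g' (\<lambda>a' c'. sw g (\<lambda>a c. sw h' (\<lambda>b' d'. sw h (\<lambda>b d. F a b c d a' b' c' d'))))"
    by (subst (2) sw_swap) (rule refl)
  also have "\<dots> = sw g' (\<lambda>a' c'. sw h' (\<lambda>b' d'. sw g (\<lambda>a c. sw h (\<lambda>b d. F a b c d a' b' c' d'))))"
    by (subst (2) sw_swap) (rule refl)
  finally show ?thesis .
qed

text \<open>Interchanging sums separates the part in \<open>g\<close> from the part in
  \<open>h\<close>; coassociativity is applied to each, and the sums are interleaved again.\<close>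

lemma SS_coassoc:
  assumes g: "g \<in> C" and h: "h \<in> C" and U: "vspace U"
    and F1: "\<And>b c d e f. b \<in> C \<Longrightarrow> c \<in> C \<Longrightarrow> d \<in> C \<Longrightarrow> e \<in> C \<Longrightarrow> f \<in> C \<Longrightarrow>
        linear_map H U (\<lambda>a. F a b c d e f)"
    and F2: "\<And>a c d e f. a \<in> C \<Longrightarrow> c \<in> C \<Longrightarrow> d \<in> C \<Longrightarrow> e \<in> C \<Longrightarrow> f \<in> C \<Longrightarrow>
        linear_map H U (\<lambda>b. F a b c d e f)"
    and F3: "\<And>a b d e f. a \<in> C \<Longrightarrow> b \<in> C \<Longrightarrow> d \<in> C \<Longrightarrow> e \<in> C \<Longrightarrow> f \<in> C \<Longrightarrow>
        linear_map H U (\<lambda>c. F a b c d e f)"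
    and F4: "\<And>a b c e f. a \<in> C \<Longrightarrow> b \<in> C \<Longrightarrow> c \<in> C \<Longrightarrow> e \<in> C \<Longrightarrow> f \<in> C \<Longrightarrow>
        linear_map H U (\<lambda>d. F a b c d e f)"
    and F5: "\<And>a b c d f. a \<in> C \<Longrightarrow> b \<in> C \<Longrightarrow> c \<in> C \<Longrightarrow> d \<in> C \<Longrightarrow> f \<in> C \<Longrightarrow>
        linear_map H U (\<lambda>e. F a b c d e f)"
    and F6: "\<And>a b c d e. a \<in> C \<Longrightarrow> b \<in> C \<Longrightarrow> c \<in> C \<Longrightarrow> d \<in> C \<Longrightarrow> e \<in> C \<Longrightarrow>
        linear_map H U (\<lambda>f. F a b c d e f)"
  shows "SS g h (\<lambda>s r e f. SS s r (\<lambda>a b c d. F a b c d e f)) =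
    SS g h (\<lambda>a b s r. SS s r (\<lambda>c d e f. F a b c d e f))"
proof -
  have "SS g h (\<lambda>s r e f. SS s r (\<lambda>a b c d. F a b c d e f)) =
      sw g (\<lambda>s e. sw s (\<lambda>a c. sw h (\<lambda>r f. sw r (\<lambda>b d. F a b c d e f))))"
    by (subst sw_swap) (rule refl)
  also have "\<dots> = sw g (\<lambda>s e. sw s (\<lambda>a c. sw h (\<lambda>b r. sw r (\<lambda>d f. F a b c d e f))))"
    by (rule sw_cong[OF g], rule sw_cong, assumption, rule sw_coassoc[OF h U])
      (rule F2 F4 F6; assumption)+
  also have "\<dots> = sw g (\<lambda>a s. sw s (\<lambda>c e. sw h (\<lambda>b r. sw r (\<lambda>d f. F a b c d e f))))"
    by (rule sw_coassoc[OF g U]) (intro linear_map_sw(2) U h F1 F3 F5; assumption)+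
  also have "\<dots> = SS g h (\<lambda>a b s r. SS s r (\<lambda>c d e f. F a b c d e f))"
    by (subst (2) sw_swap) (rule refl)
  finally show ?thesis .
qed

text \<open>Two different cancellations happen at once, \<open>G\<close> along \<open>g\<close> and
  \<open>G'\<close> along \<open>h\<close>, since the formulas pair the antipode on one side with
  its inverse on the other.\<close>

lemma SS_collapse:
  assumes G: "counital G" "counital G'" and U: "vspace U" and g: "g \<in> C" and h: "h \<in> C"
    and F1: "\<And>b c d. b \<in> C \<Longrightarrow> c \<in> C \<Longrightarrow> d \<in> C \<Longrightarrow> linear_map H U (\<lambda>a. F a b c d)"
    and F2: "\<And>a c d. a \<in> C \<Longrightarrow> c \<in> C \<Longrightarrow> d \<in> C \<Longrightarrow> linear_map H U (\<lambda>b. F a b c d)"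
    and F3: "\<And>a b d. a \<in> C \<Longrightarrow> b \<in> C \<Longrightarrow> d \<in> C \<Longrightarrow> linear_map H U (\<lambda>c. F a b c d)"
    and F4: "\<And>a b c. a \<in> C \<Longrightarrow> b \<in> C \<Longrightarrow> c \<in> C \<Longrightarrow> linear_map H U (\<lambda>d. F a b c d)"
  shows "SS g h (\<lambda>a b s r. SS s r (\<lambda>c d e f. F (G a c) (G' b d) e f)) = F one one g h"
proof -
  note G_mem = counital_linear(3)[OF G(1)] counital_linear(3)[OF G(2)]
  have "SS g h (\<lambda>a b s r. SS s r (\<lambda>c d e f. F (G a c) (G' b d) e f)) =
      sw g (\<lambda>a s. sw s (\<lambda>c e. sw h (\<lambda>b r. sw r (\<lambda>d f. F (G a c) (G' b d) e f))))"
    by (subst sw_swap) (rule refl)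
  also have "\<dots> = sw g (\<lambda>a s. sw s (\<lambda>c e. F (G a c) one e h))"
    by (rule sw_cong[OF g], rule sw_cong, assumption,
        rule sw_collapse_nested_left[OF G(2) U _ h, of "\<lambda>x f. F (G _ _) x _ f"])
      (intro bilinear_mapI F2 F4 G_mem; assumption)
  also have "\<dots> = F one one g h"
    by (rule sw_collapse_nested_left[OF G(1) U _ g, of "\<lambda>x e. F x one e h"])
      (intro bilinear_mapI F1 F3 unity_mem h; assumption)
  finally show ?thesis .
qed

end

section \<open>The isomorphism between X and Y\<close>

lemma op_alg_simps [simp]:
  "carrier (op_alg A) = carrier A" "smult (op_alg A) = smult A"
  "mult (op_alg A) = (\<lambda>x y. y \<cdot>\<^bsub>A\<^esub> x)" "unity (op_alg A) = unity A"
  by (simp_all add: op_alg_def)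

lemma tensor_alg_simps [simp]:
  "carrier (tensor_alg A B) = carrier (tensor_space A B)"
  "smult (tensor_alg A B) = smult (tensor_space A B)"
  by (simp_all add: tensor_alg_def)

lemma tensor_op_alg [space_norm]:
  "pure_tensor (op_alg A) W = pure_tensor A W" "pure_tensor V (op_alg B) = pure_tensor V B"
  "tensor_space (op_alg A) W = tensor_space A W" "tensor_space V (op_alg B) = tensor_space V B"
  "tlift (op_alg A) W F = tlift A W F" "tlift V (op_alg B) F = tlift V B F"
  by (rule tensor_cong; simp)+

lemma tensor_tensor_alg [space_norm]:
  "pure_tensor (tensor_alg A A') W = pure_tensor (tensor_space A A') W"
  "pure_tensor V (tensor_alg B B') = pure_tensor V (tensor_space B B')"
  "tensor_space (tensor_alg A A') W = tensor_space (tensor_space A A') W"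
  "tensor_space V (tensor_alg B B') = tensor_space V (tensor_space B B')"
  "tlift (tensor_alg A A') W F = tlift (tensor_space A A') W F"
  "tlift V (tensor_alg B B') F = tlift V (tensor_space B B') F"
  by (rule tensor_cong; simp)+

lemma op_alg_bilinear:
  assumes "vspace A" "bilinear_map A A A (mult A)"
  shows "vspace (op_alg A)" "bilinear_map (op_alg A) (op_alg A) (op_alg A) (mult (op_alg A))"
  using assms by (simp_all add: vspace_def bilinear_map_def linear_map_def)

text \<open>Only bilinear products are asked for, so the dual and its opposite qualify without first
  being shown to be algebras.\<close>

lemma tensor_alg_mult:
  assumes A: "vspace A" "bilinear_map A A A (mult A)"
    and B: "vspace B" "bilinear_map B B B (mult B)"
  shows tensor_alg_bilinear:
      "bilinear_map (tensor_space A B) (tensor_space A B) (tensor_space A B) (mult (tensor_alg A B))"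
    and tensor_alg_mult_pure:
      "\<lbrakk>a \<in> carrier A; b \<in> carrier B; a' \<in> carrier A; b' \<in> carrier B\<rbrakk> \<Longrightarrow>
        pure_tensor A B a b \<cdot>\<^bsub>tensor_alg A B\<^esub> pure_tensor A B a' b' =
        pure_tensor A B (a \<cdot>\<^bsub>A\<^esub> a') (b \<cdot>\<^bsub>B\<^esub> b')"
proof -
  note [linear_intro] = bilinear_left[OF A(2)] bilinear_right[OF A(2)] bilinear_left[OF B(2)]
    bilinear_right[OF B(2)]
  note [carrier_intro] = bilinear_closed[OF A(2)] bilinear_closed[OF B(2)] A(1) B(1)
  let ?T = "tensor_space A B"
  have inner: "bilinear_map A B ?T (\<lambda>a' b'. pure_tensor A B (a \<cdot>\<^bsub>A\<^esub> a') (b \<cdot>\<^bsub>B\<^esub> b'))"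
    if "a \<in> carrier A" "b \<in> carrier B" for a b
    using that by (intro linear_intro carrier_intro)
  have outer: "bilinear_map A B ?T (\<lambda>a b. tlift A B (\<lambda>a' b'.
      pure_tensor A B (a \<cdot>\<^bsub>A\<^esub> a') (b \<cdot>\<^bsub>B\<^esub> b')) t)" if "t \<in> carrier ?T" for t
    using that by (intro linear_intro carrier_intro)
  show "bilinear_map ?T ?T ?T (mult (tensor_alg A B))"
    unfolding tensor_alg_def by simp (intro linear_intro carrier_intro; assumption)
  show "pure_tensor A B a b \<cdot>\<^bsub>tensor_alg A B\<^esub> pure_tensor A B a' b' =
      pure_tensor A B (a \<cdot>\<^bsub>A\<^esub> a') (b \<cdot>\<^bsub>B\<^esub> b')"
    if "a \<in> carrier A" "b \<in> carrier B" "a' \<in> carrier A" "b' \<in> carrier B"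
    using that A B
    by (simp add: tensor_alg_def tlift_pure_tensor[OF _ outer] tlift_pure_tensor[OF _ inner]
        vspace_tensor_space pure_tensor_mem)
qed

section \<open>Generators of \<open>X\<close> and \<open>Y\<close>, and linear maps determined on
  them\<close>

context hopf begin

abbreviation HH where "HH \<equiv> tensor_space H H"
abbreviation DD where "DD \<equiv> tensor_space D D"
abbreviation XX where "XX \<equiv> tensor_space HH DD"
abbreviation YY where "YY \<equiv> tensor_space D (tensor_space HH D)"

text \<open>The condition under which \<open>X_lift\<close> and \<open>Y_lift\<close> take the
  prescribed values on generators. The argument order is that of \<open>X\<close>; for
  \<open>Y\<close> the arguments are permuted at the point of use.\<close>

definition quadlinear where
  "quadlinear U F \<longleftrightarrow>
    (\<forall>h\<in>C. \<forall>p\<in>carrier D. \<forall>q\<in>carrier D. linear_map H U (\<lambda>g. F g h p q)) \<and>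
    (\<forall>g\<in>C. \<forall>p\<in>carrier D. \<forall>q\<in>carrier D. linear_map H U (\<lambda>h. F g h p q)) \<and>
    (\<forall>g\<in>C. \<forall>h\<in>C. \<forall>q\<in>carrier D. linear_map D U (\<lambda>p. F g h p q)) \<and>
    (\<forall>g\<in>C. \<forall>h\<in>C. \<forall>p\<in>carrier D. linear_map D U (\<lambda>q. F g h p q))"

lemma quadlinearI [linear_intro]:
  assumes "\<And>h p q. h \<in> C \<Longrightarrow> p \<in> carrier D \<Longrightarrow> q \<in> carrier D \<Longrightarrow> linear_map H U (\<lambda>g. F g h p q)"
    and "\<And>g p q. g \<in> C \<Longrightarrow> p \<in> carrier D \<Longrightarrow> q \<in> carrier D \<Longrightarrow> linear_map H U (\<lambda>h. F g h p q)"
    and "\<And>g h q. g \<in> C \<Longrightarrow> h \<in> C \<Longrightarrow> q \<in> carrier D \<Longrightarrow> linear_map D U (\<lambda>p. F g h p q)"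
    and "\<And>g h p. g \<in> C \<Longrightarrow> h \<in> C \<Longrightarrow> p \<in> carrier D \<Longrightarrow> linear_map D U (\<lambda>q. F g h p q)"
  shows "quadlinear U F"
  using assms by (simp add: quadlinear_def)

lemma quadlinearD:
  assumes "quadlinear U F"
  shows "h \<in> C \<Longrightarrow> p \<in> carrier D \<Longrightarrow> q \<in> carrier D \<Longrightarrow> linear_map H U (\<lambda>g. F g h p q)"
    and "g \<in> C \<Longrightarrow> p \<in> carrier D \<Longrightarrow> q \<in> carrier D \<Longrightarrow> linear_map H U (\<lambda>h. F g h p q)"
    and "g \<in> C \<Longrightarrow> h \<in> C \<Longrightarrow> q \<in> carrier D \<Longrightarrow> linear_map D U (\<lambda>p. F g h p q)"
    and "g \<in> C \<Longrightarrow> h \<in> C \<Longrightarrow> p \<in> carrier D \<Longrightarrow> linear_map D U (\<lambda>q. F g h p q)"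
  using assms by (simp_all add: quadlinear_def)

lemma X_elt_eq: "X_elt H g h p q = pure_tensor HH DD (pure_tensor H H g h) (pure_tensor D D p q)"
  unfolding X_elt_def space_norm ..

lemma Y_elt_eq:
  "Y_elt H p h g q =
    pure_tensor D (tensor_space HH D) p (pure_tensor HH D (pure_tensor H H h g) q)"
  unfolding Y_elt_def space_norm ..

lemma X_elt_mem [carrier_intro, simp]:
  "g \<in> C \<Longrightarrow> h \<in> C \<Longrightarrow> p \<in> carrier D \<Longrightarrow> q \<in> carrier D \<Longrightarrow> X_elt H g h p q \<in> carrier XX"
  unfolding X_elt_eq by (intro carrier_intro)

lemma Y_elt_mem [carrier_intro, simp]:
  "g \<in> C \<Longrightarrow> h \<in> C \<Longrightarrow> p \<in> carrier D \<Longrightarrow> q \<in> carrier D \<Longrightarrow> Y_elt H p h g q \<in> carrier YY"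
  unfolding Y_elt_eq by (intro carrier_intro)

lemma linear_map_X_elt [linear_intro]:
  "linear_map V H f \<Longrightarrow> h \<in> C \<Longrightarrow> p \<in> carrier D \<Longrightarrow> q \<in> carrier D \<Longrightarrow>
    linear_map V XX (\<lambda>x. X_elt H (f x) h p q)"
  "g \<in> C \<Longrightarrow> linear_map V H f \<Longrightarrow> p \<in> carrier D \<Longrightarrow> q \<in> carrier D \<Longrightarrow>
    linear_map V XX (\<lambda>x. X_elt H g (f x) p q)"
  "g \<in> C \<Longrightarrow> h \<in> C \<Longrightarrow> linear_map V D k \<Longrightarrow> q \<in> carrier D \<Longrightarrow>
    linear_map V XX (\<lambda>x. X_elt H g h (k x) q)"
  "g \<in> C \<Longrightarrow> h \<in> C \<Longrightarrow> p \<in> carrier D \<Longrightarrow> linear_map V D k \<Longrightarrow>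
    linear_map V XX (\<lambda>x. X_elt H g h p (k x))"
  unfolding X_elt_eq by (intro linear_intro carrier_intro; assumption)+

lemma linear_map_Y_elt [linear_intro]:
  "linear_map V D k \<Longrightarrow> h \<in> C \<Longrightarrow> g \<in> C \<Longrightarrow> q \<in> carrier D \<Longrightarrow>
    linear_map V YY (\<lambda>x. Y_elt H (k x) h g q)"
  "p \<in> carrier D \<Longrightarrow> linear_map V H f \<Longrightarrow> g \<in> C \<Longrightarrow> q \<in> carrier D \<Longrightarrow>
    linear_map V YY (\<lambda>x. Y_elt H p (f x) g q)"
  "p \<in> carrier D \<Longrightarrow> h \<in> C \<Longrightarrow> linear_map V H f \<Longrightarrow> q \<in> carrier D \<Longrightarrow>
    linear_map V YY (\<lambda>x. Y_elt H p h (f x) q)"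
  "p \<in> carrier D \<Longrightarrow> h \<in> C \<Longrightarrow> g \<in> C \<Longrightarrow> linear_map V D k \<Longrightarrow>
    linear_map V YY (\<lambda>x. Y_elt H p h g (k x))"
  unfolding Y_elt_eq by (intro linear_intro carrier_intro; assumption)+

lemma X_lift_eq:
  "X_lift H F = tlift HH DD (\<lambda>a f. tlift H H (\<lambda>g h. tlift D D (F g h) f) a)"
  unfolding X_lift_def space_norm ..

lemma Y_lift_eq:
  "Y_lift H F = tlift D (tensor_space HH D) (\<lambda>p s. tlift HH D (\<lambda>t q.
    tlift H H (\<lambda>h g. F p h g q) t) s)"
  unfolding Y_lift_def space_norm ..

lemma X_lift_bilinear:
  assumes U: "vspace U" and F: "quadlinear U F"
  shows "bilinear_map HH DD U (\<lambda>a f. tlift H H (\<lambda>g h. tlift D D (F g h) f) a)"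
  by (intro linear_intro carrier_intro U quadlinearD[OF F]; assumption)

lemma linear_map_X_lift:
  assumes "vspace U" "quadlinear U F"
  shows "linear_map XX U (X_lift H F)"
  unfolding X_lift_eq using assms by (intro linear_map_tlift X_lift_bilinear carrier_intro)

lemma X_lift_elt:
  assumes U: "vspace U" and F: "quadlinear U F"
    and "g \<in> C" "h \<in> C" "p \<in> carrier D" "q \<in> carrier D"
  shows "X_lift H F (X_elt H g h p q) = F g h p q"
proof -
  have 1: "bilinear_map H H U (\<lambda>g h. tlift D D (F g h) f)" if "f \<in> carrier DD" for f
    by (intro linear_intro carrier_intro U quadlinearD[OF F] that; (assumption | rule that)?)
  have 2: "bilinear_map D D U (F g h)" if "g \<in> C" "h \<in> C" for g h
    by (intro linear_intro carrier_intro U quadlinearD[OF F] that; (assumption | rule that)?)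
  show ?thesis
    using assms(3-6)
    by (simp add: X_lift_eq X_elt_eq tlift_pure_tensor[OF U X_lift_bilinear[OF U F]]
        tlift_pure_tensor[OF U 1] tlift_pure_tensor[OF U 2] pure_tensor_mem vspace_H vspace_D)
qed

lemma Y_lift_bilinear:
  assumes U: "vspace U" and F: "quadlinear U (\<lambda>g h p q. F p h g q)"
  shows "bilinear_map D (tensor_space HH D) U
    (\<lambda>p s. tlift HH D (\<lambda>t q. tlift H H (\<lambda>h g. F p h g q) t) s)"
  by (intro linear_intro carrier_intro U quadlinearD[OF F]; assumption)

lemma linear_map_Y_lift:
  assumes "vspace U" "quadlinear U (\<lambda>g h p q. F p h g q)"
  shows "linear_map YY U (Y_lift H F)"
  unfolding Y_lift_eq using assms by (intro linear_map_tlift Y_lift_bilinear carrier_intro)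

lemma Y_lift_elt:
  assumes U: "vspace U" and F: "quadlinear U (\<lambda>g h p q. F p h g q)"
    and "g \<in> C" "h \<in> C" "p \<in> carrier D" "q \<in> carrier D"
  shows "Y_lift H F (Y_elt H p h g q) = F p h g q"
proof -
  have 1: "bilinear_map HH D U (\<lambda>t q. tlift H H (\<lambda>h g. F p h g q) t)" if "p \<in> carrier D" for p
    by (intro linear_intro carrier_intro U quadlinearD[OF F] that; (assumption | rule that)?)
  have 2: "bilinear_map H H U (\<lambda>h g. F p h g q)" if "p \<in> carrier D" "q \<in> carrier D" for p q
    by (intro linear_intro carrier_intro U quadlinearD[OF F] that; (assumption | rule that)?)
  show ?thesis
    using assms(3-6)
    by (simp add: Y_lift_eq Y_elt_eq tlift_pure_tensor[OF U Y_lift_bilinear[OF U F]]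
        tlift_pure_tensor[OF U 1] tlift_pure_tensor[OF U 2] pure_tensor_mem vspace_H vspace_D
        vspace_tensor_space)
qed

text \<open>The nested tensor product is peeled off one factor at a time: first an arbitrary element
  of \<open>DD\<close>, then one of \<open>HH\<close>, then the outer tensor.\<close>

lemma X_ext:
  assumes U: "vspace U" and f: "linear_map XX U f" and g: "linear_map XX U k"
    and eq: "\<And>g h p q. g \<in> C \<Longrightarrow> h \<in> C \<Longrightarrow> p \<in> carrier D \<Longrightarrow> q \<in> carrier D \<Longrightarrow>
      f (X_elt H g h p q) = k (X_elt H g h p q)"
    and x: "x \<in> carrier XX"
  shows "f x = k x"
proof -
  note comp = linear_map_compose[OF f] linear_map_compose[OF g]
  have 1: "f (pure_tensor HH DD (pure_tensor H H a b) t) = k (pure_tensor HH DD (pure_tensor H H a b) t)"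
    if "a \<in> C" "b \<in> C" "t \<in> carrier DD" for a b t
    by (rule tensor_ext[OF vspace_D vspace_D U _ _ _ that(3)])
      (use that eq in \<open>auto simp: X_elt_eq intro!: comp linear_intro carrier_intro\<close>)
  have 2: "f (pure_tensor HH DD s t) = k (pure_tensor HH DD s t)"
    if "s \<in> carrier HH" "t \<in> carrier DD" for s t
    by (rule tensor_ext[OF vspace_H vspace_H U _ _ _ that(1)])
      (use that 1 in \<open>auto intro!: comp linear_intro carrier_intro\<close>)
  show ?thesis
    by (rule tensor_ext[OF _ _ U f g 2 x]) (intro carrier_intro; assumption)+
qed

lemma Y_ext:
  assumes U: "vspace U" and f: "linear_map YY U f" and g: "linear_map YY U k"
    and eq: "\<And>g h p q. g \<in> C \<Longrightarrow> h \<in> C \<Longrightarrow> p \<in> carrier D \<Longrightarrow> q \<in> carrier D \<Longrightarrow>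
      f (Y_elt H p h g q) = k (Y_elt H p h g q)"
    and y: "y \<in> carrier YY"
  shows "f y = k y"
proof -
  note comp = linear_map_compose[OF f] linear_map_compose[OF g]
  let ?P = "\<lambda>p t q. pure_tensor D (tensor_space HH D) p (pure_tensor HH D t q)"
  have 1: "f (?P p t q) = k (?P p t q)"
    if "p \<in> carrier D" "q \<in> carrier D" "t \<in> carrier HH" for p q t
    by (rule tensor_ext[OF vspace_H vspace_H U _ _ _ that(3)])
      (use that eq in \<open>auto simp: Y_elt_eq intro!: comp linear_intro carrier_intro\<close>)
  have 2: "f (pure_tensor D (tensor_space HH D) p s) = k (pure_tensor D (tensor_space HH D) p s)"
    if "p \<in> carrier D" "s \<in> carrier (tensor_space HH D)" for p s
    by (rule tensor_ext[OF _ vspace_D U _ _ _ that(2)])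
      (use that 1 in \<open>auto intro!: comp linear_intro carrier_intro\<close>)
  show ?thesis
    by (rule tensor_ext[OF _ _ U f g 2 y]) (intro carrier_intro; assumption)+
qed

end

section \<open>The products of \<open>X\<close> and \<open>Y\<close> on generators\<close>

context fd_hopf begin

lemma X_left_mult:
  shows "bilinear_map HH HH HH (mult (X_left H))"
    and "g \<in> C \<Longrightarrow> h \<in> C \<Longrightarrow> g' \<in> C \<Longrightarrow> h' \<in> C \<Longrightarrow>
      pure_tensor H H g h \<cdot>\<^bsub>X_left H\<^esub> pure_tensor H H g' h' = pure_tensor H H (g' \<cdot> g) (h \<cdot> h')"
proof -
  note op = op_alg_bilinear[OF vspace_H bilinear_mult]
  show "bilinear_map HH HH HH (mult (X_left H))"
    using tensor_alg_bilinear[OF op vspace_H bilinear_mult] unfolding space_norm .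
  show "g \<in> C \<Longrightarrow> h \<in> C \<Longrightarrow> g' \<in> C \<Longrightarrow> h' \<in> C \<Longrightarrow>
      pure_tensor H H g h \<cdot>\<^bsub>X_left H\<^esub> pure_tensor H H g' h' = pure_tensor H H (g' \<cdot> g) (h \<cdot> h')"
    using tensor_alg_mult_pure[OF op vspace_H bilinear_mult, of g h g' h'] unfolding space_norm by simp
qed

lemma X_right_mult:
  shows "bilinear_map DD DD DD (mult (X_right H))"
    and "p \<in> carrier D \<Longrightarrow> q \<in> carrier D \<Longrightarrow> p' \<in> carrier D \<Longrightarrow> q' \<in> carrier D \<Longrightarrow>
      pure_tensor D D p q \<cdot>\<^bsub>X_right H\<^esub> pure_tensor D D p' q' =
      pure_tensor D D (p \<cdot>\<^bsub>D\<^esub> p') (q' \<cdot>\<^bsub>D\<^esub> q)"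
proof -
  note op = op_alg_bilinear[OF vspace_D bilinear_D_mult]
  show "bilinear_map DD DD DD (mult (X_right H))"
    using tensor_alg_bilinear[OF vspace_D bilinear_D_mult op] unfolding space_norm .
  show "p \<in> carrier D \<Longrightarrow> q \<in> carrier D \<Longrightarrow> p' \<in> carrier D \<Longrightarrow> q' \<in> carrier D \<Longrightarrow>
      pure_tensor D D p q \<cdot>\<^bsub>X_right H\<^esub> pure_tensor D D p' q' =
      pure_tensor D D (p \<cdot>\<^bsub>D\<^esub> p') (q' \<cdot>\<^bsub>D\<^esub> q)"
    using tensor_alg_mult_pure[OF vspace_D bilinear_D_mult op, of p q p' q'] unfolding space_norm by simp
qed

text \<open>Both triple sums are already nested to the right, so a single interchange of the inner
  sum over \<open>g\<close> with the outer sum over \<open>h\<close> is enough; coassociativity does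
  not enter.\<close>

lemma sweedler3_SS:
  "sweedler3 H g (\<lambda>g1 g2 g3. sweedler3 H h (\<lambda>h1 h2 h3. F g1 g2 g3 h1 h2 h3)) =
    SS g h (\<lambda>g1 h1 s r. SS s r (\<lambda>g2 h2 g3 h3. F g1 g2 g3 h1 h2 h3))"
  unfolding sweedler3_def by (subst (2) sw_swap) (rule refl)

lemma X_exchange_eq:
  "X_exchange H f a = tlift D D (\<lambda>p q. tlift H H (\<lambda>g h.
    SS g h (\<lambda>g1 h1 s r. SS s r (\<lambda>g2 h2 g3 h3.
      X_elt H g2 h2 (rr (Si h1) p (S g1)) (rr (S h3) q (Si g3))))) a) f"
  unfolding X_exchange_def space_norm sweedler3_SS ..

lemma X_exchange_bilinear: "bilinear_map DD HH XX (X_exchange H)"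
  unfolding X_exchange_eq by (intro linear_intro carrier_intro; assumption)

lemma X_exchange_pure:
  assumes "p \<in> carrier D" "q \<in> carrier D" "g \<in> C" "h \<in> C"
  shows "X_exchange H (pure_tensor D D p q) (pure_tensor H H g h) =
    SS g h (\<lambda>g1 h1 s r. SS s r (\<lambda>g2 h2 g3 h3.
      X_elt H g2 h2 (rr (Si h1) p (S g1)) (rr (S h3) q (Si g3))))"
  unfolding X_exchange_eq
  apply (rule trans[OF tlift_pure_tensor[of XX]])
      apply (intro carrier_intro)
     apply (intro linear_intro carrier_intro assms; assumption)
    apply (rule assms)+
  apply (rule tlift_pure_tensor[of XX])
     apply (intro carrier_intro)
    apply (intro linear_intro carrier_intro assms; assumption)
   apply (rule assms)+
  done

lemma X_alg_simps [simp]: "carrier (X_alg H) = carrier XX" "smult (X_alg H) = smult XX"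
  and Y_alg_simps [simp]: "carrier (Y_alg H) = carrier YY" "smult (Y_alg H) = smult YY"
  unfolding X_alg_def Y_alg_def space_norm by simp_all

lemma X_mult_eq:
  "x \<cdot>\<^bsub>X_alg H\<^esub> y = tlift HH DD (\<lambda>a f. tlift HH DD (\<lambda>a' f'. tlift HH DD (\<lambda>a'' f''.
    pure_tensor HH DD (a \<cdot>\<^bsub>X_left H\<^esub> a'') (f'' \<cdot>\<^bsub>X_right H\<^esub> f')) (X_exchange H f a')) y) x"
  unfolding X_alg_def space_norm by simp

lemma X_mult_lin [linear_intro]:
  "linear_map V HH f \<Longrightarrow> a \<in> carrier HH \<Longrightarrow> linear_map V HH (\<lambda>x. f x \<cdot>\<^bsub>X_left H\<^esub> a)"
  "linear_map V HH f \<Longrightarrow> a \<in> carrier HH \<Longrightarrow> linear_map V HH (\<lambda>x. a \<cdot>\<^bsub>X_left H\<^esub> f x)"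
  "linear_map V DD k \<Longrightarrow> b \<in> carrier DD \<Longrightarrow> linear_map V DD (\<lambda>x. k x \<cdot>\<^bsub>X_right H\<^esub> b)"
  "linear_map V DD k \<Longrightarrow> b \<in> carrier DD \<Longrightarrow> linear_map V DD (\<lambda>x. b \<cdot>\<^bsub>X_right H\<^esub> k x)"
  "linear_map V DD k \<Longrightarrow> a \<in> carrier HH \<Longrightarrow> linear_map V XX (\<lambda>x. X_exchange H (k x) a)"
  "linear_map V HH f \<Longrightarrow> b \<in> carrier DD \<Longrightarrow> linear_map V XX (\<lambda>x. X_exchange H b (f x))"
  by (rule bilinear_left[OF X_left_mult(1)] bilinear_right[OF X_left_mult(1)]
      bilinear_left[OF X_right_mult(1)] bilinear_right[OF X_right_mult(1)]
      bilinear_left[OF X_exchange_bilinear] bilinear_right[OF X_exchange_bilinear]; assumption)+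

lemma X_mult_mem [carrier_intro]:
  "a \<in> carrier HH \<Longrightarrow> a' \<in> carrier HH \<Longrightarrow> a \<cdot>\<^bsub>X_left H\<^esub> a' \<in> carrier HH"
  "b \<in> carrier DD \<Longrightarrow> b' \<in> carrier DD \<Longrightarrow> b \<cdot>\<^bsub>X_right H\<^esub> b' \<in> carrier DD"
  "b \<in> carrier DD \<Longrightarrow> a \<in> carrier HH \<Longrightarrow> X_exchange H b a \<in> carrier XX"
  by (rule bilinear_closed[OF X_left_mult(1)] bilinear_closed[OF X_right_mult(1)]
      bilinear_closed[OF X_exchange_bilinear]; assumption)+

lemma X_mult_bilinear: "bilinear_map XX XX XX (mult (X_alg H))"
  unfolding X_mult_eq by (intro linear_intro carrier_intro; assumption)

lemma X_mult_elt:
  assumes x: "g \<in> C" "h \<in> C" "p \<in> carrier D" "q \<in> carrier D"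
    and y: "g' \<in> C" "h' \<in> C" "p' \<in> carrier D" "q' \<in> carrier D"
  shows "X_elt H g h p q \<cdot>\<^bsub>X_alg H\<^esub> X_elt H g' h' p' q' =
    SS g' h' (\<lambda>g1 h1 s r. SS s r (\<lambda>g2 h2 g3 h3.
      X_elt H (g2 \<cdot> g) (h \<cdot> h2) (rr (Si h1) p (S g1) \<cdot>\<^bsub>D\<^esub> p') (q' \<cdot>\<^bsub>D\<^esub> rr (S h3) q (Si g3))))"
proof -
  let ?a = "pure_tensor H H g h" and ?f = "pure_tensor D D p q"
    and ?a' = "pure_tensor H H g' h'" and ?f' = "pure_tensor D D p' q'"
  have pm: "?a \<in> carrier HH" "?f \<in> carrier DD" "?a' \<in> carrier HH" "?f' \<in> carrier DD"
    by (intro carrier_intro x y)+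
  \<comment> \<open>\<open>?T\<close> multiplies an exchanged element by the outer factors, on the
    left in \<open>HH\<close> and on the right in \<open>DD\<close>. Being linear, it passes through
    the Sweedler sums of the exchange rule.\<close>
  let ?T = "\<lambda>t. tlift HH DD (\<lambda>a'' f''.
    pure_tensor HH DD (?a \<cdot>\<^bsub>X_left H\<^esub> a'') (f'' \<cdot>\<^bsub>X_right H\<^esub> ?f')) t"
  have bil: "bilinear_map HH DD XX (\<lambda>a'' f''.
      pure_tensor HH DD (?a \<cdot>\<^bsub>X_left H\<^esub> a'') (f'' \<cdot>\<^bsub>X_right H\<^esub> ?f'))"
    by (intro linear_intro carrier_intro pm)
  have T: "linear_map XX XX ?T"
    by (rule linear_map_tlift) (intro carrier_intro bil)+
  have T_elt: "?T (X_elt H g2 h2 p2 q2) = X_elt H (g2 \<cdot> g) (h \<cdot> h2) (p2 \<cdot>\<^bsub>D\<^esub> p') (q' \<cdot>\<^bsub>D\<^esub> q2)"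
    if z: "g2 \<in> C" "h2 \<in> C" "p2 \<in> carrier D" "q2 \<in> carrier D" for g2 h2 p2 q2
    unfolding X_elt_eq
    apply (subst tlift_pure_tensor[OF _ bil])
       apply (intro carrier_intro x y z)+
    apply (simp add: X_left_mult(2) X_right_mult(2) x y z)
    done
  have "X_elt H g h p q \<cdot>\<^bsub>X_alg H\<^esub> X_elt H g' h' p' q' = ?T (X_exchange H ?f ?a')"
    unfolding X_mult_eq
    unfolding X_elt_eq
    apply (rule trans[OF tlift_pure_tensor[of XX]])
        apply (intro carrier_intro)
       apply (intro linear_intro carrier_intro pm; assumption)
      apply (rule pm)+
    apply (rule tlift_pure_tensor[of XX])
       apply (intro carrier_intro)
      apply (intro linear_intro carrier_intro pm; assumption)
     apply (rule pm)+
    done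
  also have "\<dots> = SS g' h' (\<lambda>g1 h1 s r. ?T (SS s r (\<lambda>g2 h2 g3 h3.
      X_elt H g2 h2 (rr (Si h1) p (S g1)) (rr (S h3) q (Si g3)))))"
    unfolding X_exchange_pure[OF x(3,4) y(1,2)]
    by (rule SS_linear[OF _ T y(1,2)]) (intro carrier_intro x; assumption)+
  also have "\<dots> = SS g' h' (\<lambda>g1 h1 s r. SS s r (\<lambda>g2 h2 g3 h3.
      ?T (X_elt H g2 h2 (rr (Si h1) p (S g1)) (rr (S h3) q (Si g3)))))"
    by (rule SS_cong[OF y(1,2)], rule SS_linear[OF _ T]) (intro carrier_intro x; assumption | assumption)+
  also have "\<dots> = SS g' h' (\<lambda>g1 h1 s r. SS s r (\<lambda>g2 h2 g3 h3.
      X_elt H (g2 \<cdot> g) (h \<cdot> h2) (rr (Si h1) p (S g1) \<cdot>\<^bsub>D\<^esub> p') (q' \<cdot>\<^bsub>D\<^esub> rr (S h3) q (Si g3))))"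
    by (rule SS_cong[OF y(1,2)], rule SS_cong, assumption, assumption, rule T_elt)
      (simp_all add: x)
  finally show ?thesis .
qed

text \<open>The product of two generators of \<open>Y\<close> with the sums over \<open>g\<close>
  and \<open>g'\<close> moved outside those over \<open>h\<close> and \<open>h'\<close>, to match
  the paired form \<open>SS\<close>.\<close>

definition Y_prod where
  "Y_prod p h g q p' h' g' q' =
    SS g h (\<lambda>g1 h1 g2 h2. SS g' h' (\<lambda>g1' h1' g2' h2'.
      Y_elt H (p \<cdot>\<^bsub>D\<^esub> rr h1 p' g1) (h2 \<cdot> h1') (g1' \<cdot> g2) (q' \<cdot>\<^bsub>D\<^esub> rr (S h2') q (Si g2'))))"

lemma Y_mult_eq: "y \<cdot>\<^bsub>Y_alg H\<^esub> y' =
  Y_lift H (\<lambda>p h g q. Y_lift H (\<lambda>p' h' g' q'. Y_prod p h g q p' h' g' q') y') y"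
proof -
  have "sw h (\<lambda>h1 h2. sw g (\<lambda>g1 g2. sw h' (\<lambda>h1' h2'. sw g' (\<lambda>g1' g2'.
      Y_elt H (p \<cdot>\<^bsub>D\<^esub> rr h1 p' g1) (h2 \<cdot> h1') (g1' \<cdot> g2) (q' \<cdot>\<^bsub>D\<^esub> rr (S h2') q (Si g2')))))) =
      Y_prod p h g q p' h' g' q'" for p h g q p' h' g' q'
    unfolding Y_prod_def by (subst sw_swap, subst (3) sw_swap, rule refl)
  then show ?thesis by (simp add: Y_alg_def)
qed

lemma Y_prod_quadlinear:
  "p' \<in> carrier D \<Longrightarrow> q' \<in> carrier D \<Longrightarrow> g' \<in> C \<Longrightarrow> h' \<in> C \<Longrightarrow>
    quadlinear YY (\<lambda>g h p q. Y_prod p h g q p' h' g' q')"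
  "p \<in> carrier D \<Longrightarrow> q \<in> carrier D \<Longrightarrow> g \<in> C \<Longrightarrow> h \<in> C \<Longrightarrow>
    quadlinear YY (\<lambda>g' h' p' q'. Y_prod p h g q p' h' g' q')"
  unfolding Y_prod_def by (intro linear_intro carrier_intro; assumption)+

lemma linear_map_Y_lift_fun:
  assumes U: "vspace U" and y: "y \<in> carrier YY"
    and F: "\<And>p h g q. p \<in> carrier D \<Longrightarrow> h \<in> C \<Longrightarrow> g \<in> C \<Longrightarrow> q \<in> carrier D \<Longrightarrow>
      linear_map V U (\<lambda>x. F x p h g q)"
  shows "linear_map V U (\<lambda>x. Y_lift H (F x) y)"
  unfolding Y_lift_eq by (intro linear_map_tlift_fun U y F)

lemma Y_prod_lift_quadlinear:
  assumes "y' \<in> carrier YY"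
  shows "quadlinear YY (\<lambda>g h p q. Y_lift H (\<lambda>p' h' g' q'. Y_prod p h g q p' h' g' q') y')"
  by (intro quadlinearI linear_map_Y_lift_fun carrier_intro assms quadlinearD[OF Y_prod_quadlinear(1)])

lemma Y_mult_bilinear: "bilinear_map YY YY YY (mult (Y_alg H))"
  unfolding Y_mult_eq
proof (rule bilinear_mapI)
  fix y assume y: "y \<in> carrier YY"
  show "linear_map YY YY (\<lambda>y'. Y_lift H (\<lambda>p h g q. Y_lift H (\<lambda>p' h' g' q'.
      Y_prod p h g q p' h' g' q') y') y)"
    by (intro linear_map_Y_lift_fun linear_map_Y_lift carrier_intro y Y_prod_quadlinear)
  show "linear_map YY YY (\<lambda>x. Y_lift H (\<lambda>p h g q. Y_lift H (\<lambda>p' h' g' q'.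
      Y_prod p h g q p' h' g' q') y) x)"
    by (intro linear_map_Y_lift carrier_intro Y_prod_lift_quadlinear y)
qed

lemma Y_mult_elt:
  assumes "g \<in> C" "h \<in> C" "p \<in> carrier D" "q \<in> carrier D"
    and "g' \<in> C" "h' \<in> C" "p' \<in> carrier D" "q' \<in> carrier D"
  shows "Y_elt H p h g q \<cdot>\<^bsub>Y_alg H\<^esub> Y_elt H p' h' g' q' = Y_prod p h g q p' h' g' q'"
  unfolding Y_mult_eq using assms
  by (simp add: Y_lift_elt[OF _ Y_prod_lift_quadlinear] Y_lift_elt[OF _ Y_prod_quadlinear(2)] carrier_intro)

section \<open>\<open>phi\<close> and \<open>phi_inv\<close> are mutually inverse\<close>

lemma phi_eq: "phi H = X_lift H (\<lambda>g h p q. SS g h (\<lambda>g1 h1 g2 h2. Y_elt H (rr h1 p g1) h2 g2 q))"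
  by (simp add: phi_def)

lemma phi_inv_eq: "phi_inv H =
  Y_lift H (\<lambda>p h g q. SS g h (\<lambda>g1 h1 g2 h2. X_elt H g2 h2 (rr (Si h1) p (S g1)) q))"
  by (simp add: phi_inv_def)

lemma phi_quadlinear:
  "quadlinear YY (\<lambda>g h p q. SS g h (\<lambda>g1 h1 g2 h2. Y_elt H (rr h1 p g1) h2 g2 q))"
  by (intro linear_intro carrier_intro; assumption)

lemma phi_inv_quadlinear:
  "quadlinear XX (\<lambda>g h p q. SS g h (\<lambda>g1 h1 g2 h2. X_elt H g2 h2 (rr (Si h1) p (S g1)) q))"
  by (intro linear_intro carrier_intro; assumption)

lemma vspace_XX: "vspace XX" and vspace_YY: "vspace YY"
  by (intro carrier_intro)+

lemma linear_phi: "linear_map XX YY (phi H)"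
  unfolding phi_eq by (rule linear_map_X_lift[OF vspace_YY phi_quadlinear])

lemma linear_phi_inv: "linear_map YY XX (phi_inv H)"
  unfolding phi_inv_eq by (rule linear_map_Y_lift[OF vspace_XX phi_inv_quadlinear])

lemma phi_elt:
  "g \<in> C \<Longrightarrow> h \<in> C \<Longrightarrow> p \<in> carrier D \<Longrightarrow> q \<in> carrier D \<Longrightarrow>
    phi H (X_elt H g h p q) = SS g h (\<lambda>g1 h1 g2 h2. Y_elt H (rr h1 p g1) h2 g2 q)"
  unfolding phi_eq by (rule X_lift_elt[OF vspace_YY phi_quadlinear])

lemma phi_inv_elt:
  "g \<in> C \<Longrightarrow> h \<in> C \<Longrightarrow> p \<in> carrier D \<Longrightarrow> q \<in> carrier D \<Longrightarrow>
    phi_inv H (Y_elt H p h g q) = SS g h (\<lambda>g1 h1 g2 h2. X_elt H g2 h2 (rr (Si h1) p (S g1)) q)"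
  unfolding phi_inv_eq by (rule Y_lift_elt[OF vspace_XX phi_inv_quadlinear])

text \<open>By \<open>rr_rr\<close> an outer action multiplies from the left on the \<open>h\<close>
  side and from the right on the \<open>g\<close> side. The composite thus contains
  \<open>Si h2 \<cdot> h1\<close> and \<open>g1 \<cdot> S g2\<close>, which explains why
  \<open>phi_inv\<close> has the inverse antipode on one side and the antipode on the other.\<close>

lemma phi_inv_phi:
  assumes x: "x \<in> carrier XX"
  shows "phi_inv H (phi H x) = x"
proof (rule X_ext[OF vspace_XX _ linear_map_ident _ x])
  show "linear_map XX XX (\<lambda>x. phi_inv H (phi H x))"
    by (rule linear_map_compose[OF linear_phi_inv linear_phi])
  fix g h p q assume a: "g \<in> C" "h \<in> C" "p \<in> carrier D" "q \<in> carrier D"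
  have "phi_inv H (phi H (X_elt H g h p q)) =
      SS g h (\<lambda>g1 h1 s r. phi_inv H (Y_elt H (rr h1 p g1) r s q))"
    unfolding phi_elt[OF a]
    by (rule SS_linear[OF vspace_YY linear_phi_inv a(1,2)]) (simp add: a)
  also have "\<dots> = SS g h (\<lambda>g1 h1 s r. SS s r (\<lambda>g2 h2 g3 h3.
      X_elt H g3 h3 (rr (Si h2 \<cdot> h1) p (g1 \<cdot> S g2)) q))"
    apply (rule SS_cong[OF a(1,2)])
    apply (subst phi_inv_elt)
    apply (simp_all add: a)
    apply (rule SS_cong)
    apply (simp_all add: a rr_rr)
    done
  also have "\<dots> = X_elt H g h (rr one p one) q"
    by (rule SS_collapse[OF counital_antipode(2) counital_antipode_inv(1) vspace_XX a(1,2),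
          of "\<lambda>x y g3 h3. X_elt H g3 h3 (rr y p x) q"])
      (intro linear_intro carrier_intro a; assumption)+
  finally show "phi_inv H (phi H (X_elt H g h p q)) = X_elt H g h p q" by (simp add: a)
qed

text \<open>In this order the adjacent factors are \<open>h2 \<cdot> Si h1\<close> and
  \<open>S g1 \<cdot> g2\<close>, so the other two cancellation rules apply.\<close>

lemma phi_phi_inv:
  assumes y: "y \<in> carrier YY"
  shows "phi H (phi_inv H y) = y"
proof (rule Y_ext[OF vspace_YY _ linear_map_ident _ y])
  show "linear_map YY YY (\<lambda>y. phi H (phi_inv H y))"
    by (rule linear_map_compose[OF linear_phi linear_phi_inv])
  fix g h p q assume a: "g \<in> C" "h \<in> C" "p \<in> carrier D" "q \<in> carrier D"
  have "phi H (phi_inv H (Y_elt H p h g q)) =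
      SS g h (\<lambda>g1 h1 s r. phi H (X_elt H s r (rr (Si h1) p (S g1)) q))"
    unfolding phi_inv_elt[OF a]
    by (rule SS_linear[OF vspace_XX linear_phi a(1,2)]) (simp add: a)
  also have "\<dots> = SS g h (\<lambda>g1 h1 s r. SS s r (\<lambda>g2 h2 g3 h3.
      Y_elt H (rr (h2 \<cdot> Si h1) p (S g1 \<cdot> g2)) h3 g3 q))"
    apply (rule SS_cong[OF a(1,2)])
    apply (subst phi_elt)
    apply (simp_all add: a)
    apply (rule SS_cong)
    apply (simp_all add: a rr_rr)
    done
  also have "\<dots> = Y_elt H (rr one p one) h g q"
    by (rule SS_collapse[OF counital_antipode(1) counital_antipode_inv(2) vspace_YY a(1,2),
          of "\<lambda>x y g3 h3. Y_elt H (rr y p x) h3 g3 q"])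
      (intro linear_intro carrier_intro a; assumption)+
  finally show "phi H (phi_inv H (Y_elt H p h g q)) = Y_elt H p h g q" by (simp add: a)
qed

lemma phi_unity: "phi H (unity (X_alg H)) = unity (Y_alg H)"
proof -
  have "phi H (unity (X_alg H)) =
      sw one (\<lambda>g1 g2. sw one (\<lambda>h1 h2. Y_elt H (rr h1 (unity D) g1) h2 g2 (unity D)))"
    by (simp add: X_alg_def phi_elt)
  also have "\<dots> = sw one (\<lambda>g1 g2. Y_elt H (rr one (unity D) g1) one g2 (unity D))"
    by (rule sw_cong[OF unity_mem], rule sw_unity[OF vspace_YY]) (intro linear_intro carrier_intro; assumption)
  also have "\<dots> = Y_elt H (rr one (unity D) one) one one (unity D)"
    by (rule sw_unity[OF vspace_YY]) (intro linear_intro carrier_intro; assumption)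
  finally show ?thesis by (simp add: Y_alg_def)
qed

end

section \<open>Multiplicativity of \<open>phi\<close>\<close>

context hopf begin

text \<open>The dual is a module algebra under both regular actions: at \<open>x\<close> the left
  side evaluates the convolution on the comultiplication of \<open>g \<cdot> x \<cdot> h\<close>,
  which splits by \<open>sw_mult\<close>.\<close>

lemma rr_mult:
  assumes g: "g \<in> C" and h: "h \<in> C" and p: "p \<in> carrier D" "p' \<in> carrier D"
  shows "rr h (p \<cdot>\<^bsub>D\<^esub> p') g = SS g h (\<lambda>g1 h1 g2 h2. rr h1 p g1 \<cdot>\<^bsub>D\<^esub> rr h2 p' g2)"
proof (rule D_ext)
  show "rr h (p \<cdot>\<^bsub>D\<^esub> p') g \<in> carrier D" by (intro carrier_intro g h p)
  show "SS g h (\<lambda>g1 h1 g2 h2. rr h1 p g1 \<cdot>\<^bsub>D\<^esub> rr h2 p' g2) \<in> carrier D"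
    by (intro carrier_intro g h p; assumption)
  fix x assume x: "x \<in> C"
  have "rr h (p \<cdot>\<^bsub>D\<^esub> p') g x = sw (g \<cdot> x \<cdot> h) (\<lambda>a b. p a * p' b)"
    using g h x by (simp add: rr_apply D_mult_apply)
  also have "\<dots> = sw (g \<cdot> x) (\<lambda>a b. sw h (\<lambda>h1 h2. p (a \<cdot> h1) * p' (b \<cdot> h2)))"
    by (rule sw_mult[OF mult_mem[OF g x] h vspace_base_field])
      (intro linear_intro linear_map_D p carrier_intro; assumption)
  also have "\<dots> = SS g x (\<lambda>g1 x1 g2 x2. sw h (\<lambda>h1 h2. p (g1 \<cdot> x1 \<cdot> h1) * p' (g2 \<cdot> x2 \<cdot> h2)))"
    by (rule sw_mult[OF g x vspace_base_field]) (intro linear_intro linear_map_D p carrier_intro h; assumption)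
  \<comment> \<open>The sum over \<open>x\<close> moves innermost, where it is the convolution
    product of the two translated forms.\<close>
  also have "\<dots> = SS g h (\<lambda>g1 h1 g2 h2. sw x (\<lambda>x1 x2. p (g1 \<cdot> x1 \<cdot> h1) * p' (g2 \<cdot> x2 \<cdot> h2)))"
    by (subst (2) sw_swap) (rule refl)
  also have "\<dots> = SS g h (\<lambda>g1 h1 g2 h2. (rr h1 p g1 \<cdot>\<^bsub>D\<^esub> rr h2 p' g2) x)"
    apply (rule SS_cong[OF g h])
    apply (simp add: D_mult_apply x)
    apply (rule sw_cong[OF x])
    apply (simp add: rr_apply)
    done
  also have "\<dots> = SS g h (\<lambda>g1 h1 g2 h2. rr h1 p g1 \<cdot>\<^bsub>D\<^esub> rr h2 p' g2) x"
    by (simp add: sw_apply)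
  finally show "rr h (p \<cdot>\<^bsub>D\<^esub> p') g x =
    SS g h (\<lambda>g1 h1 g2 h2. rr h1 p g1 \<cdot>\<^bsub>D\<^esub> rr h2 p' g2) x" .
qed

end

context fd_hopf begin

text \<open>Splitting by \<open>rr_mult\<close> composes the action of \<open>h2\<close>,
  \<open>g2\<close> on the first factor with the twist by \<open>Si h1\<close>, \<open>S g1\<close>,
  which it cancels; only \<open>p'\<close> is still acted on. This is how \<open>phi\<close> undoes
  the twist in the product of \<open>X\<close>.\<close>

lemma rr_mult_twisted:
  assumes g: "g \<in> C" and h: "h \<in> C" and p: "p \<in> carrier D" "p' \<in> carrier D"
  shows "SS g h (\<lambda>g1 h1 g2 h2. rr h2 (rr (Si h1) p (S g1) \<cdot>\<^bsub>D\<^esub> p') g2) = p \<cdot>\<^bsub>D\<^esub> rr h p' g"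
proof -
  have "SS g h (\<lambda>g1 h1 g2 h2. rr h2 (rr (Si h1) p (S g1) \<cdot>\<^bsub>D\<^esub> p') g2) =
      SS g h (\<lambda>g1 h1 s r. SS s r (\<lambda>g2 h2 g3 h3.
        rr (h2 \<cdot> Si h1) p (S g1 \<cdot> g2) \<cdot>\<^bsub>D\<^esub> rr h3 p' g3))"
    apply (rule SS_cong[OF g h])
    apply (subst rr_mult)
        apply (simp_all add: p)
    apply (rule SS_cong)
      apply (simp_all add: p rr_rr)
    done
  also have "\<dots> = rr one p one \<cdot>\<^bsub>D\<^esub> rr h p' g"
    by (rule SS_collapse[OF counital_antipode(1) counital_antipode_inv(2) vspace_D g h,
          of "\<lambda>x y g3 h3. rr y p x \<cdot>\<^bsub>D\<^esub> rr h3 p' g3"])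
      (intro linear_intro carrier_intro p; assumption)+
  finally show ?thesis by (simp add: p)
qed

lemma phi_mult_elt:
  assumes x: "g \<in> C" "h \<in> C" "p \<in> carrier D" "q \<in> carrier D"
    and y: "g' \<in> C" "h' \<in> C" "p' \<in> carrier D" "q' \<in> carrier D"
  shows "phi H (X_elt H g h p q \<cdot>\<^bsub>X_alg H\<^esub> X_elt H g' h' p' q') =
    phi H (X_elt H g h p q) \<cdot>\<^bsub>Y_alg H\<^esub> phi H (X_elt H g' h' p' q')"
proof -
  let ?Q = "\<lambda>h3 g3. q' \<cdot>\<^bsub>D\<^esub> rr (S h3) q (Si g3)"
  let ?P = "\<lambda>h1 g1. rr (Si h1) p (S g1) \<cdot>\<^bsub>D\<^esub> p'"
  \<comment> \<open>Comultiplying the products \<open>g2 \<cdot> g\<close> and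
    \<open>h \<cdot> h2\<close> gives an action by products, which \<open>rr_rr\<close> splits into
    two: the parts of \<open>g2\<close> and \<open>h2\<close> act first, so that they can meet the
    twist, and those of \<open>g\<close> and \<open>h\<close> act afterwards.\<close>
  have phi_prod: "phi H (X_elt H (g2 \<cdot> g) (h \<cdot> h2) P Q) =
      SS g2 h2 (\<lambda>a i c j. SS g h (\<lambda>b e d f.
        Y_elt H (rr e (rr i P a) b) (f \<cdot> j) (c \<cdot> d) Q))"
    if z: "g2 \<in> C" "h2 \<in> C" "P \<in> carrier D" "Q \<in> carrier D" for g2 h2 P Q
  proof -
    have "phi H (X_elt H (g2 \<cdot> g) (h \<cdot> h2) P Q) =
        SS (g2 \<cdot> g) (h \<cdot> h2) (\<lambda>g1 h1 g2 h2. Y_elt H (rr h1 P g1) h2 g2 Q)"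
      by (rule phi_elt) (use x z in auto)
    also have "\<dots> = sw g2 (\<lambda>a c. sw g (\<lambda>b d. sw (h \<cdot> h2) (\<lambda>k l.
        Y_elt H (rr k P (a \<cdot> b)) l (c \<cdot> d) Q)))"
      by (rule sw_mult[OF z(1) x(1) vspace_YY])
        (intro linear_intro carrier_intro x z; assumption)
    also have "\<dots> = sw g2 (\<lambda>a c. sw g (\<lambda>b d. sw h (\<lambda>e f. sw h2 (\<lambda>i j.
        Y_elt H (rr (e \<cdot> i) P (a \<cdot> b)) (f \<cdot> j) (c \<cdot> d) Q))))"
      by (rule sw_cong[OF z(1)], rule sw_cong[OF x(1)], rule sw_mult[OF x(2) z(2) vspace_YY])
        (intro linear_intro carrier_intro z; assumption)
    also have "\<dots> = sw g2 (\<lambda>a c. sw g (\<lambda>b d. sw h (\<lambda>e f. sw h2 (\<lambda>i j.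
        Y_elt H (rr e (rr i P a) b) (f \<cdot> j) (c \<cdot> d) Q))))"
      by (rule sw_cong[OF z(1)], rule sw_cong[OF x(1)], rule sw_cong[OF x(2)],
          rule sw_cong[OF z(2)]) (simp add: rr_rr z)
    also have "\<dots> = sw g2 (\<lambda>a c. sw g (\<lambda>b d. sw h2 (\<lambda>i j. sw h (\<lambda>e f.
        Y_elt H (rr e (rr i P a) b) (f \<cdot> j) (c \<cdot> d) Q))))"
      by (subst (3) sw_swap) (rule refl)
    also have "\<dots> = SS g2 h2 (\<lambda>a i c j. SS g h (\<lambda>b e d f.
        Y_elt H (rr e (rr i P a) b) (f \<cdot> j) (c \<cdot> d) Q))"
      by (subst (2) sw_swap) (rule refl)
    finally show ?thesis .
  qed
  have "phi H (X_elt H g h p q \<cdot>\<^bsub>X_alg H\<^esub> X_elt H g' h' p' q') =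
      SS g' h' (\<lambda>g1 h1 s r. phi H (SS s r (\<lambda>g2 h2 g3 h3.
        X_elt H (g2 \<cdot> g) (h \<cdot> h2) (?P h1 g1) (?Q h3 g3))))"
    unfolding X_mult_elt[OF x y]
    by (rule SS_linear[OF vspace_XX linear_phi y(1,2)]) (intro carrier_intro x y; assumption)
  also have "\<dots> = SS g' h' (\<lambda>g1 h1 s r. SS s r (\<lambda>g2 h2 g3 h3.
      phi H (X_elt H (g2 \<cdot> g) (h \<cdot> h2) (?P h1 g1) (?Q h3 g3))))"
    by (rule SS_cong[OF y(1,2)], rule SS_linear[OF vspace_XX linear_phi])
      (assumption | intro carrier_intro x y; assumption)+
  also have "\<dots> = SS g' h' (\<lambda>g1 h1 s r. SS s r (\<lambda>g2 h2 g3 h3. SS g2 h2 (\<lambda>a i c j.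
      SS g h (\<lambda>b e d f.
        Y_elt H (rr e (rr i (?P h1 g1) a) b) (f \<cdot> j) (c \<cdot> d) (?Q h3 g3)))))"
    by (rule SS_cong[OF y(1,2)], rule SS_cong, assumption, assumption, rule phi_prod)
      (assumption | intro carrier_intro x y; assumption)+
  \<comment> \<open>Two regroupings of the four legs of \<open>g'\<close> and \<open>h'\<close>:
    this one detaches \<open>a\<close>, \<open>i\<close> from \<open>c\<close>, \<open>j\<close>,
    and the next one joins them to \<open>g1\<close>, \<open>h1\<close>, the pattern of
    \<open>rr_mult_twisted\<close>.\<close>
  also have "\<dots> = SS g' h' (\<lambda>g1 h1 s r. SS s r (\<lambda>a i v w. SS v w (\<lambda>c j g3 h3.
      SS g h (\<lambda>b e d f.
        Y_elt H (rr e (rr i (?P h1 g1) a) b) (f \<cdot> j) (c \<cdot> d) (?Q h3 g3)))))"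
    by (rule SS_cong[OF y(1,2)], rule SS_coassoc[OF _ _ vspace_YY])
      (assumption | intro linear_intro carrier_intro x y; assumption)+
  also have "\<dots> = SS g' h' (\<lambda>s r v w. SS s r (\<lambda>g1 h1 a i. SS v w (\<lambda>c j g3 h3.
      SS g h (\<lambda>b e d f.
        Y_elt H (rr e (rr i (?P h1 g1) a) b) (f \<cdot> j) (c \<cdot> d) (?Q h3 g3)))))"
    by (rule SS_coassoc[OF y(1,2) vspace_YY, symmetric]) (intro linear_intro carrier_intro x y; assumption)+
  also have "\<dots> = SS g' h' (\<lambda>s r v w. SS v w (\<lambda>c j g3 h3. SS g h (\<lambda>b e d f.
        Y_elt H (rr e (p \<cdot>\<^bsub>D\<^esub> rr r p' s) b) (f \<cdot> j) (c \<cdot> d) (?Q h3 g3))))"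
  proof (rule SS_cong[OF y(1,2)])
    fix s r v w assume z: "s \<in> C" "r \<in> C" "v \<in> C" "w \<in> C"
    \<comment> \<open>The remaining sums are linear in the first dual slot, so the sum over
      \<open>g1 h1 a i\<close> can be evaluated inside that slot.\<close>
    let ?L = "\<lambda>Z. SS v w (\<lambda>c j g3 h3. SS g h (\<lambda>b e d f.
        Y_elt H (rr e Z b) (f \<cdot> j) (c \<cdot> d) (?Q h3 g3)))"
    have "linear_map D YY ?L" by (intro linear_intro carrier_intro x y z; assumption)
    from SS_linear[OF vspace_D this z(1,2), of "\<lambda>g1 h1 a i. rr i (?P h1 g1) a"]
    show "SS s r (\<lambda>g1 h1 a i. ?L (rr i (?P h1 g1) a)) = ?L (p \<cdot>\<^bsub>D\<^esub> rr r p' s)"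
      using x y z by (simp add: rr_mult_twisted)
  qed
  \<comment> \<open>The outer action of \<open>e\<close>, \<open>b\<close> is split by
    \<open>rr_mult\<close>; coassociativity then hands its second half to the legs \<open>d\<close>,
    \<open>f\<close>, whose leading parts act on the second factor in the product of
    \<open>Y\<close>.\<close>
  also have "\<dots> = SS g' h' (\<lambda>s r v w. SS v w (\<lambda>c j g3 h3. SS g h (\<lambda>b e d f. SS d f (\<lambda>k l d f.
        Y_elt H (rr e p b \<cdot>\<^bsub>D\<^esub> rr l (rr r p' s) k) (f \<cdot> j) (c \<cdot> d) (?Q h3 g3)))))"
  proof (rule SS_cong[OF y(1,2)], rule SS_cong)
    fix s r v w c j g3 h3
    assume z: "s \<in> C" "r \<in> C" "c \<in> C" "j \<in> C" "g3 \<in> C" "h3 \<in> C"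
    have "SS g h (\<lambda>b e d f. Y_elt H (rr e (p \<cdot>\<^bsub>D\<^esub> rr r p' s) b) (f \<cdot> j) (c \<cdot> d) (?Q h3 g3)) =
        SS g h (\<lambda>b e d f. SS b e (\<lambda>b1 e1 b2 e2.
          Y_elt H (rr e1 p b1 \<cdot>\<^bsub>D\<^esub> rr e2 (rr r p' s) b2) (f \<cdot> j) (c \<cdot> d) (?Q h3 g3)))"
    proof (rule SS_cong[OF x(1,2)])
      fix b e d f assume t: "b \<in> C" "e \<in> C" "d \<in> C" "f \<in> C"
      have "linear_map D YY (\<lambda>Z. Y_elt H Z (f \<cdot> j) (c \<cdot> d) (?Q h3 g3))"
        by (intro linear_intro carrier_intro x y z t)
      from SS_linear[OF vspace_D this t(1,2), of "\<lambda>b1 e1 b2 e2. rr e1 p b1 \<cdot>\<^bsub>D\<^esub> rr e2 (rr r p' s) b2"]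
      show "Y_elt H (rr e (p \<cdot>\<^bsub>D\<^esub> rr r p' s) b) (f \<cdot> j) (c \<cdot> d) (?Q h3 g3) =
          SS b e (\<lambda>b1 e1 b2 e2.
          Y_elt H (rr e1 p b1 \<cdot>\<^bsub>D\<^esub> rr e2 (rr r p' s) b2) (f \<cdot> j) (c \<cdot> d) (?Q h3 g3))"
        using x y z t by (simp add: rr_mult)
    qed
    also have "\<dots> = SS g h (\<lambda>b e d f. SS d f (\<lambda>k l d f.
        Y_elt H (rr e p b \<cdot>\<^bsub>D\<^esub> rr l (rr r p' s) k) (f \<cdot> j) (c \<cdot> d) (?Q h3 g3)))"
      by (rule SS_coassoc[OF x(1,2) vspace_YY]) (intro linear_intro carrier_intro x y z; assumption)+
    finally show "SS g h (\<lambda>b e d f. Y_elt H (rr e (p \<cdot>\<^bsub>D\<^esub> rr r p' s) b) (f \<cdot> j) (c \<cdot> d) (?Q h3 g3)) =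
        SS g h (\<lambda>b e d f. SS d f (\<lambda>k l d f.
        Y_elt H (rr e p b \<cdot>\<^bsub>D\<^esub> rr l (rr r p' s) k) (f \<cdot> j) (c \<cdot> d) (?Q h3 g3)))" .
  qed
  \<comment> \<open>From here on only independent sums are interchanged, until \<open>Y_prod\<close>
    and then the two images under \<open>phi\<close> become visible.\<close>
  also have "\<dots> = SS g' h' (\<lambda>s r v w. SS g h (\<lambda>b e d f. Y_prod (rr e p b) f d q (rr r p' s) w v q'))"
    unfolding Y_prod_def
    apply (rule SS_cong[OF y(1,2)])
    apply (subst SS_swap)
    apply (rule SS_cong[OF x(1,2)])
    apply (rule SS_swap)
    done
  also have "\<dots> = SS g h (\<lambda>b e d f. SS g' h' (\<lambda>s r v w. Y_prod (rr e p b) f d q (rr r p' s) w v q'))"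
    by (rule SS_swap)
  also have "\<dots> = SS g h (\<lambda>b e d f. SS g' h' (\<lambda>s r v w.
      Y_elt H (rr e p b) f d q \<cdot>\<^bsub>Y_alg H\<^esub> Y_elt H (rr r p' s) w v q'))"
    by (rule SS_cong[OF x(1,2)], rule SS_cong[OF y(1,2)]) (simp add: Y_mult_elt x y)
  also have "\<dots> = SS g h (\<lambda>b e d f. Y_elt H (rr e p b) f d q \<cdot>\<^bsub>Y_alg H\<^esub> phi H (X_elt H g' h' p' q'))"
    unfolding phi_elt[OF y]
    by (rule SS_cong[OF x(1,2)], rule SS_linear[OF vspace_YY _ y(1,2), symmetric],
        rule bilinear_right[OF Y_mult_bilinear linear_map_ident])
      (intro carrier_intro x y; assumption)+
  also have "\<dots> = phi H (X_elt H g h p q) \<cdot>\<^bsub>Y_alg H\<^esub> phi H (X_elt H g' h' p' q')"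
    unfolding phi_elt[OF x]
    by (rule SS_linear[OF vspace_YY _ x(1,2), symmetric],
        rule bilinear_left[OF Y_mult_bilinear linear_map_ident])
      (use linear_map_closed[OF linear_phi] in \<open>simp_all add: x y\<close>)
  finally show ?thesis .
qed

text \<open>Both sides are bilinear in \<open>x\<close> and \<open>y\<close>, so
  \<open>X_ext\<close> applied in each variable reduces the claim to
  \<open>phi_mult_elt\<close>.\<close>

lemma phi_mult:
  assumes x: "x \<in> carrier XX" and y: "y \<in> carrier XX"
  shows "phi H (x \<cdot>\<^bsub>X_alg H\<^esub> y) = phi H x \<cdot>\<^bsub>Y_alg H\<^esub> phi H y"
proof -
  note phi_mem = linear_map_closed[OF linear_phi]
  have left: "linear_map XX YY (\<lambda>x. phi H (x \<cdot>\<^bsub>X_alg H\<^esub> y))"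
    "linear_map XX YY (\<lambda>x. phi H x \<cdot>\<^bsub>Y_alg H\<^esub> phi H y)" if "y \<in> carrier XX" for y
    by (rule linear_map_compose[OF linear_phi bilinear_left[OF X_mult_bilinear linear_map_ident that]],
      rule bilinear_left[OF Y_mult_bilinear linear_phi phi_mem[OF that]])
  have right: "linear_map XX YY (\<lambda>y. phi H (x \<cdot>\<^bsub>X_alg H\<^esub> y))"
    "linear_map XX YY (\<lambda>y. phi H x \<cdot>\<^bsub>Y_alg H\<^esub> phi H y)"
    by (rule linear_map_compose[OF linear_phi bilinear_right[OF X_mult_bilinear linear_map_ident x]],
      rule bilinear_right[OF Y_mult_bilinear linear_phi phi_mem[OF x]])
  have elt: "phi H (x \<cdot>\<^bsub>X_alg H\<^esub> X_elt H g' h' p' q') = phi H x \<cdot>\<^bsub>Y_alg H\<^esub> phi H (X_elt H g' h' p' q')"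
    if "g' \<in> C" "h' \<in> C" "p' \<in> carrier D" "q' \<in> carrier D" for g' h' p' q'
    by (rule X_ext[OF vspace_YY left _ x]) (simp_all add: phi_mult_elt that)
  show ?thesis
    by (rule X_ext[OF vspace_YY right _ y]) (rule elt)
qed

lemma phi_iso: "algebra_iso (X_alg H) (Y_alg H) (phi H)"
proof -
  have "bij_betw (phi H) (carrier XX) (carrier YY)"
    by (rule bij_betw_byWitness[of _ "phi_inv H"])
      (auto simp: phi_inv_phi phi_phi_inv linear_map_closed[OF linear_phi]
        linear_map_closed[OF linear_phi_inv])
  moreover have "linear_map (X_alg H) (Y_alg H) (phi H)"
    using linear_phi by (simp add: linear_map_def)
  ultimately show ?thesis
    by (simp add: algebra_iso_def phi_mult phi_unity)
qed

end

section \<open>Compatibility of \<open>phi\<close> with the actions on Hopf bimodules\<close>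

context hopf begin

lemma linear_map_eval_smult:
  assumes U: "vspace U"
  shows "linear_map V H f \<Longrightarrow> a \<in> carrier D \<Longrightarrow> u \<in> carrier U \<Longrightarrow>
      linear_map V U (\<lambda>x. smult U (a (f x) * c) u)"
    and "linear_map V H f \<Longrightarrow> a \<in> carrier D \<Longrightarrow> u \<in> carrier U \<Longrightarrow>
      linear_map V U (\<lambda>x. smult U (c * a (f x)) u)"
  by (intro linear_intro linear_map_D U; assumption)+

lemma coact_mem:
  assumes M: "bicomodule D M" and m: "m \<in> carrier M"
  shows "coact D M m \<in> carrier (tensor_space D (tensor_space M D))"
proof -
  have V: "vspace M" and l: "linear_map M (tensor_space D M) (lcoact M)"
    and r: "linear_map M (tensor_space M D) (rcoact M)"
    using M by (simp_all add: bicomodule_def)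
  show ?thesis
    unfolding coact_def coact_elt_def
    by (intro carrier_intro V linear_map_closed[OF l m]) (intro carrier_intro V linear_map_closed[OF r]; assumption)+
qed

lemma linear_map_coact_sum:
  assumes M: "bicomodule D M" and m: "m \<in> carrier M" and U: "vspace U"
    and F: "\<And>a n b. a \<in> carrier D \<Longrightarrow> n \<in> carrier M \<Longrightarrow> b \<in> carrier D \<Longrightarrow>
      linear_map V U (\<lambda>x. F x a n b)"
  shows "linear_map V U (\<lambda>x. coact_sum D M m (F x))"
  unfolding coact_sum_def by (intro linear_map_tlift_fun[OF U] coact_mem[OF M m] F)

end

context fd_hopf begin

text \<open>For fixed \<open>m\<close> the action of \<open>Y\<close> is linear, hence passes
  through the sum defining \<open>phi\<close>. That sum contributes the first Sweedler legs and the
  action of \<open>Y\<close> the second and third, which is exactly the right-nested triple sum in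
  \<open>X_act\<close>.\<close>

lemma X_act_phi:
  assumes M: "hopf_bimodule D M" and m: "m \<in> carrier M"
    and a: "g \<in> C" "h \<in> C" "p \<in> carrier D" "q \<in> carrier D"
  shows "X_act H M (X_elt H g h p q) m = Y_act H M (phi H (X_elt H g h p q)) m"
proof -
  have co: "bicomodule D M" and V: "vspace M" and l: "bilinear_map D M M (lact M)"
    and r: "bilinear_map M D M (ract M)"
    using M by (simp_all add: hopf_bimodule_def bimodule_def)
  note [linear_intro] = linear_map_coact_sum[OF co m V] linear_map_eval_smult[OF V]
    bilinear_left[OF l] bilinear_right[OF l] bilinear_left[OF r] bilinear_right[OF r]
  note [carrier_intro] = V bilinear_closed[OF l] bilinear_closed[OF r]
  have Y_quad: "quadlinear M (\<lambda>g h p q. sw g (\<lambda>g1 g2. sw h (\<lambda>h1 h2. coact_sum D M m (\<lambda>a n b.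
      smult M (a g1 * b h1) (ract M (lact M p n) (rr h2 q g2))))))"
    by (intro linear_intro carrier_intro; assumption)
  have X_quad: "quadlinear M (\<lambda>g h p q. SS g h (\<lambda>g1 h1 s r. SS s r (\<lambda>g2 h2 g3 h3.
      coact_sum D M m (\<lambda>a n b.
      smult M (a g2 * b h2) (ract M (lact M (rr h1 p g1) n) (rr h3 q g3))))))"
    by (intro linear_intro carrier_intro; assumption)
  have Y_lin: "linear_map YY M (\<lambda>y. Y_act H M y m)"
    unfolding Y_act_def by (rule linear_map_Y_lift[OF V Y_quad])
  have "Y_act H M (phi H (X_elt H g h p q)) m =
      SS g h (\<lambda>g1 h1 s r. Y_act H M (Y_elt H (rr h1 p g1) r s q) m)"
    unfolding phi_elt[OF a] by (rule SS_linear[OF vspace_YY Y_lin a(1,2)]) (simp add: a)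
  also have "\<dots> = SS g h (\<lambda>g1 h1 s r. SS s r (\<lambda>g2 h2 g3 h3. coact_sum D M m (\<lambda>a n b.
      smult M (a g2 * b h2) (ract M (lact M (rr h1 p g1) n) (rr h3 q g3)))))"
    unfolding Y_act_def
    by (rule SS_cong[OF a(1,2)], rule Y_lift_elt[OF V Y_quad]) (simp_all add: a)
  also have "\<dots> = X_act H M (X_elt H g h p q) m"
    unfolding X_act_def sweedler3_SS by (rule X_lift_elt[OF V X_quad a, symmetric])
  finally show ?thesis ..
qed

end

theorem proposition2p3:
  fixes H :: "('k::field, 'h::ab_group_add) hopf"
    and M :: "('k, 'h \<Rightarrow> 'k, 'm::ab_group_add) hbimod"
  assumes "hopf_algebra H" and "finite_dimensional H"
  shows
    "(\<forall>g\<in>carrier H. \<forall>h\<in>carrier H. \<forall>p\<in>carrier (dual_hopf H). \<forall>q\<in>carrier (dual_hopf H).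
        phi H (X_elt H g h p q) =
        sweedler2 H g (\<lambda>g1 g2. sweedler2 H h (\<lambda>h1 h2.
          Y_elt H ((h1 \<rightharpoonup>\<^bsub>H\<^esub> p) \<leftharpoonup>\<^bsub>H\<^esub> g1) h2 g2 q))) \<and>
     algebra_iso (X_alg H) (Y_alg H) (phi H) \<and>
     (hopf_bimodule (dual_hopf H) M \<longrightarrow>
       (\<forall>g\<in>carrier H. \<forall>h\<in>carrier H. \<forall>p\<in>carrier (dual_hopf H). \<forall>q\<in>carrier (dual_hopf H).
        \<forall>m\<in>carrier M.
          X_act H M (X_elt H g h p q) m = Y_act H M (phi H (X_elt H g h p q)) m)) \<and>
     (\<forall>p\<in>carrier (dual_hopf H). \<forall>h\<in>carrier H. \<forall>g\<in>carrier H. \<forall>q\<in>carrier (dual_hopf H).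
        phi_inv H (Y_elt H p h g q) =
        sweedler2 H g (\<lambda>g1 g2. sweedler2 H h (\<lambda>h1 h2.
          X_elt H g2 h2
            ((antipode_inv H h1 \<rightharpoonup>\<^bsub>H\<^esub> p) \<leftharpoonup>\<^bsub>H\<^esub> antipode H g1) q))) \<and>
     linear_map (Y_alg H) (X_alg H) (phi_inv H) \<and>
     (\<forall>x\<in>carrier (X_alg H). phi_inv H (phi H x) = x) \<and>
     (\<forall>y\<in>carrier (Y_alg H). phi H (phi_inv H y) = y)"
proof -
  interpret fd_hopf H by unfold_locales (fact assms)+
  have "linear_map (Y_alg H) (X_alg H) (phi_inv H)"
    using linear_phi_inv by (simp add: linear_map_def)
  then show ?thesis
    by (intro conjI ballI impI phi_iso)
      (simp_all add: phi_elt phi_inv_elt X_act_phi phi_inv_phi phi_phi_inv)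
qed

end
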